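(* Let $\mathcal{A}$ be an arrangement of $m+n$ hyperplanes which is strictly linearly fibered over an arrangement $\mathcal{B}$ of $m$ hyperplanes in $\mathbb{C}^\ell$, let $L$ be a complex line transverse to $\mathcal{B}$, and let $C$, $Y$, $u_j$, $\mathcal{W}$, $V(j)$ be as in the context. The braid monodromy $\widehat\gamma:\mathbb{F}_m\to P_n$ of the bundle $\widehat p:Y\to C$, and hence that of the strictly linearly fibered bundle $p:M(\mathcal{A})\to M(\mathcal{B})$, is given, for $1\le j\le m$, by $$\gamma\circ i_*(u_j)=\widehat\gamma(u_j)=\prod_{k=1}^{r}A_{V_k(j)}^{\zeta_k}=\prod_{k=1}^{r}\zeta_k^{-1}\cdot A_{V_k(j)}\cdot\zeta_k,$$ where $V(j)=(V_1(j)\mid\dots\mid V_r(j))$ and $\zeta_k\in P_n$ is a pure braid determined by the subdiagram $\mathcal{W}_{j-1}$ of $\mathcal{W}$ and the block $V_k(j)$.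
   Context: Arrangements are finite collections of affine hyperplanes in a complex affine space; $M(\mathcal{A})$ is the complement and $G(\mathcal{A})=\pi_1(M(\mathcal{A}))$. $F(\mathbb{C},n)$ is the configuration space of $n$ ordered distinct points in $\mathbb{C}$, $P_n=\pi_1(F(\mathbb{C},n))$ the pure braid group, contained in the braid group $B_n=\langle\sigma_1,\dots,\sigma_{n-1}\rangle$, with generators $A_{i,j}=\sigma_{j-1}\cdots\sigma_{i+1}\sigma_i^2\sigma_{i+1}^{-1}\cdots\sigma_{j-1}^{-1}$, $1\le i<j\le n$. Write $u^v=v^{-1}uv$. $\mathcal{A}$ in $\mathbb{C}^{\ell+1}$ is strictly linearly fibered over $\mathcal{B}$ in $\mathbb{C}^\ell$ if there are coordinates $(\mathbf{x},z)$ on $\mathbb{C}^{\ell+1}$ such that the restriction $p$ of $(\mathbf{x},z)\mapsto\mathbf{x}$ to $M(\mathcal{A})$ is a fiber bundle projection onto $M(\mathcal{B})$ with fiber the complement of finitely many points in $\mathbb{C}$. Then $\mathcal{A}$ is defined by $Q(\mathcal{B})(\mathbf{x})\cdot\phi(\mathbf{x},z)$, $\phi=\prod_{j=1}^n(z-g_j(\mathbf{x}))$ with $g_j$ (affine) linear; the root map is $g=(g_1,\dots,g_n):M(\mathcal{B})\to F(\mathbb{C},n)$, and $\gamma=g_*:G(\mathcal{B})\to P_n$ is called the braid monodromy of $p$. Let $L\cong\mathbb{C}$ (coordinate $x$) be transverse to $\mathcal{B}=\{H_1,\dots,H_m\}$, let $q_1,\dots,q_m$ be the $m$ distinct points where $L$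 meets the hyperplanes of $\mathcal{B}$, let $C=L\setminus\{q_1,\dots,q_m\}$, let $i:C\hookrightarrow M(\mathcal{B})$ be the inclusion, and let $\widehat\gamma=(g\circ i)_*=\gamma\circ i_*:\pi_1(C)=\mathbb{F}_m\to P_n$. Let $\phi(x,z)$ be the restriction of $\phi$ to $L$; it defines an arrangement $\mathcal{H}$ of $n$ lines in $\mathbb{C}^2$ whose multiple points lie on the lines $x=q_j$. Put $Y=\{(x,z)\in C\times\mathbb{C}\mid\phi(x,z)\neq0\}$ and $\widehat p(x,z)=x$. Order the $q_j$ by decreasing real part, ties broken by increasing imaginary part. Fix a basepoint $q_0\in C$ with $\mathrm{Re}(q_0)>\mathrm{Re}(q_1)$ and a path $\xi$ in $\mathbb{C}$ from $q_0$ passing through $q_1,q_2,\dots,q_m$ in order, which in a small disk $D_\epsilon(q_j)$ is a horizontal segment traversed from right to left; let $q_j'=q_j+\epsilon$ and $q_j''=q_j-\epsilon$ be its entry and exit points. Let $\xi_{j,j+1}$ be the part of $\xi$ from $q_j''$ to $q_{j+1}'$, and $\xi_j'$, $\xi_j''$ the counterclockwise arcs of $\partial D_\epsilon(q_j)$ from $q_j'$ to $q_j''$ and from $q_j''$ to $q_j'$. The part of $\xi$ from $q_0$ to $q_1'$ is taken to contribute the trivial braid. $u_j\in\pi_1(C,q_0)$ is the class of the loop which follows $\xi$, replacing passage through each $q_i$, $i<j$, by $\xi_i'$, then goes once around $q_j$ along $\xi_j'$ and $\xi_j''$, and returns the same way; $\mathbb{F}_m=\langle u_1,\dots,u_m\rangle$.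 The braided wiring diagram is $\mathcal{W}=\{(x,z)\in\xi\times\mathbb{C}\mid\phi(x,z)=0\}$, recorded as a sequence $\{I(1),\beta_{1,2},I(2),\beta_{2,3},\dots,I(m),\beta_{m,m+1}\}$. Here $\beta_{j,j+1}\in B_n$ is the braid obtained by tracing the $n$ points of $\mathcal{W}$ over $\xi_{j,j+1}$, and $I(j)$ is the partition of $\{1,\dots,n\}$, assumed to have blocks of consecutive integers, recording which lines of $\mathcal{H}$ (in their order by increasing real part of $z$, ties broken by imaginary part, over $x=q_j'$) meet over $x=q_j$ (singletons for lines not meeting others there). The subdiagram $\mathcal{W}_{j-1}$ is $\{I(1),\beta_{1,2},\dots,I(j-1),\beta_{j-1,j}\}$. $V(j)=(V_1(j)\mid\dots\mid V_r(j))$ is the partition of $\{1,\dots,n\}$ recording which lines of $\mathcal{H}$ meet over $x=q_j$, but with the lines indexed by their order over the basepoint $x=q_0$. For a block $V=\{k_1<\dots<k_s\}$, $A_V=(A_{k_1,k_2})(A_{k_1,k_3}A_{k_2,k_3})\cdots(A_{k_1,k_s}\cdots A_{k_{s-1},k_s})$, with $A_V=1$ if $s=1$.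
   Formalization: It is additionally assumed that two lines of H not meeting over x=q_j have the same order over q_j' and q_j''; otherwise a real-part swap over q_j is not recorded in W, and the braids ζ_k are not determined by W_{j-1} and V_k(j). *)

theory Defs
  imports
    "HOL-Complex_Analysis.Complex_Analysis"
    "HOL-Algebra.Group"
    "HOL-Combinatorics.Permutations"
begin

section \<open>Fundamental groups\<close>

definition path_class :: "'a::topological_space set \<Rightarrow> (real \<Rightarrow> 'a) \<Rightarrow> (real \<Rightarrow> 'a) set" where
  "path_class S p = {r. homotopic_paths S p r}"

definition fundamental_group :: "'a::topological_space set \<Rightarrow> 'a \<Rightarrow> (real \<Rightarrow> 'a) set monoid" where
  "fundamental_group S x =
    \<lparr>carrier = {path_class S p | p. path p \<and> path_image p \<subseteq> S \<and> pathstart p = x \<and> pathfinish p = x},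
     mult = (\<lambda>P Q. {r. \<exists>p\<in>P. \<exists>q\<in>Q. homotopic_paths S (p +++ q) r}),
     one = path_class S (\<lambda>_. x)\<rparr>"

definition induced_map ::
  "'b::topological_space set \<Rightarrow> ('a::topological_space \<Rightarrow> 'b) \<Rightarrow> (real \<Rightarrow> 'a) set \<Rightarrow> (real \<Rightarrow> 'b) set" where
  "induced_map T f P = {r. \<exists>p\<in>P. homotopic_paths T (f \<circ> p) r}"

section \<open>Affine arrangements and strictly linearly fibered arrangements\<close>

text \<open>The space of \<open>d\<close>-tuples of complex numbers, indexed by \<open>1, \<dots>, d\<close>, with the product topology.\<close>

definition cspace :: "nat \<Rightarrow> (nat \<Rightarrow> complex) set" where
  "cspace d = {x. \<forall>i. i \<notin> {1..d} \<longrightarrow> x i = 0}"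

definition affine_form :: "nat \<Rightarrow> ((nat \<Rightarrow> complex) \<Rightarrow> complex) \<Rightarrow> bool" where
  "affine_form d f \<longleftrightarrow> (\<exists>a b. \<forall>x\<in>cspace d. f x = (\<Sum>i=1..d. a i * x i) + b)"

definition affine_hyperplane :: "nat \<Rightarrow> (nat \<Rightarrow> complex) set \<Rightarrow> bool" where
  "affine_hyperplane d H \<longleftrightarrow>
     (\<exists>a b. (\<exists>i\<in>{1..d}. a i \<noteq> 0) \<and> H = {x\<in>cspace d. (\<Sum>i=1..d. a i * x i) = b})"

definition arrangement :: "nat \<Rightarrow> (nat \<Rightarrow> complex) set set \<Rightarrow> bool" where
  "arrangement d \<A> \<longleftrightarrow> finite \<A> \<and> (\<forall>H\<in>\<A>. affine_hyperplane d H)"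

definition arr_complement :: "nat \<Rightarrow> (nat \<Rightarrow> complex) set set \<Rightarrow> (nat \<Rightarrow> complex) set" where
  "arr_complement d \<A> = cspace d - \<Union>\<A>"

definition fiber_bundle ::
  "'e::topological_space set \<Rightarrow> 'b::topological_space set \<Rightarrow> 'f::topological_space set \<Rightarrow> ('e \<Rightarrow> 'b) \<Rightarrow> bool" where
  "fiber_bundle E B F p \<longleftrightarrow>
     continuous_on E p \<and> p ` E = B \<and>
     (\<forall>b\<in>B. \<exists>U h k. b \<in> U \<and> openin (top_of_set B) U \<and>
        homeomorphism (E \<inter> p -` U) (U \<times> F) h k \<and> (\<forall>e\<in>E \<inter> p -` U. fst (h e) = p e))"

text \<open>Affine coordinates \<open>(X, Z)\<close>, with \<open>X\<close> an \<open>l\<close>-tuple, on a space of dimension \<open>l + 1\<close>.\<close>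

definition affine_coordinates ::
  "nat \<Rightarrow> ((nat \<Rightarrow> complex) \<Rightarrow> (nat \<Rightarrow> complex)) \<Rightarrow> ((nat \<Rightarrow> complex) \<Rightarrow> complex) \<Rightarrow> bool" where
  "affine_coordinates l X Z \<longleftrightarrow>
     (\<forall>i\<in>{1..l}. affine_form (l + 1) (\<lambda>v. X v i)) \<and> affine_form (l + 1) Z \<and>
     bij_betw (\<lambda>v. (X v, Z v)) (cspace (l + 1)) (cspace l \<times> UNIV)"

definition strictly_linearly_fibered_via ::
  "nat \<Rightarrow> (nat \<Rightarrow> complex) set set \<Rightarrow> (nat \<Rightarrow> complex) set set \<Rightarrow>
   ((nat \<Rightarrow> complex) \<Rightarrow> (nat \<Rightarrow> complex)) \<Rightarrow> ((nat \<Rightarrow> complex) \<Rightarrow> complex) \<Rightarrow> bool" where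
  "strictly_linearly_fibered_via l \<A> \<B> X Z \<longleftrightarrow>
     arrangement (l + 1) \<A> \<and> arrangement l \<B> \<and> affine_coordinates l X Z \<and>
     (\<exists>D :: complex set. finite D \<and>
        fiber_bundle (arr_complement (l + 1) \<A>) (arr_complement l \<B>) (- D) X)"

definition conf :: "nat \<Rightarrow> (nat \<Rightarrow> complex) set" where
  "conf n = {y\<in>cspace n. inj_on y {1..n}}"

text \<open>\<open>g\<close> is a root map: in the coordinates \<open>(x, z)\<close>, the arrangement \<open>\<A>\<close> is defined by
  \<open>Q(\<B>)(x) * (\<Prod>j=1..n. z - g x j)\<close>.\<close>

definition root_map ::
  "nat \<Rightarrow> nat \<Rightarrow> (nat \<Rightarrow> complex) set set \<Rightarrow> (nat \<Rightarrow> complex) set set \<Rightarrow>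
   ((nat \<Rightarrow> complex) \<Rightarrow> (nat \<Rightarrow> complex)) \<Rightarrow> ((nat \<Rightarrow> complex) \<Rightarrow> complex) \<Rightarrow>
   ((nat \<Rightarrow> complex) \<Rightarrow> (nat \<Rightarrow> complex)) \<Rightarrow> bool" where
  "root_map l n \<A> \<B> X Z g \<longleftrightarrow>
     (\<forall>j\<in>{1..n}. affine_form l (\<lambda>x. g x j)) \<and>
     (\<forall>x\<in>cspace l. g x \<in> cspace n) \<and>
     g ` arr_complement l \<B> \<subseteq> conf n \<and>
     \<A> = (\<lambda>H. {v\<in>cspace (l + 1). X v \<in> H}) ` \<B> \<union>
         (\<lambda>j. {v\<in>cspace (l + 1). Z v = g (X v) j}) ` {1..n}"

section \<open>Braid groups\<close>

definition std_conf :: "nat \<Rightarrow> nat \<Rightarrow> complex" where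
  "std_conf n i = (if i \<in> {1..n} then of_nat i else 0)"

text \<open>The braid group is the fundamental group of the space of \<open>n\<close> unordered points, based at
  \<open>{1, \<dots>, n}\<close>, described through lifts to \<open>conf n\<close>: an element is a homotopy class of paths
  in \<open>conf n\<close> from the standard configuration to one of its relabellings. In a product the
  second factor is relabelled so that it starts where the first one ends. The first factor is
  traversed first.\<close>

type_synonym braid = "(real \<Rightarrow> nat \<Rightarrow> complex) set"

definition braid_group :: "nat \<Rightarrow> braid monoid" where
  "braid_group n =
    \<lparr>carrier = {path_class (conf n) p | p. path p \<and> path_image p \<subseteq> conf n \<and> pathstart p = std_conf n \<and>
                 (\<exists>\<pi>. \<pi> permutes {1..n} \<and> pathfinish p = std_conf n \<circ> \<pi>)},
     mult = (\<lambda>P Q. {r. \<exists>p\<in>P. \<exists>q\<in>Q. \<exists>\<pi>. \<pi> permutes {1..n} \<and> pathfinish p = std_conf n \<circ> \<pi> \<and>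
                 homotopic_paths (conf n) (p +++ (\<lambda>t. q t \<circ> \<pi>)) r}),
     one = path_class (conf n) (\<lambda>_. std_conf n)\<rparr>"

definition pure_braid_group :: "nat \<Rightarrow> braid monoid" where
  "pure_braid_group n = fundamental_group (conf n) (std_conf n)"

definition braid_word :: "nat \<Rightarrow> braid list \<Rightarrow> braid" where
  "braid_word n bs = foldr (\<otimes>\<^bsub>braid_group n\<^esub>) bs \<one>\<^bsub>braid_group n\<^esub>"

text \<open>The generator \<open>\<sigma>\<^sub>i\<close>, for \<open>1 \<le> i < n\<close>, is the counterclockwise half twist of the
  points \<open>i\<close> and \<open>i + 1\<close>. The orientation matters: lines through a common point wind
  counterclockwise around each other along a counterclockwise loop in the base.\<close>

definition sigma :: "nat \<Rightarrow> nat \<Rightarrow> braid" where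
  "sigma n i = path_class (conf n)
     (\<lambda>t k. if k = i then of_nat i + 1/2 - exp (\<i> * of_real (pi * t)) / 2
            else if k = i + 1 then of_nat i + 1/2 + exp (\<i> * of_real (pi * t)) / 2
            else std_conf n k)"

definition pure_gen :: "nat \<Rightarrow> nat \<Rightarrow> nat \<Rightarrow> braid" where
  "pure_gen n i j = braid_word n
     (map (sigma n) (rev [Suc i..<j]) @ [sigma n i, sigma n i] @
      map (\<lambda>k. inv\<^bsub>braid_group n\<^esub> (sigma n k)) [Suc i..<j])"

definition block_twist :: "nat \<Rightarrow> nat set \<Rightarrow> braid" where
  "block_twist n V = braid_word n
     (concat (map (\<lambda>b. map (\<lambda>a. pure_gen n a b) (sorted_list_of_set {a\<in>V. a < b}))
        (sorted_list_of_set V)))"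

definition braid_conj :: "nat \<Rightarrow> braid \<Rightarrow> braid \<Rightarrow> braid" where
  "braid_conj n u v = inv\<^bsub>braid_group n\<^esub> v \<otimes>\<^bsub>braid_group n\<^esub> u \<otimes>\<^bsub>braid_group n\<^esub> v"

section \<open>Braids traced by paths of configurations\<close>

definition lex_less :: "complex \<Rightarrow> complex \<Rightarrow> bool" where
  "lex_less z w \<longleftrightarrow> Re z < Re w \<or> (Re z = Re w \<and> Im z < Im w)"

definition lex_pos :: "nat \<Rightarrow> (nat \<Rightarrow> complex) \<Rightarrow> nat \<Rightarrow> nat" where
  "lex_pos n y i = (if i \<in> {1..n} then Suc (card {k\<in>{1..n}. lex_less (y k) (y i)}) else i)"

definition straight :: "(nat \<Rightarrow> complex) \<Rightarrow> (nat \<Rightarrow> complex) \<Rightarrow> real \<Rightarrow> nat \<Rightarrow> complex" where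
  "straight y w t i = of_real (1 - t) * y i + of_real t * w i"

text \<open>A path \<open>c\<close> in \<open>conf n\<close> with arbitrary end points determines a braid: its strands are
  relabelled by their initial order, and both ends are joined to the standard configuration by
  straight segments. These stay in \<open>conf n\<close>, because convex combinations of lexicographically
  increasing tuples are lexicographically increasing.\<close>

definition traced_braid :: "nat \<Rightarrow> (real \<Rightarrow> nat \<Rightarrow> complex) \<Rightarrow> braid" where
  "traced_braid n c =
     (let c' = (\<lambda>t. c t \<circ> inv_into UNIV (lex_pos n (c 0)))
      in path_class (conf n)
           (straight (std_conf n) (c' 0) +++ c' +++ straight (c' 1) (std_conf n \<circ> lex_pos n (c' 1))))"

text \<open>The homomorphism induced by a map \<open>f\<close> into \<open>conf n\<close>, on the fundamental group based at
  \<open>x0\<close>. Its target is identified with the pure braid group along the straight segment from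
  the standard configuration. This is used only when the entries of \<open>f x0\<close> are
  lexicographically increasing.\<close>

definition braid_monodromy ::
  "nat \<Rightarrow> ('a::topological_space \<Rightarrow> nat \<Rightarrow> complex) \<Rightarrow> 'a \<Rightarrow> (real \<Rightarrow> 'a) set \<Rightarrow> braid" where
  "braid_monodromy n f x0 P =
     {r. \<exists>p\<in>induced_map (conf n) f P.
        homotopic_paths (conf n) (straight (std_conf n) (f x0) +++ p +++ straight (f x0) (std_conf n)) r}"

section \<open>Transverse lines, paths and loops in the base\<close>

definition aff_line :: "(nat \<Rightarrow> complex) \<Rightarrow> (nat \<Rightarrow> complex) \<Rightarrow> complex \<Rightarrow> nat \<Rightarrow> complex" where
  "aff_line a v x = (\<lambda>i. a i + x * v i)"

definition transverse_line ::
  "nat \<Rightarrow> (nat \<Rightarrow> complex) set set \<Rightarrow> (nat \<Rightarrow> complex) \<Rightarrow> (nat \<Rightarrow> complex) \<Rightarrow> bool" where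
  "transverse_line l \<B> a v \<longleftrightarrow>
     a \<in> cspace l \<and> v \<in> cspace l \<and> v \<noteq> (\<lambda>_. 0) \<and>
     (\<forall>H\<in>\<B>. \<exists>!x. aff_line a v x \<in> H) \<and>
     (\<forall>H\<in>\<B>. \<forall>H'\<in>\<B>. H \<noteq> H' \<longrightarrow> aff_line a v -` H \<inter> aff_line a v -` H' = {})"

text \<open>\<open>q\<close> lists the points of the finite set \<open>Q\<close> by decreasing real part, ties broken by
  increasing imaginary part.\<close>

definition ordered_points :: "nat \<Rightarrow> complex set \<Rightarrow> (nat \<Rightarrow> complex) \<Rightarrow> bool" where
  "ordered_points m Q q \<longleftrightarrow> bij_betw q {1..m} Q \<and>
     (\<forall>i\<in>{1..m}. \<forall>j\<in>{1..m}. i < j \<longrightarrow>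
        Re (q j) < Re (q i) \<or> (Re (q i) = Re (q j) \<and> Im (q i) < Im (q j)))"

text \<open>A path from \<open>q0\<close> through \<open>q 1, \<dots>, q m\<close> which runs along the horizontal diameter, from
  right to left, of each disk of radius \<open>\<epsilon>\<close> around a \<open>q j\<close>. It is given by its pieces
  outside the disks: \<open>\<xi> 0\<close> ends at \<open>q 1 + \<epsilon>\<close>, \<open>\<xi> j\<close> runs from \<open>q j - \<epsilon>\<close> to
  \<open>q (j + 1) + \<epsilon>\<close>, and \<open>\<xi> m\<close> is the part after the last disk.\<close>

definition base_path ::
  "nat \<Rightarrow> (nat \<Rightarrow> complex) \<Rightarrow> complex \<Rightarrow> real \<Rightarrow> (nat \<Rightarrow> real \<Rightarrow> complex) \<Rightarrow> bool" where
  "base_path m q q0 \<epsilon> \<xi> \<longleftrightarrow>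
     q0 \<notin> q ` {1..m} \<and> (1 \<le> m \<longrightarrow> Re (q 1) < Re q0) \<and> 0 < \<epsilon> \<and>
     (\<forall>i\<in>{1..m}. \<forall>j\<in>{1..m}. i \<noteq> j \<longrightarrow> cball (q i) \<epsilon> \<inter> cball (q j) \<epsilon> = {}) \<and>
     (\<forall>j\<le>m. path (\<xi> j) \<and> path_image (\<xi> j) \<inter> (\<Union>i\<in>{1..m}. ball (q i) \<epsilon>) = {}) \<and>
     pathstart (\<xi> 0) = q0 \<and>
     (\<forall>j\<in>{1..m}. pathstart (\<xi> j) = q j - of_real \<epsilon>) \<and>
     (\<forall>j<m. pathfinish (\<xi> j) = q (Suc j) + of_real \<epsilon>)"

definition upper_arc :: "complex \<Rightarrow> real \<Rightarrow> real \<Rightarrow> complex" where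
  "upper_arc c \<epsilon> = part_circlepath c \<epsilon> 0 pi"

definition lower_arc :: "complex \<Rightarrow> real \<Rightarrow> real \<Rightarrow> complex" where
  "lower_arc c \<epsilon> = part_circlepath c \<epsilon> pi (2 * pi)"

text \<open>The path from \<open>q0\<close> to \<open>q (k + 1) + \<epsilon>\<close> which avoids \<open>q 1, \<dots>, q k\<close> along the upper
  arcs.\<close>

primrec approach ::
  "(nat \<Rightarrow> complex) \<Rightarrow> real \<Rightarrow> (nat \<Rightarrow> real \<Rightarrow> complex) \<Rightarrow> nat \<Rightarrow> real \<Rightarrow> complex" where
  "approach q \<epsilon> \<xi> 0 = \<xi> 0"
| "approach q \<epsilon> \<xi> (Suc k) = approach q \<epsilon> \<xi> k +++ (upper_arc (q (Suc k)) \<epsilon> +++ \<xi> (Suc k))"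

definition base_loop ::
  "nat \<Rightarrow> (nat \<Rightarrow> complex) \<Rightarrow> real \<Rightarrow> (nat \<Rightarrow> real \<Rightarrow> complex) \<Rightarrow> nat \<Rightarrow> (real \<Rightarrow> complex) set" where
  "base_loop m q \<epsilon> \<xi> j = path_class (- q ` {1..m})
     (approach q \<epsilon> \<xi> (j - 1) +++ (upper_arc (q j) \<epsilon> +++ lower_arc (q j) \<epsilon>) +++
      reversepath (approach q \<epsilon> \<xi> (j - 1)))"

section \<open>Braided wiring diagrams\<close>

text \<open>Here \<open>f\<close> is the restriction of a root map to a transverse line, so that the lines are
  \<open>z = f x i\<close> for \<open>i = 1, \<dots>, n\<close>.\<close>

definition meeting_partition :: "nat \<Rightarrow> (complex \<Rightarrow> nat \<Rightarrow> complex) \<Rightarrow> complex \<Rightarrow> nat set set" where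
  "meeting_partition n f c = {1..n} // {(i, k). i \<in> {1..n} \<and> k \<in> {1..n} \<and> f c i = f c k}"

definition local_partition ::
  "nat \<Rightarrow> (complex \<Rightarrow> nat \<Rightarrow> complex) \<Rightarrow> complex \<Rightarrow> real \<Rightarrow> nat set set" where
  "local_partition n f c \<epsilon> = (\<lambda>V. lex_pos n (f (c + of_real \<epsilon>)) ` V) ` meeting_partition n f c"

definition wiring_diagram ::
  "nat \<Rightarrow> (complex \<Rightarrow> nat \<Rightarrow> complex) \<Rightarrow> nat \<Rightarrow> (nat \<Rightarrow> complex) \<Rightarrow> real \<Rightarrow> (nat \<Rightarrow> real \<Rightarrow> complex) \<Rightarrow>
   (nat set set \<times> braid) list" where
  "wiring_diagram n f m q \<epsilon> \<xi> =
     map (\<lambda>j. (local_partition n f (q j) \<epsilon>, traced_braid n (f \<circ> \<xi> j))) [1..<Suc m]"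

text \<open>The lines are indexed by their order over \<open>q0\<close>, the first piece of the path contributes
  the trivial braid, the blocks over each \<open>q j\<close> are consecutive, and the disks are small
  enough that the partition is all that happens over their diameters: two lines that do not
  meet over \<open>q j\<close> have the same order over both end points. The last condition cannot be
  omitted, since the partition does not record a crossing (in real part) over \<open>q j\<close> of two
  lines that do not meet.\<close>

definition braided_wiring ::
  "nat \<Rightarrow> (complex \<Rightarrow> nat \<Rightarrow> complex) \<Rightarrow> nat \<Rightarrow> (nat \<Rightarrow> complex) \<Rightarrow> complex \<Rightarrow> real \<Rightarrow>
   (nat \<Rightarrow> real \<Rightarrow> complex) \<Rightarrow> bool" where
  "braided_wiring n f m q q0 \<epsilon> \<xi> \<longleftrightarrow>
     (\<forall>i\<in>{1..n}. \<forall>k\<in>{1..n}. i < k \<longrightarrow> lex_less (f q0 i) (f q0 k)) \<and>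
     (1 \<le> m \<longrightarrow> traced_braid n (f \<circ> \<xi> 0) = \<one>\<^bsub>braid_group n\<^esub>) \<and>
     (\<forall>j\<in>{1..m}.
        (\<forall>U\<in>local_partition n f (q j) \<epsilon>. \<exists>a b. U = {a..b}) \<and>
        (\<forall>i\<in>{1..n}. \<forall>k\<in>{1..n}. f (q j) i \<noteq> f (q j) k \<longrightarrow>
           (lex_less (f (q j + of_real \<epsilon>) i) (f (q j + of_real \<epsilon>) k) \<longleftrightarrow>
            lex_less (f (q j - of_real \<epsilon>) i) (f (q j - of_real \<epsilon>) k))))"

end

theory Submission
  imports Defs
begin

text \<open>A path of configurations whose ends lie anywhere in \<open>conf n\<close> has a traced braid, because the
  configurations with a given lexicographic order form a convex set. Traced braids are multiplicative,
  and two paths trace the same braid if every difference of two strands can be deformed linearly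
  from one to the other without passing through the origin. This last principle replaces all pictures.

  Near \<open>q j\<close> the lines are deformed to a standard position which depends only on \<open>I(j)\<close>: over the half
  circle they trace a braid determined by \<open>I(j)\<close>, and over the full circle the blocks turn independently,
  each by a rigid full turn. Hence the braid \<open>P\<close> traced over the path to \<open>q j\<close> is determined by the subdiagram,
  and \<open>u j\<close> is sent to the product of the \<open>P F P\<^sup>-\<^sup>1\<close>, where \<open>F\<close> is the full turn of a block. Lifting the points
  of \<open>V\<close> above the others shows both that \<open>A V\<close> is the full turn of \<open>V\<close> and that any permutation
  of the points is realised by a braid \<open>\<gamma>\<close> conjugating the full turn of \<open>V\<close> to that of its image.
  If \<open>\<gamma>\<close> and \<open>P\<close> have the same permutation, then \<open>\<zeta> = \<gamma> P\<^sup>-\<^sup>1\<close> is pure.\<close>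

section \<open>Homotopies of paths in topological spaces\<close>

text \<open>The choice of order matters: for \<open>z \<noteq> 0\<close> exactly one of
  \<open>z\<close> and \<open>- z\<close> is lexicographically positive, and the positive vectors
  form a convex cone. So every configuration lies in exactly one convex cell, and ties of real parts
  need no separate treatment. The obstacle is that \<open>\<zeta>\<close> may depend only on a list
  of partitions and braids, while the lines near \<open>q j\<close> have arbitrary positions and
  slopes. Over the full unit circle a linear deformation of one such family into another can make
  strands collide, since differences are known to be lexicographically positive only at
  \<open>1\<close> and \<open>-1\<close>. Shrinking the circle first helps: for lines that do not
  meet, the constant terms then dominate; for lines that meet, the factor \<open>u\<close> splits
  off and only slopes are interpolated. The permutation of \<open>P\<close> is likewise taken from
  the braid itself, namely from the end point shared by all its representatives. Lifting a block
  turns the combinatorics of its labels into heights: a block whose points are not adjacent can turn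
  rigidly, and the generators are read off from who passes above whom.\<close>

lemma homotopic_paths_convex_image:
  fixes F :: "'b::real_normed_vector \<Rightarrow> 'a::topological_space"
  assumes "convex K" "continuous_on K F" "F ` K \<subseteq> S"
    and "path p" "path_image p \<subseteq> K" "path q" "path_image q \<subseteq> K"
    and "pathstart p = pathstart q" "pathfinish p = pathfinish q"
  shows "homotopic_paths S (F \<circ> p) (F \<circ> q)"
proof (rule homotopic_paths_continuous_image[OF _ assms(2)])
  \<comment> \<open>The target need not have a linear structure
    (\<open>nat \<Rightarrow> complex\<close> carries no norm), so the linear homotopy is made in
    the convex parameter set \<open>K\<close> and pushed forward by \<open>F\<close>.\<close>
  show "homotopic_paths K p q"
  proof (rule homotopic_paths_linear)
    fix t :: real assume "t \<in> {0..1}"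
    then have "p t \<in> K" "q t \<in> K"
      using assms by (auto simp: path_image_def)
    then show "closed_segment (p t) (q t) \<subseteq> K"
      using assms(1) by (simp add: closed_segment_subset)
  qed (use assms in auto)
qed (use assms(3) in auto)

lemma path_comp_linepath01: "p \<circ> linepath 0 1 = p"
  by (auto simp: linepath_def)

lemma joinpaths_compose: "f \<circ> (p +++ q) = (f \<circ> p) +++ (f \<circ> q)"
  by (auto simp: joinpaths_def)

lemma path_continuous_on: "path p \<Longrightarrow> continuous_on {0..1} p"
  by (simp add: path_def)

context
  fixes p :: "real \<Rightarrow> 'a::topological_space" and S
  assumes p: "path p" "path_image p \<subseteq> S"
begin

private lemma image01: "p ` {0..1} \<subseteq> S"
  using p(2) by (simp add: path_image_def)

text \<open>Both sides are \<open>p\<close> composed with a broken line from 0 to 1 in the unit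
  interval, so convexity of the interval suffices. The next two lemmas use the same device with
  other broken lines.\<close>

lemma homotopic_paths_rid_const:
  "homotopic_paths S (p +++ (\<lambda>_. pathfinish p)) p"
proof -
  have "homotopic_paths S (p \<circ> (linepath 0 1 +++ linepath 1 1)) (p \<circ> linepath 0 1)"
    by (rule homotopic_paths_convex_image[OF _ path_continuous_on[OF p(1)] image01])
      (auto simp: path_image_join closed_segment_eq_real_ivl)
  moreover have "p \<circ> (linepath 0 1 +++ linepath 1 1) = p +++ (\<lambda>_. pathfinish p)"
    by (auto simp: joinpaths_def linepath_def pathfinish_def fun_eq_iff algebra_simps)
  ultimately show ?thesis
    by (simp add: path_comp_linepath01)
qed

lemma homotopic_paths_lid_const:
  "homotopic_paths S ((\<lambda>_. pathstart p) +++ p) p"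
proof -
  have "homotopic_paths S (p \<circ> (linepath 0 0 +++ linepath 0 1)) (p \<circ> linepath 0 1)"
    by (rule homotopic_paths_convex_image[OF _ path_continuous_on[OF p(1)] image01])
      (auto simp: path_image_join closed_segment_eq_real_ivl)
  moreover have "p \<circ> (linepath 0 0 +++ linepath 0 1) = (\<lambda>_. pathstart p) +++ p"
    by (auto simp: joinpaths_def linepath_def pathstart_def fun_eq_iff algebra_simps)
  ultimately show ?thesis
    by (simp add: path_comp_linepath01)
qed

lemma homotopic_paths_rinv_const:
  "homotopic_paths S (p +++ reversepath p) (\<lambda>_. pathstart p)"
proof -
  have "homotopic_paths S (p \<circ> (linepath 0 1 +++ linepath 1 0)) (p \<circ> linepath 0 0)"
    by (rule homotopic_paths_convex_image[OF _ path_continuous_on[OF p(1)] image01])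
      (auto simp: path_image_join closed_segment_eq_real_ivl)
  moreover have "p \<circ> (linepath 0 1 +++ linepath 1 0) = p +++ reversepath p"
    by (auto simp: joinpaths_def linepath_def reversepath_def fun_eq_iff algebra_simps)
  moreover have "p \<circ> linepath 0 0 = (\<lambda>_. pathstart p)"
    by (auto simp: pathstart_def linepath_def)
  ultimately show ?thesis
    by (simp add: path_comp_linepath01)
qed

end

lemma homotopic_paths_linv_const:
  assumes "path p" "path_image p \<subseteq> S"
  shows "homotopic_paths S (reversepath p +++ p) (\<lambda>_. pathfinish p)"
  using homotopic_paths_rinv_const[of "reversepath p" S] assms by simp

lemma path_const: "path (\<lambda>_. x)"
  by (simp add: path_def)

lemma path_image_const: "path_image (\<lambda>_. x) = {x}"
  by (auto simp: path_image_def)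

text \<open>The two ways around the boundary are homotopic in the square because the square is
  convex. This is the source of every relation between traced braids obtained from a two-parameter
  family.\<close>

lemma homotopic_square:
  fixes h :: "real \<times> real \<Rightarrow> 'a::topological_space"
  assumes "continuous_on ({0..1} \<times> {0..1}) h" "h ` ({0..1} \<times> {0..1}) \<subseteq> S"
  shows "homotopic_paths S ((\<lambda>t. h (0, t)) +++ (\<lambda>s. h (s, 1))) ((\<lambda>s. h (s, 0)) +++ (\<lambda>t. h (1, t)))"
proof -
  have K: "convex ({0..1} \<times> {0..1} :: (real \<times> real) set)"
    by (intro convex_Times convex_real_interval)
  have seg: "closed_segment a b \<subseteq> {0..1} \<times> {0..1}" if "a \<in> {0..1} \<times> {0..1}" "b \<in> {0..1} \<times> {0..1}"
    for a b :: "real \<times> real"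
    using that K by (rule closed_segment_subset)
  have "homotopic_paths S (h \<circ> (linepath (0,0) (0,1) +++ linepath (0,1) (1,1)))
      (h \<circ> (linepath (0,0) (1,0) +++ linepath (1,0) (1,1)))"
    by (rule homotopic_paths_convex_image[OF K assms]) (simp_all add: seg subset_path_image_join)
  moreover have "h \<circ> (linepath (0,0) (0,1) +++ linepath (0,1) (1,1)) = (\<lambda>t. h (0, t)) +++ (\<lambda>s. h (s, 1))"
    "h \<circ> (linepath (0,0) (1,0) +++ linepath (1,0) (1,1)) = (\<lambda>s. h (s, 0)) +++ (\<lambda>t. h (1, t))"
    by (auto simp: joinpaths_def linepath_def fun_eq_iff)
  ultimately show ?thesis by simp
qed

lemma path_class_eqI: "homotopic_paths S p q \<Longrightarrow> path_class S p = path_class S q"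
  unfolding path_class_def by (blast intro: homotopic_paths_sym homotopic_paths_trans)

lemma path_class_self: "path p \<Longrightarrow> path_image p \<subseteq> S \<Longrightarrow> p \<in> path_class S p"
  by (simp add: path_class_def)

lemma homotopic_paths_assoc':
  assumes "path p" "path_image p \<subseteq> S" "path q" "path_image q \<subseteq> S" "path r" "path_image r \<subseteq> S"
    "pathfinish p = pathstart q" "pathfinish q = pathstart r"
  shows "homotopic_paths S ((p +++ q) +++ r) (p +++ (q +++ r))"
  by (rule homotopic_paths_sym, rule homotopic_paths_assoc) (use assms in auto)

section \<open>The braid group\<close>

declare One_nat_def [simp del]

abbreviation (input) "Br \<equiv> braid_group"

lemma conf_comp_permutes: "y \<in> conf n \<Longrightarrow> \<pi> permutes {1..n} \<Longrightarrow> y \<circ> \<pi> \<in> conf n"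
  unfolding conf_def cspace_def
  by (auto simp: permutes_not_in permutes_image intro!: comp_inj_on permutes_inj_on)

lemma continuous_on_comp_permutation: "continuous_on A (\<lambda>y. (y :: nat \<Rightarrow> complex) \<circ> \<pi>)"
  by (intro continuous_on_coordinatewise_then_product) (auto intro: continuous_on_product_then_coordinatewise continuous_on_id)

lemma homotopic_paths_relabel:
  assumes "homotopic_paths (conf n) p q" "\<pi> permutes {1..n}"
  shows "homotopic_paths (conf n) (\<lambda>t. p t \<circ> \<pi>) (\<lambda>t. q t \<circ> \<pi>)"
  using homotopic_paths_continuous_image[OF assms(1) continuous_on_comp_permutation, of \<pi> "conf n"]
    conf_comp_permutes[OF _ assms(2)] by (auto simp: comp_def)

lemma path_relabel: "path p \<Longrightarrow> path (\<lambda>t. p t \<circ> \<pi>)" for p :: "real \<Rightarrow> nat \<Rightarrow> complex"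
  using path_continuous_image[of p "\<lambda>y. y \<circ> \<pi>"] continuous_on_comp_permutation by (auto simp: comp_def)

lemma path_image_relabel:
  "path_image p \<subseteq> conf n \<Longrightarrow> \<pi> permutes {1..n} \<Longrightarrow> path_image (\<lambda>t. p t \<circ> \<pi>) \<subseteq> conf n"
  using conf_comp_permutes by (fastforce simp: path_image_def)

lemma pathstart_relabel [simp]: "pathstart (\<lambda>t. p t \<circ> \<pi>) = pathstart p \<circ> \<pi>"
  and pathfinish_relabel [simp]: "pathfinish (\<lambda>t. p t \<circ> \<pi>) = pathfinish p \<circ> \<pi>"
  by (simp_all add: pathstart_def pathfinish_def)

lemma reversepath_relabel: "reversepath (\<lambda>t. p t \<circ> \<pi>) = (\<lambda>t. reversepath p t \<circ> \<pi>)"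
  by (simp add: reversepath_def)

lemma joinpaths_relabel: "(\<lambda>t. (p +++ q) t \<circ> \<pi>) = (\<lambda>t. p t \<circ> \<pi>) +++ (\<lambda>t. q t \<circ> \<pi>)"
  by (auto simp: joinpaths_def)

lemma std_conf_in_conf [simp]: "std_conf n \<in> conf n"
  by (auto simp: conf_def cspace_def std_conf_def inj_on_def)

text \<open>Makes the permutation quantified in the product of \<open>braid_group\<close> unique: it
  is determined by the end point of the first factor.\<close>

lemma std_conf_comp_eq_iff:
  assumes "\<pi> permutes {1..n}" "\<rho> permutes {1..n}"
  shows "std_conf n \<circ> \<pi> = std_conf n \<circ> \<rho> \<longleftrightarrow> \<pi> = \<rho>"
proof
  assume eq: "std_conf n \<circ> \<pi> = std_conf n \<circ> \<rho>"
  show "\<pi> = \<rho>"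
  proof
    fix i
    show "\<pi> i = \<rho> i"
    proof (cases "i \<in> {1..n}")
      case True
      then have "\<pi> i \<in> {1..n}" "\<rho> i \<in> {1..n}"
        using assms by (metis permutes_in_image)+
      with fun_cong[OF eq, of i] show ?thesis
        by (auto simp: std_conf_def)
    next
      case False
      then show ?thesis using assms by (metis permutes_not_in)
    qed
  qed
qed auto

definition braid_path :: "nat \<Rightarrow> (real \<Rightarrow> nat \<Rightarrow> complex) \<Rightarrow> (nat \<Rightarrow> nat) \<Rightarrow> bool" where
  "braid_path n p \<pi> \<longleftrightarrow> path p \<and> path_image p \<subseteq> conf n \<and> pathstart p = std_conf n \<and>
     \<pi> permutes {1..n} \<and> pathfinish p = std_conf n \<circ> \<pi>"

lemma carrier_braid_group: "carrier (Br n) = {path_class (conf n) p | p \<pi>. braid_path n p \<pi>}"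
  by (auto simp: braid_group_def braid_path_def)

lemma one_braid_group: "\<one>\<^bsub>Br n\<^esub> = path_class (conf n) (\<lambda>_. std_conf n)"
  by (simp add: braid_group_def)

lemma braid_path_const: "braid_path n (\<lambda>_. std_conf n) id"
  by (simp add: braid_path_def path_const path_image_const pathstart_def pathfinish_def permutes_id)

lemma braid_path_join:
  assumes "braid_path n p \<pi>" "braid_path n q \<rho>"
  shows "braid_path n (p +++ (\<lambda>t. q t \<circ> \<pi>)) (\<rho> \<circ> \<pi>)"
  using assms unfolding braid_path_def
  by (auto simp: path_relabel path_image_relabel path_image_join permutes_compose o_assoc
      simp del: o_apply dest!: path_image_relabel[of q n \<pi>, THEN subsetD, rotated 2])

text \<open>Homotopic paths have equal end points, hence the same permutation, so the product does
  not depend on the representatives over which its definition ranges.\<close>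

lemma braid_group_mult:
  assumes p: "braid_path n p \<pi>" and q: "braid_path n q \<rho>"
  shows "path_class (conf n) p \<otimes>\<^bsub>Br n\<^esub> path_class (conf n) q
    = path_class (conf n) (p +++ (\<lambda>t. q t \<circ> \<pi>))"
proof -
  have hom: "homotopic_paths (conf n) (p +++ (\<lambda>t. q t \<circ> \<pi>)) (p' +++ (\<lambda>t. q' t \<circ> \<pi>))"
    if "homotopic_paths (conf n) p p'" "homotopic_paths (conf n) q q'" for p' q'
    using that p q by (intro homotopic_paths_join homotopic_paths_relabel) (auto simp: braid_path_def)
  have uniq: "\<pi>' = \<pi>" if "homotopic_paths (conf n) p p'" "\<pi>' permutes {1..n}" "pathfinish p' = std_conf n \<circ> \<pi>'" for p' \<pi>'
    using that p homotopic_paths_imp_pathfinish[OF that(1)] std_conf_comp_eq_iff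
    unfolding braid_path_def by metis
  have "(\<exists>p'\<in>path_class (conf n) p. \<exists>q'\<in>path_class (conf n) q. \<exists>\<pi>'. \<pi>' permutes {1..n} \<and>
      pathfinish p' = std_conf n \<circ> \<pi>' \<and> homotopic_paths (conf n) (p' +++ (\<lambda>t. q' t \<circ> \<pi>')) r)
    \<longleftrightarrow> homotopic_paths (conf n) (p +++ (\<lambda>t. q t \<circ> \<pi>)) r" (is "?L \<longleftrightarrow> ?R") for r
  proof
    assume ?L
    then show ?R using hom uniq unfolding path_class_def
      by (metis (no_types, lifting) homotopic_paths_trans mem_Collect_eq)
  next
    assume ?R
    moreover have "p \<in> path_class (conf n) p" "q \<in> path_class (conf n) q"
      using p q by (auto simp: braid_path_def path_class_self)
    ultimately show ?L using p unfolding braid_path_def by blast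
  qed
  then show ?thesis
    by (simp add: braid_group_def path_class_def)
qed

lemma group_braid_group: "group (Br n)"
proof (rule groupI)
  let ?G = "Br n" and ?c = "path_class (conf n)"
  show "\<one>\<^bsub>?G\<^esub> \<in> carrier ?G"
    using braid_path_const by (auto simp: carrier_braid_group one_braid_group)
  show "x \<otimes>\<^bsub>?G\<^esub> y \<in> carrier ?G" if "x \<in> carrier ?G" "y \<in> carrier ?G" for x y
    using that by (auto simp: carrier_braid_group braid_group_mult) (use braid_path_join in blast)
  show "x \<otimes>\<^bsub>?G\<^esub> y \<otimes>\<^bsub>?G\<^esub> z = x \<otimes>\<^bsub>?G\<^esub> (y \<otimes>\<^bsub>?G\<^esub> z)"
    if xyz: "x \<in> carrier ?G" "y \<in> carrier ?G" "z \<in> carrier ?G" for x y z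
  proof -
    obtain p \<pi> q \<rho> r \<tau> where pqr: "x = ?c p" "y = ?c q" "z = ?c r"
      "braid_path n p \<pi>" "braid_path n q \<rho>" "braid_path n r \<tau>"
      using xyz by (auto simp: carrier_braid_group)
    have "homotopic_paths (conf n) ((p +++ (\<lambda>t. q t \<circ> \<pi>)) +++ (\<lambda>t. r t \<circ> (\<rho> \<circ> \<pi>)))
        (p +++ ((\<lambda>t. q t \<circ> \<pi>) +++ (\<lambda>t. r t \<circ> (\<rho> \<circ> \<pi>))))"
      using pqr(4-6) unfolding braid_path_def
      by (intro homotopic_paths_assoc' path_relabel path_image_relabel permutes_compose) (auto simp: o_assoc)
    moreover have "(\<lambda>t. q t \<circ> \<pi>) +++ (\<lambda>t. r t \<circ> (\<rho> \<circ> \<pi>)) = (\<lambda>t. (q +++ (\<lambda>t. r t \<circ> \<rho>)) t \<circ> \<pi>)"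
      by (simp add: joinpaths_relabel o_assoc)
    ultimately show ?thesis
      using braid_path_join[OF pqr(4,5)] braid_path_join[OF pqr(5,6)] pqr
      by (simp add: braid_group_mult path_class_eqI)
  qed
  show "\<one>\<^bsub>?G\<^esub> \<otimes>\<^bsub>?G\<^esub> x = x" if x: "x \<in> carrier ?G" for x
  proof -
    obtain p \<pi> where p: "x = ?c p" "braid_path n p \<pi>"
      using x by (auto simp: carrier_braid_group)
    have "homotopic_paths (conf n) ((\<lambda>_. std_conf n) +++ p) p"
      using homotopic_paths_lid_const[of p "conf n"] p(2) by (simp add: braid_path_def)
    then show ?thesis
      using p braid_group_mult[OF braid_path_const p(2)] by (simp add: one_braid_group path_class_eqI)
  qed
  show "\<exists>y\<in>carrier ?G. y \<otimes>\<^bsub>?G\<^esub> x = \<one>\<^bsub>?G\<^esub>" if x: "x \<in> carrier ?G" for x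
  proof -
    obtain p \<pi> where p: "x = ?c p" "braid_path n p \<pi>"
      using x by (auto simp: carrier_braid_group)
    have perm: "\<pi> permutes {1..n}"
      using p(2) by (simp add: braid_path_def)
    \<comment> \<open>The reversed path starts at the relabelled configuration; undoing the
      relabelling makes it start at \<open>std_conf n\<close>.\<close>
    let ?q = "\<lambda>t. reversepath p t \<circ> inv_into UNIV \<pi>"
    have cancel: "std_conf n \<circ> \<pi> \<circ> inv_into UNIV \<pi> = std_conf n"
      using permutes_inv_o(1)[OF perm] by (simp add: o_assoc[symmetric])
    have q: "braid_path n ?q (inv_into UNIV \<pi>)"
      using p(2) perm permutes_inv[OF perm] path_image_relabel[of "reversepath p" n "inv_into UNIV \<pi>"]
      by (simp add: braid_path_def path_relabel cancel)
    have "homotopic_paths (conf n) (?q +++ (\<lambda>t. p t \<circ> inv_into UNIV \<pi>)) (\<lambda>_. std_conf n)"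
      using homotopic_paths_linv_const[of "\<lambda>t. p t \<circ> inv_into UNIV \<pi>" "conf n"] p(2) permutes_inv[OF perm]
      by (simp add: braid_path_def path_relabel path_image_relabel cancel reversepath_relabel)
    then have "?c ?q \<otimes>\<^bsub>?G\<^esub> x = \<one>\<^bsub>?G\<^esub>"
      using p q by (simp add: braid_group_mult one_braid_group path_class_eqI)
    then show ?thesis
      using q by (auto simp: carrier_braid_group)
  qed
qed

section \<open>Lexicographic order\<close>

lemma conf_distinct: "y \<in> conf n \<Longrightarrow> i \<in> {1..n} \<Longrightarrow> k \<in> {1..n} \<Longrightarrow> i \<noteq> k \<Longrightarrow> y i \<noteq> y k"
  unfolding conf_def using inj_onD by fastforce

text \<open>Turns comparisons of strands into membership of the difference vector in a convex cone
  without the origin; the facts on scaling, sums and convex combinations below are all that is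
  needed of this cone.\<close>

lemma lex_less_diff: "lex_less z w \<longleftrightarrow> lex_less 0 (w - z)"
  by (auto simp: lex_less_def)

lemma lex_less_irrefl [simp]: "\<not> lex_less z z"
  by (simp add: lex_less_def)

lemma lex_less_asym: "lex_less z w \<Longrightarrow> \<not> lex_less w z"
  by (auto simp: lex_less_def)

lemma lex_less_trans: "lex_less z w \<Longrightarrow> lex_less w x \<Longrightarrow> lex_less z x"
  by (auto simp: lex_less_def)

lemma lex_less_linear: "z \<noteq> w \<Longrightarrow> lex_less z w \<or> lex_less w z"
  by (auto simp: lex_less_def complex_eq_iff)

lemma lex_less_scale: "r > 0 \<Longrightarrow> lex_less 0 (of_real r * z) \<longleftrightarrow> lex_less 0 z"
  by (auto simp: lex_less_def zero_less_mult_iff)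

lemma lex_less_add: "lex_less 0 z \<Longrightarrow> lex_less 0 w \<Longrightarrow> lex_less 0 (z + w)"
  by (auto simp: lex_less_def)

lemma lex_less_of_nat [simp]: "lex_less (of_nat i) (of_nat k) \<longleftrightarrow> i < k"
  by (auto simp: lex_less_def)

lemma lex_less_convex:
  assumes "lex_less 0 z" "lex_less 0 w" "s \<in> {0..1}"
  shows "lex_less 0 (of_real (1 - s) * z + of_real s * w)"
proof (cases "s = 0 \<or> s = 1")
  case False
  then have "0 < s" "0 < 1 - s" using assms(3) by auto
  then show ?thesis
    using assms(1,2) by (intro lex_less_add) (simp_all only: lex_less_scale)
qed (use assms in auto)

lemma lex_pos_mono:
  assumes "i \<in> {1..n}" "k \<in> {1..n}" "lex_less (y i) (y k)"
  shows "lex_pos n y i < lex_pos n y k"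
proof -
  have "{j\<in>{1..n}. lex_less (y j) (y i)} \<subset> {j\<in>{1..n}. lex_less (y j) (y k)}"
  proof
    show "{j\<in>{1..n}. lex_less (y j) (y i)} \<subseteq> {j\<in>{1..n}. lex_less (y j) (y k)}"
      using lex_less_trans[OF _ assms(3)] by blast
    show "{j\<in>{1..n}. lex_less (y j) (y i)} \<noteq> {j\<in>{1..n}. lex_less (y j) (y k)}"
      using assms(1,3) lex_less_irrefl[of "y i"] by blast
  qed
  then have "card {j\<in>{1..n}. lex_less (y j) (y i)} < card {j\<in>{1..n}. lex_less (y j) (y k)}"
    by (intro psubset_card_mono) auto
  then show ?thesis using assms by (simp add: lex_pos_def)
qed

lemma lex_pos_less_iff:
  assumes "y \<in> conf n" "i \<in> {1..n}" "k \<in> {1..n}"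
  shows "lex_pos n y i < lex_pos n y k \<longleftrightarrow> lex_less (y i) (y k)"
proof (cases "i = k")
  case False
  then have "y i \<noteq> y k" using assms conf_distinct by metis
  then consider "lex_less (y i) (y k)" | "lex_less (y k) (y i)"
    using lex_less_linear by metis
  then show ?thesis
    using lex_pos_mono[OF assms(2,3)] lex_pos_mono[OF assms(3,2)] lex_less_asym by cases (metis less_asym)+
qed simp

lemma lex_pos_permutes:
  assumes "y \<in> conf n"
  shows "lex_pos n y permutes {1..n}"
proof (rule bij_imp_permutes)
  have inj: "inj_on (lex_pos n y) {1..n}"
  proof (rule inj_onI)
    fix i k assume ik: "i \<in> {1..n}" "k \<in> {1..n}" "lex_pos n y i = lex_pos n y k"
    then have "\<not> lex_less (y i) (y k)" "\<not> lex_less (y k) (y i)"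
      using lex_pos_mono[of i n k y] lex_pos_mono[of k n i y] by auto
    then have "y i = y k" using lex_less_linear[of "y i" "y k"] by auto
    then show "i = k" using assms ik conf_distinct by metis
  qed
  have "lex_pos n y ` {1..n} \<subseteq> {1..n}"
  proof (rule image_subsetI)
    fix i assume i: "i \<in> {1..n}"
    have "card {k\<in>{1..n}. lex_less (y k) (y i)} \<le> card ({1..n} - {i})"
      by (rule card_mono) auto
    then show "lex_pos n y i \<in> {1..n}" using i by (auto simp: lex_pos_def)
  qed
  then show "bij_betw (lex_pos n y) {1..n} {1..n}"
    using inj by (simp add: bij_betw_def endo_inj_surj)
  show "lex_pos n y i = i" if "i \<notin> {1..n}" for i
    using that by (simp only: lex_pos_def if_False)
qed

text \<open>\<open>lex_pos\<close> counts smaller entries, and \<pi> maps the labels of these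
  bijectively onto \<open>{1..<\<pi> i}\<close>.\<close>

lemma lex_pos_unique:
  assumes "\<pi> permutes {1..n}"
    and less: "\<And>i k. i \<in> {1..n} \<Longrightarrow> k \<in> {1..n} \<Longrightarrow> lex_less (y i) (y k) \<longleftrightarrow> \<pi> i < \<pi> k"
  shows "lex_pos n y = \<pi>"
proof
  fix i
  show "lex_pos n y i = \<pi> i"
  proof (cases "i \<in> {1..n}")
    case True
    have "\<pi> ` {k\<in>{1..n}. lex_less (y k) (y i)} = {1..<\<pi> i}"
    proof
      show "\<pi> ` {k\<in>{1..n}. lex_less (y k) (y i)} \<subseteq> {1..<\<pi> i}"
        using less True permutes_in_image[OF assms(1)] by fastforce
      show "{1..<\<pi> i} \<subseteq> \<pi> ` {k\<in>{1..n}. lex_less (y k) (y i)}"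
      proof
        fix j assume j: "j \<in> {1..<\<pi> i}"
        have "\<pi> i \<in> {1..n}" using True permutes_in_image[OF assms(1)] by blast
        then have "j \<in> \<pi> ` {1..n}" using j permutes_image[OF assms(1)] by auto
        then show "j \<in> \<pi> ` {k\<in>{1..n}. lex_less (y k) (y i)}"
          using j less True by auto
      qed
    qed
    then have "card {k\<in>{1..n}. lex_less (y k) (y i)} = \<pi> i - 1"
      by (metis card_image card_atLeastLessThan permutes_inj_on[OF assms(1)])
    moreover have "\<pi> i \<in> {1..n}"
      using True permutes_in_image[OF assms(1)] by blast
    ultimately show ?thesis using True by (auto simp: lex_pos_def)
  next
    case False
    then show ?thesis using permutes_not_in[OF assms(1)] by (auto simp: lex_pos_def)
  qed
qed

lemma lex_pos_comp:
  assumes "y \<in> conf n" "\<pi> permutes {1..n}"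
  shows "lex_pos n (y \<circ> \<pi>) = lex_pos n y \<circ> \<pi>"
proof (rule lex_pos_unique)
  show "lex_pos n y \<circ> \<pi> permutes {1..n}"
    using assms by (intro permutes_compose lex_pos_permutes)
  show "lex_less ((y \<circ> \<pi>) i) ((y \<circ> \<pi>) k) \<longleftrightarrow> (lex_pos n y \<circ> \<pi>) i < (lex_pos n y \<circ> \<pi>) k"
    if "i \<in> {1..n}" "k \<in> {1..n}" for i k
    using that permutes_in_image[OF assms(2)] lex_pos_less_iff[OF assms(1)] by (simp only: o_apply)
qed

lemma lex_pos_std_conf [simp]: "lex_pos n (std_conf n) = id"
  by (rule lex_pos_unique) (auto simp: permutes_id std_conf_def)

lemma lex_pos_std_conf_comp: "\<pi> permutes {1..n} \<Longrightarrow> lex_pos n (std_conf n \<circ> \<pi>) = \<pi>"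
  by (simp add: lex_pos_comp)

text \<open>Pairs with \<open>i < k\<close> suffice: entries of a configuration are distinct, so the
  opposite comparison is the negation.\<close>

lemma lex_pos_eqI:
  assumes "y \<in> conf n" "w \<in> conf n"
    and "\<And>i k. i \<in> {1..n} \<Longrightarrow> k \<in> {1..n} \<Longrightarrow> i < k \<Longrightarrow> lex_less (y i) (y k) \<longleftrightarrow> lex_less (w i) (w k)"
  shows "lex_pos n y = lex_pos n w"
proof (rule lex_pos_unique[OF lex_pos_permutes[OF assms(2)]])
  fix i k assume ik: "i \<in> {1..n}" "k \<in> {1..n}"
  have flip: "lex_less (x i) (x k) \<longleftrightarrow> \<not> lex_less (x k) (x i)" if "x \<in> conf n" "i \<noteq> k" for x
  proof -
    have "x i \<noteq> x k" using that ik conf_distinct by metis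
    then show ?thesis using lex_less_linear[of "x i" "x k"] lex_less_asym[of "x i" "x k"] by auto
  qed
  show "lex_less (y i) (y k) \<longleftrightarrow> lex_pos n w i < lex_pos n w k"
  proof (cases i k rule: linorder_cases)
    case greater
    then show ?thesis using assms(3)[OF ik(2,1)] flip[OF assms(1)] flip[OF assms(2)] lex_pos_less_iff[OF assms(2) ik] by simp
  qed (use assms(3)[OF ik] lex_pos_less_iff[OF assms(2) ik] in auto)
qed

section \<open>Straight paths of configurations\<close>

lemma straight_0 [simp]: "straight y w 0 = y" and straight_1 [simp]: "straight y w 1 = w"
  by (auto simp: straight_def)

lemma pathstart_straight [simp]: "pathstart (straight y w) = y"
  and pathfinish_straight [simp]: "pathfinish (straight y w) = w"
  by (simp_all add: pathstart_def pathfinish_def)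

lemma path_straight: "path (straight y w)"
  unfolding path_def straight_def
  by (intro continuous_on_coordinatewise_then_product continuous_intros)

lemma reversepath_straight: "reversepath (straight y w) = straight w y"
  by (auto simp: reversepath_def straight_def fun_eq_iff)

lemma straight_comp: "straight y w t \<circ> \<pi> = straight (y \<circ> \<pi>) (w \<circ> \<pi>) t"
  by (auto simp: straight_def)

lemma straight_same [simp]: "straight y y = (\<lambda>_. y)"
  by (auto simp: straight_def fun_eq_iff algebra_simps)

lemma straight_conf:
  assumes "y \<in> conf n" "w \<in> conf n"
    and "\<And>i k. i \<in> {1..n} \<Longrightarrow> k \<in> {1..n} \<Longrightarrow> i < k \<Longrightarrow> of_real (1 - s) * (y k - y i) + of_real s * (w k - w i) \<noteq> 0"
  shows "straight y w s \<in> conf n"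
proof -
  have eq: "straight y w s k - straight y w s i = of_real (1 - s) * (y k - y i) + of_real s * (w k - w i)" for i k
    by (simp add: straight_def algebra_simps)
  have "straight y w s i \<noteq> straight y w s k" if "i \<in> {1..n}" "k \<in> {1..n}" "i < k" for i k
    using assms(3)[OF that] unfolding eq[symmetric] by auto
  then have "inj_on (straight y w s) {1..n}"
    by (intro linorder_inj_onI') auto
  then show ?thesis using assms(1,2) by (auto simp: conf_def cspace_def straight_def)
qed

lemma
  assumes "y \<in> conf n" "w \<in> conf n" "lex_pos n y = lex_pos n w" "s \<in> {0..1}"
  shows straight_cell: "straight y w s \<in> conf n"
    and lex_pos_straight: "lex_pos n (straight y w s) = lex_pos n y"
proof -
  have eq: "straight y w s k - straight y w s i = of_real (1 - s) * (y k - y i) + of_real s * (w k - w i)" for i k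
    by (simp add: straight_def algebra_simps)
  have conv: "lex_less (straight y w s i) (straight y w s k)" if "i \<in> {1..n}" "k \<in> {1..n}" "lex_less (y i) (y k)" for i k
  proof -
    have "lex_less (w i) (w k)"
      using that assms(3) lex_pos_less_iff[OF assms(1) that(1,2)] lex_pos_less_iff[OF assms(2) that(1,2)] by simp
    then have "lex_less 0 (straight y w s k - straight y w s i)"
      unfolding eq using that assms(4) by (intro lex_less_convex) (auto simp: lex_less_diff[symmetric])
    then show ?thesis using lex_less_diff by blast
  qed
  have lin: "lex_less (y i) (y k) \<or> lex_less (y k) (y i)" if "i \<in> {1..n}" "k \<in> {1..n}" "i \<noteq> k" for i k
    using that assms(1) lex_less_linear conf_distinct by metis
  have "inj_on (straight y w s) {1..n}"
  proof (rule inj_onI, rule ccontr)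
    fix i k assume ik: "i \<in> {1..n}" "k \<in> {1..n}" "straight y w s i = straight y w s k" "i \<noteq> k"
    show False using lin[OF ik(1,2,4)] conv[OF ik(1,2)] conv[OF ik(2,1)] ik(3) by auto
  qed
  then show conf: "straight y w s \<in> conf n" using assms(1,2) by (auto simp: conf_def cspace_def straight_def)
  show "lex_pos n (straight y w s) = lex_pos n y"
  proof (rule lex_pos_eqI[OF conf assms(1)])
    fix i k assume ik: "i \<in> {1..n}" "k \<in> {1..n}" "i < k"
    then show "lex_less (straight y w s i) (straight y w s k) \<longleftrightarrow> lex_less (y i) (y k)"
      using lin[OF ik(1,2)] conv[OF ik(1,2)] conv[OF ik(2,1)] lex_less_asym by (metis less_irrefl)
  qed
qed

lemma path_image_straight_cell:
  "y \<in> conf n \<Longrightarrow> w \<in> conf n \<Longrightarrow> lex_pos n y = lex_pos n w \<Longrightarrow> path_image (straight y w) \<subseteq> conf n"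
  using straight_cell by (fastforce simp: path_image_def)

lemma continuous_on_straight:
  assumes "path p" "path q"
  shows "continuous_on ({0..1} \<times> {0..1}) (\<lambda>x. straight (p (snd x)) (q (snd x)) (fst x))"
proof -
  have "continuous_on ({0..1} \<times> {0..1}) (\<lambda>x. r (snd x) i)"
    if "path r" for r :: "real \<Rightarrow> nat \<Rightarrow> complex" and i
  proof -
    have "continuous_on {0..1} (\<lambda>t. r t i)"
      using that unfolding path_def by (rule continuous_on_product_then_coordinatewise)
    then show ?thesis
      by (rule continuous_on_compose2) (auto intro: continuous_intros)
  qed
  with assms show ?thesis
    unfolding straight_def
    by (intro continuous_on_coordinatewise_then_product continuous_intros) auto
qed

lemma homotopic_paths_straight:
  assumes "path p" "path q" "pathstart p = pathstart q" "pathfinish p = pathfinish q"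
    and "\<And>s t. s \<in> {0..1} \<Longrightarrow> t \<in> {0..1} \<Longrightarrow> straight (p t) (q t) s \<in> S"
  shows "homotopic_paths S p q"
  unfolding homotopic_paths
  using assms(3-5)
  by (intro exI[of _ "\<lambda>x. straight (p (snd x)) (q (snd x)) (fst x)"] conjI continuous_on_straight[OF assms(1,2)])
    (auto simp: pathstart_def pathfinish_def)

section \<open>Traced braids\<close>

definition conf_path :: "nat \<Rightarrow> (real \<Rightarrow> nat \<Rightarrow> complex) \<Rightarrow> bool" where
  "conf_path n c \<longleftrightarrow> path c \<and> path_image c \<subseteq> conf n"

lemma conf_path_at: "conf_path n c \<Longrightarrow> t \<in> {0..1} \<Longrightarrow> c t \<in> conf n"
  by (auto simp: conf_path_def path_image_def)

lemma conf_path_start: "conf_path n c \<Longrightarrow> c 0 \<in> conf n"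
  and conf_path_finish: "conf_path n c \<Longrightarrow> c 1 \<in> conf n"
  by (auto intro: conf_path_at)

lemma conf_path_join: "conf_path n c \<Longrightarrow> conf_path n d \<Longrightarrow> c 1 = d 0 \<Longrightarrow> conf_path n (c +++ d)"
  by (simp add: conf_path_def subset_path_image_join pathfinish_def pathstart_def)

lemma conf_path_reversepath: "conf_path n c \<Longrightarrow> conf_path n (reversepath c)"
  by (simp add: conf_path_def)

lemma conf_path_relabel: "conf_path n c \<Longrightarrow> \<pi> permutes {1..n} \<Longrightarrow> conf_path n (\<lambda>t. c t \<circ> \<pi>)"
  by (simp add: conf_path_def path_relabel path_image_relabel)

lemma conf_path_straight_cell:
  "y \<in> conf n \<Longrightarrow> w \<in> conf n \<Longrightarrow> lex_pos n y = lex_pos n w \<Longrightarrow> conf_path n (straight y w)"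
  by (simp add: conf_path_def path_straight path_image_straight_cell)

lemma conf_pathI:
  assumes "\<And>i. i \<in> {1..n} \<Longrightarrow> continuous_on {0..1} (\<lambda>t. c t i)"
    and "\<And>t. t \<in> {0..1} \<Longrightarrow> c t \<in> conf n"
  shows "conf_path n c"
proof -
  have "continuous_on {0..1} (\<lambda>t. c t i)" for i
  proof (cases "i \<in> {1..n}")
    case False
    then have "c t i = 0" if "t \<in> {0..1}" for t
      using assms(2)[OF that] by (auto simp: conf_def cspace_def)
    then show ?thesis by (metis (mono_tags, lifting) continuous_on_cong continuous_on_const)
  qed (rule assms(1))
  then show ?thesis
    using assms(2) by (auto simp: conf_path_def path_def path_image_def intro: continuous_on_coordinatewise_then_product)
qed

definition pinned :: "nat \<Rightarrow> (real \<Rightarrow> nat \<Rightarrow> complex) \<Rightarrow> real \<Rightarrow> nat \<Rightarrow> complex" where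
  "pinned n c = straight (std_conf n) (c 0) +++ c +++ straight (c 1) (std_conf n \<circ> lex_pos n (c 1))"

lemma traced_braid_pinned:
  "traced_braid n c = path_class (conf n) (pinned n (\<lambda>t. c t \<circ> inv_into UNIV (lex_pos n (c 0))))"
  by (simp add: traced_braid_def pinned_def Let_def)

lemma lex_pos_normalised:
  assumes "y \<in> conf n"
  shows "lex_pos n (y \<circ> inv_into UNIV (lex_pos n y)) = id"
  using assms lex_pos_permutes[OF assms]
  by (simp add: lex_pos_comp permutes_inv permutes_inv_o)

lemma conf_path_from_std: "y \<in> conf n \<Longrightarrow> lex_pos n y = id \<Longrightarrow> conf_path n (straight (std_conf n) y)"
  by (intro conf_path_straight_cell) auto

lemma conf_path_to_std: "y \<in> conf n \<Longrightarrow> conf_path n (straight y (std_conf n \<circ> lex_pos n y))"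
  by (intro conf_path_straight_cell) (auto simp: conf_comp_permutes lex_pos_permutes lex_pos_std_conf_comp)

lemma braid_path_pinned:
  assumes "conf_path n c" "lex_pos n (c 0) = id"
  shows "braid_path n (pinned n c) (lex_pos n (c 1))"
proof -
  have c0: "c 0 \<in> conf n" and c1: "c 1 \<in> conf n"
    using assms conf_path_start conf_path_finish by auto
  have "conf_path n (pinned n c)"
    unfolding pinned_def using assms c0 c1
    by (intro conf_path_join conf_path_from_std conf_path_to_std) (auto simp: joinpaths_def)
  then show ?thesis
    using c1 by (simp add: braid_path_def conf_path_def lex_pos_permutes)  (simp add: pinned_def)
qed

lemma traced_braid_sorted:
  "lex_pos n (c 0) = id \<Longrightarrow> traced_braid n c = path_class (conf n) (pinned n c)"
  by (simp add: traced_braid_pinned comp_def)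

lemma traced_braid_in_carrier:
  assumes "conf_path n c"
  shows "traced_braid n c \<in> carrier (Br n)"
proof -
  have c0: "c 0 \<in> conf n" using assms conf_path_start by blast
  then have "braid_path n (pinned n (\<lambda>t. c t \<circ> inv_into UNIV (lex_pos n (c 0))))
     (lex_pos n (c 1 \<circ> inv_into UNIV (lex_pos n (c 0))))"
    using lex_pos_permutes[OF c0]
    by (intro braid_path_pinned conf_path_relabel assms permutes_inv) (auto simp: lex_pos_normalised)
  then show ?thesis
    unfolding carrier_braid_group traced_braid_pinned by blast
qed

text \<open>The normalisation by the initial order absorbs \<pi>, since
  \<open>inv (\<tau> \<circ> \<pi>)\<close> is \<open>inv \<pi> \<circ> inv \<tau>\<close>. Hence
  the lines may be renumbered freely at any point of the base.\<close>

lemma traced_braid_relabel: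
  assumes "c 0 \<in> conf n" "\<pi> permutes {1..n}"
  shows "traced_braid n (\<lambda>t. c t \<circ> \<pi>) = traced_braid n c"
proof -
  have "inv_into UNIV (lex_pos n (c 0 \<circ> \<pi>)) = inv_into UNIV \<pi> \<circ> inv_into UNIV (lex_pos n (c 0))"
    using lex_pos_permutes[OF assms(1)] assms(2)
    by (simp add: lex_pos_comp[OF assms] o_inv_distrib permutes_bij)
  moreover have "x \<circ> \<pi> \<circ> (inv_into UNIV \<pi> \<circ> \<rho>) = x \<circ> \<rho>" for x :: "nat \<Rightarrow> complex" and \<rho> :: "nat \<Rightarrow> nat"
    using permutes_inv_o(1)[OF assms(2)] by (metis comp_assoc comp_id)
  ultimately show ?thesis
    by (simp add: traced_braid_pinned)
qed

lemma homotopic_imp_conf_path: "homotopic_paths (conf n) c d \<Longrightarrow> conf_path n c"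
  using homotopic_paths_imp_path[of "conf n" c d] homotopic_paths_imp_subset[of "conf n" c d]
  by (simp add: conf_path_def)

lemma homotopic_pinned:
  assumes "homotopic_paths (conf n) c d" "lex_pos n (c 0) = id"
  shows "homotopic_paths (conf n) (pinned n c) (pinned n d)"
proof -
  have c: "conf_path n c"
    using assms(1) by (rule homotopic_imp_conf_path)
  have eq: "d 0 = c 0" "d 1 = c 1"
    using assms homotopic_paths_imp_pathstart homotopic_paths_imp_pathfinish by (force simp: pathstart_def pathfinish_def)+
  have "path_image (straight (std_conf n) (c 0)) \<subseteq> conf n"
    "path_image (straight (c 1) (std_conf n \<circ> lex_pos n (c 1))) \<subseteq> conf n"
    using conf_path_from_std[OF conf_path_start[OF c] assms(2)] conf_path_to_std[OF conf_path_finish[OF c]]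
    by (simp_all add: conf_path_def)
  then show ?thesis
    unfolding pinned_def eq using assms(1) eq
    by (intro homotopic_paths_join) (auto simp: path_straight pathstart_def pathfinish_def joinpaths_def)
qed

lemma traced_braid_homotopic:
  assumes "homotopic_paths (conf n) c d"
  shows "traced_braid n c = traced_braid n d"
proof -
  have eq: "d 0 = c 0"
    using assms homotopic_paths_imp_pathstart by (force simp: pathstart_def)
  have c0: "c 0 \<in> conf n"
    using assms by (intro conf_path_start homotopic_imp_conf_path)
  show ?thesis
    unfolding traced_braid_pinned eq
    using c0 lex_pos_permutes[OF c0]
    by (intro path_class_eqI homotopic_pinned homotopic_paths_relabel assms permutes_inv) (auto simp: lex_pos_normalised)
qed

lemma pathstart_const [simp]: "pathstart (\<lambda>_. x) = x"
  and pathfinish_const [simp]: "pathfinish (\<lambda>_. x) = x"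
  by (simp_all add: pathstart_def pathfinish_def)

lemma homotopic_paths_cancel:
  assumes "path p" "path_image p \<subseteq> S" "path s" "path_image s \<subseteq> S" "path q" "path_image q \<subseteq> S"
    and "pathfinish p = pathstart s" "pathstart q = pathstart s"
  shows "homotopic_paths S ((p +++ s) +++ (reversepath s +++ q)) (p +++ q)"
proof -
  have "homotopic_paths S ((p +++ s) +++ (reversepath s +++ q)) (p +++ (s +++ (reversepath s +++ q)))"
    using assms by (intro homotopic_paths_assoc') (auto simp: subset_path_image_join)
  also have "homotopic_paths S \<dots> (p +++ ((s +++ reversepath s) +++ q))"
    using assms by (intro homotopic_paths_join homotopic_paths_assoc) (auto simp: subset_path_image_join)
  also have "homotopic_paths S \<dots> (p +++ ((\<lambda>_. pathstart q) +++ q))"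
    using assms homotopic_paths_rinv_const[of s S] by (intro homotopic_paths_join) (auto simp: subset_path_image_join)
  also have "homotopic_paths S \<dots> (p +++ q)"
    using assms by (intro homotopic_paths_join homotopic_paths_lid_const) auto
  finally show ?thesis .
qed

text \<open>At the junction the closing segment of the first braid and the opening segment of the
  second run through the same configurations in opposite directions, once the labels are matched,
  and they cancel.\<close>

lemma traced_braid_join:
  assumes c: "conf_path n c" and d: "conf_path n d" and cd: "c 1 = d 0"
  shows "traced_braid n (c +++ d) = traced_braid n c \<otimes>\<^bsub>Br n\<^esub> traced_braid n d"
proof -
  let ?\<sigma> = "inv_into UNIV (lex_pos n (c 0))" and ?\<tau> = "inv_into UNIV (lex_pos n (d 0))"
  define a where "a = (\<lambda>t. c t \<circ> ?\<sigma>)"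
  define b where "b = (\<lambda>t. d t \<circ> ?\<sigma>)"
  \<comment> \<open>\<open>b\<close> labels the strands of \<open>d\<close> by their order at the
    start of \<open>c\<close>, \<open>e\<close> by their order at the start of \<open>d\<close>. The
    two differ by \<rho>, which is the permutation of the first factor.\<close>
  define e where "e = (\<lambda>t. d t \<circ> ?\<tau>)"
  have \<sigma>: "?\<sigma> permutes {1..n}" and \<tau>: "?\<tau> permutes {1..n}"
    using c d by (simp_all add: lex_pos_permutes permutes_inv conf_path_start)
  have a: "conf_path n a" and b: "conf_path n b" and e: "conf_path n e"
    unfolding a_def b_def e_def using c d \<sigma> \<tau> by (simp_all add: conf_path_relabel)
  have a0: "lex_pos n (a 0) = id" and e0: "lex_pos n (e 0) = id"
    using c d by (simp_all add: a_def e_def lex_pos_normalised conf_path_start)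
  have ab: "a 1 = b 0" by (simp add: a_def b_def cd)
  define \<rho> where "\<rho> = lex_pos n (a 1)"
  have \<rho>: "\<rho> permutes {1..n}"
    unfolding \<rho>_def using a by (simp add: lex_pos_permutes conf_path_finish)
  have \<rho>': "\<rho> = lex_pos n (d 0) \<circ> ?\<sigma>"
    unfolding \<rho>_def a_def cd using d \<sigma> by (intro lex_pos_comp) (auto simp: conf_path_start)
  have be: "b t = e t \<circ> \<rho>" for t
  proof -
    have "?\<tau> \<circ> \<rho> = ?\<sigma>"
      unfolding \<rho>' o_assoc using lex_pos_permutes[OF conf_path_start[OF d]] by (simp add: permutes_inv_o)
    then show ?thesis by (simp add: b_def e_def o_assoc[symmetric])
  qed
  then have be_fun: "b = (\<lambda>t. e t \<circ> \<rho>)" by blast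
  have lex_b: "lex_pos n (b 1) = lex_pos n (e 1) \<circ> \<rho>"
    unfolding be using e \<rho> by (intro lex_pos_comp) (auto simp: conf_path_finish)
  let ?A = "straight (std_conf n) (a 0)" and ?S = "straight (a 1) (std_conf n \<circ> \<rho>)"
  let ?B = "straight (b 1) (std_conf n \<circ> lex_pos n (b 1))"
  have A: "conf_path n ?A" and S: "conf_path n ?S" and B: "conf_path n ?B"
    unfolding \<rho>_def using a a0 b by (simp_all add: conf_path_from_std conf_path_to_std conf_path_start conf_path_finish)
  \<comment> \<open>The relabelling of the second factor prescribed by the product turns its opening
    segment into the reverse of \<open>?S\<close>.\<close>
  have rel: "(\<lambda>t. pinned n e t \<circ> \<rho>) = reversepath ?S +++ (b +++ ?B)"
    by (simp add: pinned_def joinpaths_relabel straight_comp reversepath_straight ab lex_b lex_b[unfolded be_fun] o_assoc be_fun)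
  note P = A S B a b
  have P': "path ?A" "path ?S" "path ?B" "path a" "path b"
    "path_image ?A \<subseteq> conf n" "path_image ?S \<subseteq> conf n" "path_image ?B \<subseteq> conf n" "path_image a \<subseteq> conf n" "path_image b \<subseteq> conf n"
    using P by (auto simp: conf_path_def)
  have ends: "pathstart a = a 0" "pathfinish a = a 1" "pathstart b = a 1" "pathfinish b = b 1"
    by (auto simp: pathstart_def pathfinish_def ab)
  have "traced_braid n c \<otimes>\<^bsub>Br n\<^esub> traced_braid n d
      = path_class (conf n) (pinned n a) \<otimes>\<^bsub>Br n\<^esub> path_class (conf n) (pinned n e)"
    by (simp add: traced_braid_pinned a_def e_def)
  also have "\<dots> = path_class (conf n) ((?A +++ a +++ ?S) +++ (reversepath ?S +++ (b +++ ?B)))"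
    using braid_group_mult[OF braid_path_pinned[OF a a0] braid_path_pinned[OF e e0]]
    by (simp add: rel flip: \<rho>_def) (simp add: pinned_def \<rho>_def)
  also have "\<dots> = path_class (conf n) (?A +++ (a +++ b) +++ ?B)"
  proof (rule path_class_eqI)
    have "homotopic_paths (conf n) ((?A +++ a +++ ?S) +++ (reversepath ?S +++ (b +++ ?B)))
        (((?A +++ a) +++ ?S) +++ (reversepath ?S +++ (b +++ ?B)))"
      using P' ends by (intro homotopic_paths_join homotopic_paths_assoc) (auto simp: subset_path_image_join)
    also have "homotopic_paths (conf n) \<dots> ((?A +++ a) +++ (b +++ ?B))"
      using P' ends by (intro homotopic_paths_cancel) (auto simp: subset_path_image_join)
    also have "homotopic_paths (conf n) \<dots> (?A +++ (a +++ (b +++ ?B)))"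
      using P' ends by (intro homotopic_paths_assoc') (auto simp: subset_path_image_join)
    also have "homotopic_paths (conf n) \<dots> (?A +++ ((a +++ b) +++ ?B))"
      using P' ends by (intro homotopic_paths_join homotopic_paths_assoc) (auto simp: subset_path_image_join)
    finally show "homotopic_paths (conf n) ((?A +++ a +++ ?S) +++ (reversepath ?S +++ (b +++ ?B)))
        (?A +++ (a +++ b) +++ ?B)" .
  qed
  also have "\<dots> = traced_braid n (c +++ d)"
  proof -
    have "(\<lambda>t. (c +++ d) t \<circ> inv_into UNIV (lex_pos n ((c +++ d) 0))) = a +++ b"
      by (auto simp: joinpaths_def a_def b_def)
    moreover have "(a +++ b) 0 = a 0" "(a +++ b) 1 = b 1"
      by (auto simp: joinpaths_def)
    ultimately show ?thesis
      by (simp add: traced_braid_pinned pinned_def)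
  qed
  finally show ?thesis ..
qed

text \<open>The pinned path stays in the cell of \<open>std_conf n\<close>, which is convex, and
  contracts straight to its base point.\<close>

lemma traced_braid_cell:
  assumes c: "conf_path n c" and cell: "\<And>t. t \<in> {0..1} \<Longrightarrow> lex_pos n (c t) = lex_pos n (c 0)"
  shows "traced_braid n c = \<one>\<^bsub>Br n\<^esub>"
proof -
  let ?\<sigma> = "inv_into UNIV (lex_pos n (c 0))"
  define a where "a = (\<lambda>t. c t \<circ> ?\<sigma>)"
  have \<sigma>: "?\<sigma> permutes {1..n}"
    using c by (simp add: lex_pos_permutes permutes_inv conf_path_start)
  have a: "conf_path n a"
    unfolding a_def using c \<sigma> by (rule conf_path_relabel)
  have at: "lex_pos n (a t) = id" if "t \<in> {0..1}" for t
    using cell[OF that] c that lex_pos_normalised[OF conf_path_at[OF c that]] by (simp add: a_def)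
  have at0: "lex_pos n (a 0) = id" and at1: "lex_pos n (a 1) = id"
    by (auto intro: at)
  have range: "pinned n a t \<in> conf n \<and> lex_pos n (pinned n a t) = id" if "t \<in> {0..1}" for t
    using that a at0 at1 unfolding pinned_def joinpaths_def
    by (auto simp: conf_path_start conf_path_finish straight_cell lex_pos_straight intro!: at conf_path_at[OF a])
  have path: "path (pinned n a)" "pathstart (pinned n a) = std_conf n" "pathfinish (pinned n a) = std_conf n"
    using braid_path_pinned[OF a at0] at1 by (auto simp: braid_path_def)
  have "homotopic_paths (conf n) (pinned n a) (\<lambda>_. std_conf n)"
  proof (rule homotopic_paths_straight)
    show "path (pinned n a)"
      using braid_path_pinned[OF a at0] by (simp add: braid_path_def)
    show "straight (pinned n a t) (std_conf n) s \<in> conf n" if "s \<in> {0..1}" "t \<in> {0..1}" for s t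
      using range that by (intro straight_cell) auto
  qed (use path in \<open>auto simp: path_const\<close>)
  then show ?thesis
    by (simp add: traced_braid_pinned one_braid_group path_class_eqI flip: a_def)
qed

lemma traced_braid_reversepath:
  assumes c: "conf_path n c"
  shows "traced_braid n (reversepath c) = inv\<^bsub>Br n\<^esub> traced_braid n c"
proof -
  interpret group "Br n" by (rule group_braid_group)
  have "traced_braid n c \<otimes>\<^bsub>Br n\<^esub> traced_braid n (reversepath c) = traced_braid n (c +++ reversepath c)"
    using c by (intro traced_braid_join[symmetric] conf_path_reversepath) (auto simp: reversepath_def)
  also have "\<dots> = traced_braid n (\<lambda>_. c 0)"
    using c homotopic_paths_rinv_const[of c "conf n"]
    by (intro traced_braid_homotopic) (auto simp: conf_path_def pathstart_def)
  also have "\<dots> = \<one>\<^bsub>Br n\<^esub>"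
    using conf_path_start[OF c] by (intro traced_braid_cell) (auto simp: conf_path_def path_const path_image_const)
  finally show ?thesis
    using c by (metis conf_path_reversepath inv_equality inv_inv traced_braid_in_carrier)
qed

text \<open>Used in two ways: with trivial sides it identifies two traced braids, with equal sides
  it expresses a conjugation.\<close>

lemma traced_braid_square:
  fixes h :: "real \<times> real \<Rightarrow> nat \<Rightarrow> complex"
  assumes "continuous_on ({0..1} \<times> {0..1}) h" "h ` ({0..1} \<times> {0..1}) \<subseteq> conf n"
  shows "traced_braid n (\<lambda>t. h (0, t)) \<otimes>\<^bsub>Br n\<^esub> traced_braid n (\<lambda>s. h (s, 1))
    = traced_braid n (\<lambda>s. h (s, 0)) \<otimes>\<^bsub>Br n\<^esub> traced_braid n (\<lambda>t. h (1, t))"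
proof -
  have comp: "conf_path n (\<lambda>t. h (g t))" if "continuous_on {0..1} g" "g ` {0..1} \<subseteq> {0..1} \<times> {0..1}" for g
    using assms(2) that continuous_on_compose2[OF assms(1) that]
    unfolding conf_path_def path_def path_image_def by blast
  have 1: "conf_path n (\<lambda>t. h (s, t))" if "s \<in> {0..1}" for s
    using that by (intro comp) (auto intro: continuous_intros)
  have 2: "conf_path n (\<lambda>s. h (s, t))" if "t \<in> {0..1}" for t
    using that by (intro comp) (auto intro: continuous_intros)
  have "traced_braid n ((\<lambda>t. h (0, t)) +++ (\<lambda>s. h (s, 1))) = traced_braid n ((\<lambda>s. h (s, 0)) +++ (\<lambda>t. h (1, t)))"
    by (intro traced_braid_homotopic homotopic_square assms)
  then show ?thesis
    using 1 2 by (simp add: traced_braid_join)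
qed

section \<open>Difference vectors and linear deformations\<close>

definition segment_misses_0 :: "complex \<Rightarrow> complex \<Rightarrow> bool" where
  "segment_misses_0 z w \<longleftrightarrow> (\<forall>s\<in>{0..1}. of_real (1 - s) * z + of_real s * w \<noteq> 0)"

lemma segment_misses_0_uminus: "segment_misses_0 (- z) (- w) \<longleftrightarrow> segment_misses_0 z w"
proof -
  have "of_real (1 - s) * - z + of_real s * - w = - (of_real (1 - s) * z + of_real s * w)" for s
    by simp
  then show ?thesis unfolding segment_misses_0_def by (metis neg_equal_0_iff_equal)
qed

lemma segment_misses_0_minus_commute: "segment_misses_0 (x - y) (z - w) \<longleftrightarrow> segment_misses_0 (y - x) (w - z)"
  using segment_misses_0_uminus[of "y - x" "w - z"] by simp

lemma segment_misses_0_commute: "segment_misses_0 z w \<longleftrightarrow> segment_misses_0 w z"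
proof -
  have "segment_misses_0 w z" if "segment_misses_0 z w" for z w
    unfolding segment_misses_0_def
  proof
    fix s :: real assume "s \<in> {0..1}"
    then have "1 - s \<in> {0..1}" by auto
    with that have "of_real (1 - (1 - s)) * z + of_real (1 - s) * w \<noteq> 0"
      unfolding segment_misses_0_def by blast
    then show "of_real (1 - s) * w + of_real s * z \<noteq> 0" by (simp add: add.commute)
  qed
  then show ?thesis by blast
qed

lemma segment_misses_0_lex:
  assumes "lex_less 0 z" "lex_less 0 w"
  shows "segment_misses_0 z w"
  unfolding segment_misses_0_def
proof
  fix s :: real assume "s \<in> {0..1}"
  from lex_less_convex[OF assms this] show "of_real (1 - s) * z + of_real s * w \<noteq> 0" by auto
qed

lemma segment_misses_0_Re: "0 < Re z \<Longrightarrow> 0 < Re w \<Longrightarrow> segment_misses_0 z w"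
  by (rule segment_misses_0_lex) (auto simp: lex_less_def)

text \<open>The hypotheses are deliberately unequal: one vector may lie on the real axis, as at the
  ends of a half turn. Any positive share of the other lifts the combination off the axis.\<close>

lemma segment_misses_0_Im:
  assumes "z \<noteq> 0" "0 \<le> Im z" "0 < Im w"
  shows "segment_misses_0 z w"
  unfolding segment_misses_0_def
proof
  fix s :: real assume s: "s \<in> {0..1}"
  show "of_real (1 - s) * z + of_real s * w \<noteq> 0"
  proof (cases "s = 0")
    case False
    then have "0 < s * Im w" "0 \<le> (1 - s) * Im z" using s assms by auto
    then have "0 < Im (of_real (1 - s) * z + of_real s * w)" by simp
    then show ?thesis by (metis less_irrefl zero_complex.sel(2))
  qed (use assms in simp)
qed

lemma segment_misses_0_same: "z \<noteq> 0 \<Longrightarrow> segment_misses_0 z z"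
  by (simp add: segment_misses_0_def flip: distrib_right)

text \<open>The straight homotopy stays in \<open>conf n\<close> as soon as, for each pair of strands, the segment
  between the two difference vectors misses the origin. Its ends move inside lexicographic cells.\<close>

lemma traced_braid_eqI:
  assumes c: "conf_path n c" and d: "conf_path n d"
    and seg: "\<And>i k t. \<lbrakk>i \<in> {1..n}; k \<in> {1..n}; i < k; t \<in> {0..1}\<rbrakk> \<Longrightarrow>
      segment_misses_0 (c t k - c t i) (d t k - d t i)"
    and start: "\<And>i k. \<lbrakk>i \<in> {1..n}; k \<in> {1..n}; i < k\<rbrakk> \<Longrightarrow> lex_less (c 0 i) (c 0 k) \<longleftrightarrow> lex_less (d 0 i) (d 0 k)"
    and finish: "\<And>i k. \<lbrakk>i \<in> {1..n}; k \<in> {1..n}; i < k\<rbrakk> \<Longrightarrow> lex_less (c 1 i) (c 1 k) \<longleftrightarrow> lex_less (d 1 i) (d 1 k)"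
  shows "traced_braid n c = traced_braid n d"
proof -
  interpret group "Br n" by (rule group_braid_group)
  let ?h = "\<lambda>x :: real \<times> real. straight (c (snd x)) (d (snd x)) (fst x)"
  have "traced_braid n (\<lambda>t. ?h (0, t)) \<otimes>\<^bsub>Br n\<^esub> traced_braid n (\<lambda>s. ?h (s, 1))
    = traced_braid n (\<lambda>s. ?h (s, 0)) \<otimes>\<^bsub>Br n\<^esub> traced_braid n (\<lambda>t. ?h (1, t))"
  proof (rule traced_braid_square)
    show "continuous_on ({0..1} \<times> {0..1}) ?h"
      using c d by (intro continuous_on_straight) (auto simp: conf_path_def)
    show "?h ` ({0..1} \<times> {0..1}) \<subseteq> conf n"
      using seg conf_path_at[OF c] conf_path_at[OF d]
      by (auto intro!: straight_conf simp: segment_misses_0_def)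
  qed
  moreover have "traced_braid n (straight (c t) (d t)) = \<one>\<^bsub>Br n\<^esub>" if "t = 0 \<or> t = 1" for t
  proof -
    have t: "c t \<in> conf n" "d t \<in> conf n"
      using c d that conf_path_start conf_path_finish by blast+
    have eq: "lex_pos n (c t) = lex_pos n (d t)"
      using that start finish by (intro lex_pos_eqI t) auto
    show ?thesis
      using t eq by (intro traced_braid_cell conf_path_straight_cell) (auto simp: lex_pos_straight)
  qed
  ultimately show ?thesis
    using traced_braid_in_carrier[OF c] traced_braid_in_carrier[OF d] by simp
qed

lemma traced_braid_convex_image:
  fixes F :: "'b::real_normed_vector \<Rightarrow> nat \<Rightarrow> complex"
  assumes "convex K" "continuous_on K F" "F ` K \<subseteq> conf n"
    and "path p" "path_image p \<subseteq> K" "path q" "path_image q \<subseteq> K"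
    and "pathstart p = pathstart q" "pathfinish p = pathfinish q"
  shows "traced_braid n (F \<circ> p) = traced_braid n (F \<circ> q)"
  by (rule traced_braid_homotopic, rule homotopic_paths_convex_image[OF assms])

text \<open>Here both joining segments are constant. The lemma identifies \<open>sigma\<close>,
  which is defined by an explicit path, with a traced braid.\<close>

lemma traced_braid_braid_path:
  assumes "braid_path n p \<pi>"
  shows "traced_braid n p = path_class (conf n) p"
proof -
  have p: "path p" "path_image p \<subseteq> conf n" "p 0 = std_conf n" "p 1 = std_conf n \<circ> \<pi>" "\<pi> permutes {1..n}"
    using assms by (auto simp: braid_path_def pathstart_def pathfinish_def)
  have "pinned n p = (\<lambda>_. pathstart p) +++ p +++ (\<lambda>_. pathfinish p)"
    using p by (simp add: pinned_def pathstart_def pathfinish_def lex_pos_std_conf_comp)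
  moreover have "homotopic_paths (conf n) ((\<lambda>_. pathstart p) +++ p +++ (\<lambda>_. pathfinish p)) p"
  proof -
    have "homotopic_paths (conf n) ((\<lambda>_. pathstart p) +++ p +++ (\<lambda>_. pathfinish p)) ((\<lambda>_. pathstart p) +++ p)"
      using p homotopic_paths_rid_const[OF p(1,2)]
      by (intro homotopic_paths_join) (auto simp: path_const path_image_const path_image_def pathstart_def joinpaths_def)
    also have "homotopic_paths (conf n) \<dots> p"
      using p by (intro homotopic_paths_lid_const)
    finally show ?thesis .
  qed
  ultimately show ?thesis
    using p(3) by (simp add: traced_braid_sorted path_class_eqI)
qed

text \<open>Configurations depending on a parameter that ranges over a whole space. In a normed
  parameter space two paths with common ends are homotopic, so they trace the same braid.\<close>

definition conf_family :: "nat \<Rightarrow> ('a::topological_space \<Rightarrow> nat \<Rightarrow> complex) \<Rightarrow> bool" where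
  "conf_family n F \<longleftrightarrow> continuous_on UNIV F \<and> range F \<subseteq> conf n"

lemma conf_familyI:
  assumes "\<And>i. i \<in> {1..n} \<Longrightarrow> continuous_on UNIV (\<lambda>x. F x i)"
    and "\<And>x. F x \<in> conf n"
  shows "conf_family n F"
proof -
  have "continuous_on UNIV (\<lambda>x. F x i)" for i
  proof (cases "i \<in> {1..n}")
    case False
    then have "F x i = 0" for x
      using assms(2)[of x] by (auto simp: conf_def cspace_def)
    then show ?thesis by simp
  qed (rule assms(1))
  then show ?thesis
    using assms(2) by (auto simp: conf_family_def intro: continuous_on_coordinatewise_then_product)
qed

lemma conf_path_family: "conf_family n F \<Longrightarrow> path p \<Longrightarrow> conf_path n (F \<circ> p)"
  using path_continuous_image[of p F]
  by (auto simp: conf_path_def conf_family_def path_image_compose intro: continuous_on_subset)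

lemma traced_braid_family:
  fixes F :: "'b::real_normed_vector \<Rightarrow> nat \<Rightarrow> complex"
  assumes "conf_family n F" "path p" "path q" "pathstart p = pathstart q" "pathfinish p = pathfinish q"
  shows "traced_braid n (F \<circ> p) = traced_braid n (F \<circ> q)"
  using assms by (intro traced_braid_convex_image[of UNIV]) (auto simp: conf_family_def)

text \<open>The point \<open>b\<close> need not lie on the segment from \<open>a\<close> to
  \<open>c\<close>: the triangle is filled in the parameter space. This is how a simultaneous
  rotation is broken up into successive ones.\<close>

lemma traced_braid_linepath_join:
  fixes F :: "'b::real_normed_vector \<Rightarrow> nat \<Rightarrow> complex"
  assumes F: "conf_family n F"
  shows "traced_braid n (F \<circ> linepath a c)
    = traced_braid n (F \<circ> linepath a b) \<otimes>\<^bsub>Br n\<^esub> traced_braid n (F \<circ> linepath b c)"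
proof -
  have "traced_braid n (F \<circ> linepath a c) = traced_braid n (F \<circ> (linepath a b +++ linepath b c))"
    by (rule traced_braid_family[OF F]) auto
  also have "\<dots> = traced_braid n ((F \<circ> linepath a b) +++ (F \<circ> linepath b c))"
    by (simp only: joinpaths_compose)
  also have "\<dots> = traced_braid n (F \<circ> linepath a b) \<otimes>\<^bsub>Br n\<^esub> traced_braid n (F \<circ> linepath b c)"
    by (intro traced_braid_join conf_path_family F path_linepath) (auto simp: linepath_def)
  finally show ?thesis .
qed

lemma inj_on_conf: "y \<in> cspace n \<Longrightarrow> (\<And>i k. i \<in> {1..n} \<Longrightarrow> k \<in> {1..n} \<Longrightarrow> i < k \<Longrightarrow> y i \<noteq> y k) \<Longrightarrow> y \<in> conf n"
  unfolding conf_def by (auto intro!: linorder_inj_onI')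

subsection \<open>Crossings\<close>

definition half_twist :: "nat \<Rightarrow> nat \<Rightarrow> real \<Rightarrow> nat \<Rightarrow> complex" where
  "half_twist n k = (\<lambda>t j. if j = k then of_nat k + 1/2 - exp (\<i> * of_real (pi * t)) / 2
     else if j = k + 1 then of_nat k + 1/2 + exp (\<i> * of_real (pi * t)) / 2 else std_conf n j)"

lemma half_twist_diff: "half_twist n k t (Suc k) - half_twist n k t k = exp (\<i> * of_real (pi * t))"
  by (simp add: half_twist_def field_simps)

text \<open>The two rotating points keep their real parts between \<open>k\<close> and
  \<open>k + 1\<close>, where there is no other strand.\<close>

lemma Re_half_twist_less:
  assumes "k \<in> {1..<n}" "i \<in> {1..n}" "j \<in> {1..n}" "i < j" "\<not> (i = k \<and> j = Suc k)"
  shows "Re (half_twist n k t i) < Re (half_twist n k t j)"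
proof -
  have c: "cos (pi * t) \<le> 1" "- 1 \<le> cos (pi * t)" by simp_all
  have "Re (half_twist n k t j) = (if j = k then k + 1/2 - cos (pi * t) / 2
    else if j = k + 1 then k + 1/2 + cos (pi * t) / 2 else j)" if "j \<in> {1..n}" for j
    using that by (auto simp: half_twist_def std_conf_def Re_exp)
  moreover have "i < k \<Longrightarrow> real i + 1 \<le> k" "k < j \<Longrightarrow> real k + 1 \<le> j" "k + 1 < j \<Longrightarrow> real k + 2 \<le> j"
    using assms(4) by linarith+
  ultimately show ?thesis
    using assms c by (auto split: if_splits; linarith)
qed

lemma braid_path_half_twist:
  assumes k: "k \<in> {1..<n}"
  shows "braid_path n (half_twist n k) (Transposition.transpose k (Suc k))"
proof -
  have "conf_path n (half_twist n k)"
  proof (rule conf_pathI)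
    fix t :: real
    show "half_twist n k t \<in> conf n"
    proof (rule inj_on_conf)
      show "half_twist n k t \<in> cspace n" using k by (auto simp: cspace_def half_twist_def std_conf_def)
      show "half_twist n k t i \<noteq> half_twist n k t j" if "i \<in> {1..n}" "j \<in> {1..n}" "i < j" for i j
        using Re_half_twist_less[OF k that, of t] half_twist_diff[of n k t] by (cases "i = k \<and> j = Suc k") force+
    qed
  next
    fix i show "continuous_on {0..1} (\<lambda>t. half_twist n k t i)"
      unfolding half_twist_def by (cases "i = k"; cases "i = Suc k") (auto intro!: continuous_intros)
  qed
  moreover have "half_twist n k 0 = std_conf n" "half_twist n k 1 = std_conf n \<circ> Transposition.transpose k (Suc k)"
    using k by (auto simp: half_twist_def std_conf_def fun_eq_iff Transposition.transpose_def field_simps)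
  moreover have "Transposition.transpose k (Suc k) permutes {1..n}"
    using k by (intro permutes_swap_id) auto
  ultimately show ?thesis
    by (auto simp: braid_path_def conf_path_def pathstart_def pathfinish_def)
qed

lemma sigma_half_twist: "k \<in> {1..<n} \<Longrightarrow> sigma n k = traced_braid n (half_twist n k)"
  using traced_braid_braid_path[OF braid_path_half_twist]
  by (simp add: sigma_def half_twist_def)

text \<open>The vector from the left strand \<open>a\<close> to the right strand \<open>b\<close>
  stays in the upper half plane, as does \<open>exp (\<i> * of_real (pi * t))\<close> up to its real
  ends. All other differences stay lexicographically positive in both motions. So the motion deforms
  linearly to the counterclockwise half twist.\<close>

lemma traced_braid_crossing:
  assumes c: "conf_path n c" and ab: "a \<in> {1..n}" "b \<in> {1..n}"
    and pos: "lex_pos n (c 0) a = k" "lex_pos n (c 0) b = Suc k"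
    and above: "\<And>t. t \<in> {0..1} \<Longrightarrow> Im (c t a) < Im (c t b)"
    and final: "lex_less (c 1 b) (c 1 a)"
    and others: "\<And>i j t. \<lbrakk>i \<in> {1..n}; j \<in> {1..n}; \<not> (i = a \<and> j = b); lex_less (c 0 i) (c 0 j); t \<in> {0..1}\<rbrakk>
      \<Longrightarrow> lex_less (c t i) (c t j)"
  shows "traced_braid n c = sigma n k"
proof -
  let ?\<pi> = "lex_pos n (c 0)"
  let ?\<rho> = "inv_into UNIV ?\<pi>"
  have c0: "c 0 \<in> conf n" using c by (rule conf_path_start)
  note perm = lex_pos_permutes[OF c0]
  have \<rho>: "?\<rho> permutes {1..n}" using perm by (rule permutes_inv)
  have \<rho>_in: "?\<rho> i \<in> {1..n}" if "i \<in> {1..n}" for i using that permutes_in_image[OF \<rho>] by blast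
  have \<pi>\<rho>: "?\<pi> (?\<rho> i) = i" for i using permutes_inverses[OF perm] by simp
  have \<rho>k: "?\<rho> k = a" "?\<rho> (Suc k) = b" using pos permutes_inverses[OF perm] by metis+
  have "?\<pi> a \<in> {1..n}" "?\<pi> b \<in> {1..n}" using ab permutes_in_image[OF perm] by blast+
  then have k: "k \<in> {1..<n}" using pos by auto
  have eq_ab: "i = k \<and> j = Suc k" if "?\<rho> i = a \<and> ?\<rho> j = b" for i j
    using that \<pi>\<rho> pos by metis
  have less0: "lex_less (c 0 (?\<rho> i)) (c 0 (?\<rho> j))" if "i \<in> {1..n}" "j \<in> {1..n}" "i < j" for i j
    using lex_pos_less_iff[OF c0 \<rho>_in[OF that(1)] \<rho>_in[OF that(2)]] that(3) \<pi>\<rho> by simp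
  have less: "lex_less (c t (?\<rho> i)) (c t (?\<rho> j))"
    if "i \<in> {1..n}" "j \<in> {1..n}" "i < j" "\<not> (i = k \<and> j = Suc k)" "t \<in> {0..1}" for i j t
    using that eq_ab by (intro others[OF _ _ _ less0] \<rho>_in) auto
  have tw: "lex_less (half_twist n k t i) (half_twist n k t j)"
    if "i \<in> {1..n}" "j \<in> {1..n}" "i < j" "\<not> (i = k \<and> j = Suc k)" for i j t
    using Re_half_twist_less[OF k that] by (simp add: lex_less_def)
  have "traced_braid n c = traced_braid n (\<lambda>t. c t \<circ> ?\<rho>)"
    using traced_braid_relabel[of c, OF c0 \<rho>] by simp
  also have "\<dots> = traced_braid n (half_twist n k)"
  proof (rule traced_braid_eqI)
    show "conf_path n (\<lambda>t. c t \<circ> ?\<rho>)" using c \<rho> by (rule conf_path_relabel)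
    show "conf_path n (half_twist n k)"
      using braid_path_half_twist[OF k] by (simp add: braid_path_def conf_path_def)
    fix i j assume ij: "i \<in> {1..n}" "j \<in> {1..n}" "i < j"
    show "segment_misses_0 ((c t \<circ> ?\<rho>) j - (c t \<circ> ?\<rho>) i) (half_twist n k t j - half_twist n k t i)"
      if t: "t \<in> {0..1}" for t
    proof (cases "i = k \<and> j = Suc k")
      case True
      have "0 \<le> Im (exp (\<i> * of_real (pi * t)))"
        using t by (simp add: Im_exp sin_ge_zero mult_left_le)
      then have "segment_misses_0 (exp (\<i> * of_real (pi * t))) (c t b - c t a)"
        using above[OF t] by (intro segment_misses_0_Im) auto
      then show ?thesis using True \<rho>k half_twist_diff segment_misses_0_commute by (metis comp_apply)
    next
      case False
      show ?thesis
        using less[OF ij False t] tw[OF ij False]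
        by (intro segment_misses_0_lex) (simp_all flip: lex_less_diff)
    qed
    show "lex_less ((c 0 \<circ> ?\<rho>) i) ((c 0 \<circ> ?\<rho>) j) \<longleftrightarrow> lex_less (half_twist n k 0 i) (half_twist n k 0 j)"
      using less0[OF ij] tw[OF ij, of 0] by (cases "i = k \<and> j = Suc k") (auto simp: half_twist_def lex_less_def[of "of_nat k"])
    show "lex_less ((c 1 \<circ> ?\<rho>) i) ((c 1 \<circ> ?\<rho>) j) \<longleftrightarrow> lex_less (half_twist n k 1 i) (half_twist n k 1 j)"
    proof (cases "i = k \<and> j = Suc k")
      case True
      then show ?thesis using final \<rho>k lex_less_asym[OF final] by (auto simp: half_twist_def lex_less_def)
    qed (use less[OF ij, of 1] tw[OF ij, of 1] in auto)
  qed
  finally show ?thesis using sigma_half_twist[OF k] by simp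
qed

section \<open>Full twists of blocks\<close>

lemma sigma_in_carrier: "k \<in> {1..<n} \<Longrightarrow> sigma n k \<in> carrier (Br n)"
  using braid_path_half_twist[of k n]
  by (simp add: sigma_half_twist traced_braid_in_carrier braid_path_def conf_path_def)

section \<open>Words in the generators and the telescoping of pure generators\<close>

context
  fixes n :: nat
begin

interpretation B: group "Br n"
  by (rule group_braid_group)

lemma braid_word_Nil [simp]: "braid_word n [] = \<one>\<^bsub>Br n\<^esub>"
  and braid_word_Cons [simp]: "braid_word n (x # xs) = x \<otimes>\<^bsub>Br n\<^esub> braid_word n xs"
  by (simp_all add: braid_word_def)

lemma braid_word_in_carrier: "set xs \<subseteq> carrier (Br n) \<Longrightarrow> braid_word n xs \<in> carrier (Br n)"
  by (induction xs) auto

lemma braid_word_append: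
  "set xs \<subseteq> carrier (Br n) \<Longrightarrow> set ys \<subseteq> carrier (Br n) \<Longrightarrow>
    braid_word n (xs @ ys) = braid_word n xs \<otimes>\<^bsub>Br n\<^esub> braid_word n ys"
  by (induction xs) (auto simp: braid_word_in_carrier B.m_assoc)

lemma braid_word_inv:
  "set xs \<subseteq> carrier (Br n) \<Longrightarrow>
    braid_word n (map (\<lambda>x. inv\<^bsub>Br n\<^esub> x) xs) = inv\<^bsub>Br n\<^esub> braid_word n (rev xs)"
  by (induction xs) (auto simp: braid_word_in_carrier braid_word_append B.inv_mult_group)

lemma pure_gen_conj:
  assumes "1 \<le> a" "a < b" "b \<le> n"
  shows "pure_gen n a b = braid_word n (map (sigma n) (rev [Suc a..<b])) \<otimes>\<^bsub>Br n\<^esub>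
     (sigma n a \<otimes>\<^bsub>Br n\<^esub> sigma n a) \<otimes>\<^bsub>Br n\<^esub>
     inv\<^bsub>Br n\<^esub> braid_word n (map (sigma n) (rev [Suc a..<b]))"
proof -
  have sub: "set (map (sigma n) [Suc a..<b]) \<subseteq> carrier (Br n)" "sigma n a \<in> carrier (Br n)"
    using assms by (auto intro!: sigma_in_carrier)
  have "map (\<lambda>k. inv\<^bsub>Br n\<^esub> (sigma n k)) [Suc a..<b] = map (\<lambda>x. inv\<^bsub>Br n\<^esub> x) (map (sigma n) [Suc a..<b])"
    by simp
  then show ?thesis
    unfolding pure_gen_def using sub
    by (simp add: braid_word_append braid_word_inv braid_word_in_carrier B.m_assoc rev_map image_subset_iff
        del: map_map)
qed

lemma pure_gen_in_carrier:
  assumes "1 \<le> a" "a < b" "b \<le> n"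
  shows "pure_gen n a b \<in> carrier (Br n)"
proof -
  have "set (map (sigma n) (rev [Suc a..<b])) \<subseteq> carrier (Br n)" "sigma n a \<in> carrier (Br n)"
    using assms by (auto intro!: sigma_in_carrier)
  then show ?thesis
    unfolding pure_gen_conj[OF assms] by (simp add: braid_word_in_carrier del: set_map)
qed

text \<open>The right hand side describes strand \<open>b\<close> moving to the left above all others in the complex plane
  and returning below the strands of \<open>V\<close> only. The product of the generators telescopes to it.\<close>

lemma braid_word_pure_gen:
  assumes b: "b \<le> n" and m: "1 \<le> m" "m \<le> b"
  shows "braid_word n (map (\<lambda>a. pure_gen n a b) (filter (\<lambda>a. a \<in> V) [m..<b]))
    = braid_word n (map (sigma n) (rev [m..<b])) \<otimes>\<^bsub>Br n\<^esub>
      braid_word n (map (\<lambda>k. if k \<in> V then sigma n k else inv\<^bsub>Br n\<^esub> sigma n k) [m..<b])"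
  using m(2,1)
proof (induction m rule: inc_induct)
  case base
  then show ?case by simp
next
  case (step m)
  let ?L = "braid_word n (map (sigma n) (rev [Suc m..<b]))"
  let ?R = "braid_word n (map (\<lambda>k. if k \<in> V then sigma n k else inv\<^bsub>Br n\<^esub> sigma n k) [Suc m..<b])"
  have sub: "set (map (sigma n) (rev [Suc m..<b])) \<subseteq> carrier (Br n)"
    "set (map (\<lambda>k. if k \<in> V then sigma n k else inv\<^bsub>Br n\<^esub> sigma n k) [Suc m..<b]) \<subseteq> carrier (Br n)"
    and s: "sigma n m \<in> carrier (Br n)"
    using step.hyps step.prems b by (auto intro!: sigma_in_carrier)
  have L: "?L \<in> carrier (Br n)" and R: "?R \<in> carrier (Br n)"
    using sub by (intro braid_word_in_carrier, blast)+
  have IH: "braid_word n (map (\<lambda>a. pure_gen n a b) (filter (\<lambda>a. a \<in> V) [Suc m..<b])) = ?L \<otimes>\<^bsub>Br n\<^esub> ?R"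
    using step by simp
  have Lm: "braid_word n (map (sigma n) (rev [m..<b])) = ?L \<otimes>\<^bsub>Br n\<^esub> sigma n m"
    using step.hyps sub s by (simp add: upt_conv_Cons braid_word_append)
  show ?case
  proof (cases "m \<in> V")
    case True
    \<comment> \<open>The tail \<open>inv ?L\<close> of the generator cancels the head of the
      remaining product. Of the two factors \<open>sigma n m\<close>, one lengthens the left word
      and the other the right word.\<close>
    have "pure_gen n m b \<otimes>\<^bsub>Br n\<^esub> (?L \<otimes>\<^bsub>Br n\<^esub> ?R)
      = ?L \<otimes>\<^bsub>Br n\<^esub> (sigma n m \<otimes>\<^bsub>Br n\<^esub> sigma n m) \<otimes>\<^bsub>Br n\<^esub>
        (inv\<^bsub>Br n\<^esub> ?L \<otimes>\<^bsub>Br n\<^esub> (?L \<otimes>\<^bsub>Br n\<^esub> ?R))"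
      using pure_gen_conj[of m b] step.hyps step.prems b L R s by (simp add: B.m_assoc)
    also have "inv\<^bsub>Br n\<^esub> ?L \<otimes>\<^bsub>Br n\<^esub> (?L \<otimes>\<^bsub>Br n\<^esub> ?R) = ?R"
      using L R by (simp flip: B.m_assoc)
    finally show ?thesis
      using True step.hyps IH Lm L R s by (simp add: upt_conv_Cons B.m_assoc)
  next
    case False
    \<comment> \<open>No generator occurs for this \<open>m\<close>; the crossing added to the left
      word is undone at once by the right word.\<close>
    have "sigma n m \<otimes>\<^bsub>Br n\<^esub> (inv\<^bsub>Br n\<^esub> sigma n m \<otimes>\<^bsub>Br n\<^esub> ?R) = ?R"
      using s R by (simp flip: B.m_assoc)
    then show ?thesis
      using False step.hyps IH Lm L R s by (simp add: upt_conv_Cons B.m_assoc)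
  qed
qed

end

text \<open>The height \<open>4 * n\<close> leaves room for rotating the strands of \<open>V\<close> above the others.\<close>

definition hover :: "nat \<Rightarrow> nat set \<Rightarrow> nat \<Rightarrow> real \<Rightarrow> real \<Rightarrow> nat \<Rightarrow> complex" where
  "hover n V b h x j = (if j = b then Complex x h
     else if j \<in> V then Complex (real j) (4 * real n) else std_conf n j)"

section \<open>A single strand moving at constant height past the others\<close>

context
  fixes n :: nat and V :: "nat set" and b :: nat
  assumes V: "V \<subseteq> {1..n}" and b: "b \<in> {1..n}"
begin

interpretation B: group "Br n"
  by (rule group_braid_group)

lemma Re_hover: "j \<in> {1..n} \<Longrightarrow> Re (hover n V b h x j) = (if j = b then x else real j)"
  by (auto simp: hover_def std_conf_def)

lemma Im_hover: "j \<in> {1..n} \<Longrightarrow> Im (hover n V b h x j) = (if j = b then h else if j \<in> V then 4 * real n else 0)"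
  by (auto simp: hover_def std_conf_def)

lemma lex_less_hover:
  "i \<in> {1..n} \<Longrightarrow> j \<in> {1..n} \<Longrightarrow> i \<noteq> b \<Longrightarrow> j \<noteq> b \<Longrightarrow> lex_less (hover n V b h x i) (hover n V b h x j) \<longleftrightarrow> i < j"
  by (auto simp: lex_less_def Re_hover)

text \<open>Strand \<open>b\<close> is separated from the others by its height, and these from each
  other by their real parts. Hence \<open>x\<close> is unrestricted.\<close>

lemma conf_family_hover:
  assumes "h \<noteq> 0" "h \<noteq> 4 * real n"
  shows "conf_family n (hover n V b h)"
proof (rule conf_familyI)
  fix x show "hover n V b h x \<in> conf n"
  proof (rule inj_on_conf)
    show "hover n V b h x \<in> cspace n"
      using V b by (auto simp: cspace_def hover_def std_conf_def)
    fix i k assume ik: "i \<in> {1..n}" "k \<in> {1..n}" "i < k"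
    show "hover n V b h x i \<noteq> hover n V b h x k"
    proof (cases "i = b \<or> k = b")
      case True
      then have "Im (hover n V b h x i) \<noteq> Im (hover n V b h x k)"
        using ik assms by (auto simp: Im_hover)
      then show ?thesis by auto
    next
      case False
      then have "Re (hover n V b h x i) \<noteq> Re (hover n V b h x k)"
        using ik by (auto simp: Re_hover)
      then show ?thesis by auto
    qed
  qed
next
  fix i show "continuous_on UNIV (\<lambda>x. hover n V b h x i)"
    unfolding hover_def Complex_eq by (cases "i = b"; cases "i \<in> V") (auto intro!: continuous_intros)
qed

text \<open>The half-integers lie between the strands, so ties of real parts cannot occur there. For
  \<open>m = 0\<close> the first claim puts strand \<open>b\<close> to the left of all
  others.\<close>

lemma lex_pos_hover:
  assumes "m < b"
  shows "lex_pos n (hover n V b h (real m + 1/2)) b = Suc m"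
    and "1 \<le> m \<Longrightarrow> lex_pos n (hover n V b h (real m + 1/2)) m = m"
    and "1 \<le> m \<Longrightarrow> lex_pos n (hover n V b h (real m - 1/2)) b = m"
    and "1 \<le> m \<Longrightarrow> lex_pos n (hover n V b h (real m - 1/2)) m = Suc m"
proof -
  have m: "m < n" using assms b by simp
  have "{k\<in>{1..n}. lex_less (hover n V b h (real m + 1/2) k) (hover n V b h (real m + 1/2) b)} = {1..m}"
    using b assms m by (auto simp: lex_less_def Re_hover split: if_splits)
  then show "lex_pos n (hover n V b h (real m + 1/2)) b = Suc m"
    using b by (simp add: lex_pos_def)
  assume m1: "1 \<le> m"
  have "{k\<in>{1..n}. lex_less (hover n V b h (real m + 1/2) k) (hover n V b h (real m + 1/2) m)} = {1..<m}"
    using b assms m m1 by (auto simp: lex_less_def Re_hover split: if_splits)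
  then show "lex_pos n (hover n V b h (real m + 1/2)) m = m"
    using m m1 by (simp add: lex_pos_def)
  have "{k\<in>{1..n}. lex_less (hover n V b h (real m - 1/2) k) (hover n V b h (real m - 1/2) b)} = {1..<m}"
    using b assms m m1 by (auto simp: lex_less_def Re_hover split: if_splits)
  then show "lex_pos n (hover n V b h (real m - 1/2)) b = m"
    using b m1 by (simp add: lex_pos_def)
  have "{k\<in>{1..n}. lex_less (hover n V b h (real m - 1/2) k) (hover n V b h (real m - 1/2) m)} = insert b {1..<m}"
    using b assms m m1 by (auto simp: lex_less_def Re_hover split: if_splits)
  then show "lex_pos n (hover n V b h (real m - 1/2)) m = Suc m"
    using m m1 assms by (simp add: lex_pos_def)
qed

text \<open>Strand \<open>m\<close> is the only other strand with real part in the interval of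
  length one around \<open>m\<close>, so only the pair of \<open>m\<close> and \<open>b\<close> can
  change its order.\<close>

lemma hover_pass:
  assumes "i \<in> {1..n}" "j \<in> {1..n}" "x \<in> {real m - 1/2..real m + 1/2}" "y \<in> {real m - 1/2..real m + 1/2}"
    and "i \<noteq> m \<or> j \<noteq> b" "i \<noteq> b \<or> j \<noteq> m" "m \<noteq> b"
    and "lex_less (hover n V b h x i) (hover n V b h x j)"
  shows "lex_less (hover n V b h y i) (hover n V b h y j)"
proof -
  consider "i = b" "j = b" | "i = b" "j \<noteq> b" | "i \<noteq> b" "j = b" | "i \<noteq> b" "j \<noteq> b" by blast
  then show ?thesis
  proof cases
    case 2
    with assms have "x \<le> real j" by (auto simp: lex_less_def Re_hover)
    then have "real m - 1/2 \<le> real j" using assms by auto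
    then have "m \<le> j" by linarith
    then have "m < j" using 2 assms by auto
    then have "y < real j" using assms(4) by auto
    then show ?thesis using 2 assms by (simp add: lex_less_def Re_hover)
  next
    case 3
    with assms have "real i \<le> x" by (auto simp: lex_less_def Re_hover)
    then have "real i \<le> real m + 1/2" using assms by auto
    then have "i \<le> m" by linarith
    then have "i < m" using 3 assms by auto
    then have "real i < y" using assms(4) by auto
    then show ?thesis using 3 assms by (simp add: lex_less_def Re_hover)
  qed (use assms in \<open>auto simp: lex_less_hover\<close>)
qed

lemma linepath_in_interval:
  fixes x y :: real
  assumes "t \<in> {0..1}" "x \<in> {l..u}" "y \<in> {l..u}"
  shows "linepath x y t \<in> {l..u}"
proof -
  have "linepath x y t \<in> closed_segment x y"
    using assms(1) by (auto simp: linepath_def closed_segment_def)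
  then show ?thesis
    using closed_segment_subset[OF assms(2,3)] by auto
qed

text \<open>Strand \<open>b\<close> comes from the right above strand \<open>m\<close>, whose height
  is 0 or \<open>4 * n\<close>. In \<open>sigma\<close> it is the right-hand point which passes
  above.\<close>

lemma hover_cross_left:
  assumes m: "1 \<le> m" "m < b" and h: "0 < h" "h \<noteq> 4 * real n" "m \<in> V \<Longrightarrow> 4 * real n < h"
  shows "traced_braid n (hover n V b h \<circ> linepath (real m + 1/2) (real m - 1/2)) = sigma n m"
proof (rule traced_braid_crossing)
  let ?c = "hover n V b h \<circ> linepath (real m + 1/2) (real m - 1/2)"
  show "conf_path n ?c"
    using h by (intro conf_path_family conf_family_hover) auto
  show mb: "m \<in> {1..n}" "b \<in> {1..n}" using m b by auto
  show "lex_pos n (?c 0) m = m"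
    "lex_pos n (?c 0) b = Suc m"
    using lex_pos_hover m by (simp_all add: linepath_def)
  show "Im (?c t m)
      < Im (?c t b)" for t
    using mb m h by (auto simp: Im_hover)
  show "lex_less (?c 1 b)
      (?c 1 m)"
    using mb m by (auto simp: lex_less_def Re_hover linepath_def)
  fix i j and t :: real
  assume ij: "i \<in> {1..n}" "j \<in> {1..n}" "\<not> (i = m \<and> j = b)" "t \<in> {0..1}"
    "lex_less (?c 0 i)
      (?c 0 j)"
  have "i \<noteq> b \<or> j \<noteq> m"
    using ij(5) m mb by (auto simp: lex_less_def Re_hover linepath_def)
  then show "lex_less (?c t i)
      (?c t j)"
    using hover_pass[OF ij(1,2), of "linepath (real m + 1/2) (real m - 1/2) 0" m "linepath (real m + 1/2) (real m - 1/2) t"]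
      linepath_in_interval[OF ij(4), of "real m + 1/2" "real m - 1/2" "real m + 1/2" "real m - 1/2"] ij(3,5) m(2)
    by (simp add: linepath_def)
qed

text \<open>Now the lifted strand \<open>m\<close> is the right-hand one and passes above
  \<open>b\<close>, so the crossing is again positive although \<open>b\<close> moves the other
  way.\<close>

lemma hover_cross_right:
  assumes m: "1 \<le> m" "m < b" "m \<in> V" and h: "h \<noteq> 0" "h < 4 * real n"
  shows "traced_braid n (hover n V b h \<circ> linepath (real m - 1/2) (real m + 1/2)) = sigma n m"
proof (rule traced_braid_crossing)
  let ?c = "hover n V b h \<circ> linepath (real m - 1/2) (real m + 1/2)"
  show "conf_path n ?c"
    using h by (intro conf_path_family conf_family_hover) auto
  show mb: "b \<in> {1..n}" "m \<in> {1..n}" using m b by auto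
  show "lex_pos n (?c 0) b = m"
    "lex_pos n (?c 0) m = Suc m"
    using lex_pos_hover m by (simp_all add: linepath_def)
  show "Im (?c t b)
      < Im (?c t m)" for t
    using mb m h by (auto simp: Im_hover)
  show "lex_less (?c 1 m)
      (?c 1 b)"
    using mb m by (auto simp: lex_less_def Re_hover linepath_def)
  fix i j and t :: real
  assume ij: "i \<in> {1..n}" "j \<in> {1..n}" "\<not> (i = b \<and> j = m)" "t \<in> {0..1}"
    "lex_less (?c 0 i)
      (?c 0 j)"
  have "i \<noteq> m \<or> j \<noteq> b"
    using ij(5) m mb by (auto simp: lex_less_def Re_hover linepath_def)
  then show "lex_less (?c t i)
      (?c t j)"
    using hover_pass[OF ij(1,2), of "linepath (real m - 1/2) (real m + 1/2) 0" m "linepath (real m - 1/2) (real m + 1/2) t"]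
      linepath_in_interval[OF ij(4), of "real m - 1/2" "real m - 1/2" "real m + 1/2" "real m + 1/2"] ij(3,5) m(2)
    by (simp add: linepath_def)
qed

text \<open>No strand is passed between \<open>b - 1/2\<close> and \<open>b\<close>; this is the
  empty word at the base of both inductions below.\<close>

lemma hover_still:
  assumes h: "h \<noteq> 0" "h \<noteq> 4 * real n" and x: "x \<in> {real b - 1/2..real b}" "y \<in> {real b - 1/2..real b}"
  shows "traced_braid n (hover n V b h \<circ> linepath x y) = \<one>\<^bsub>Br n\<^esub>"
proof (rule traced_braid_cell)
  show c: "conf_path n (hover n V b h \<circ> linepath x y)"
    using h by (intro conf_path_family conf_family_hover) auto
  have less: "lex_less (hover n V b h z i) (hover n V b h z j) \<longleftrightarrow> i < j"
    if "i \<in> {1..n}" "j \<in> {1..n}" "z \<in> {real b - 1/2..real b}" for i j z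
    using that b by (auto simp: lex_less_def Re_hover)
  fix t :: real assume t: "t \<in> {0..1}"
  show "lex_pos n ((hover n V b h \<circ> linepath x y) t) = lex_pos n ((hover n V b h \<circ> linepath x y) 0)"
  proof (rule lex_pos_eqI)
    show "(hover n V b h \<circ> linepath x y) t \<in> conf n" "(hover n V b h \<circ> linepath x y) 0 \<in> conf n"
      using conf_path_at[OF c t] conf_path_start[OF c] by blast+
  qed (use less linepath_in_interval[OF t x] linepath_in_interval[OF _ x, of 0] in auto)
qed

lemma hover_left:
  assumes m: "1 \<le> m" "m \<le> b" and h: "4 * real n < h"
  shows "traced_braid n (hover n V b h \<circ> linepath (real b) (real m - 1/2)) = braid_word n (map (sigma n) (rev [m..<b]))"
  using m(2,1)
proof (induction m rule: inc_induct)
  case base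
  then show ?case using h by (subst hover_still) auto
next
  case (step m)
  have "set (map (sigma n) (rev [Suc m..<b])) \<subseteq> carrier (Br n)" "sigma n m \<in> carrier (Br n)"
    using step.hyps step.prems b by (auto intro!: sigma_in_carrier)
  moreover have "traced_braid n (hover n V b h \<circ> linepath (real b) (real m - 1/2))
    = traced_braid n (hover n V b h \<circ> linepath (real b) (real (Suc m) - 1/2)) \<otimes>\<^bsub>Br n\<^esub>
      traced_braid n (hover n V b h \<circ> linepath (real m + 1/2) (real m - 1/2))"
    using h by (subst traced_braid_linepath_join[OF conf_family_hover, where b = "real m + 1/2"]) (auto simp: algebra_simps)
  ultimately show ?case
    using step h hover_cross_left[of m h] by (simp add: upt_conv_Cons braid_word_append comp_def)
qed

lemma hover_right:
  assumes m: "1 \<le> m" "m \<le> b" and h: "0 < h" "h < 4 * real n"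
  shows "traced_braid n (hover n V b h \<circ> linepath (real m - 1/2) (real b))
    = braid_word n (map (\<lambda>k. if k \<in> V then sigma n k else inv\<^bsub>Br n\<^esub> sigma n k) [m..<b])"
  using m(2,1)
proof (induction m rule: inc_induct)
  case base
  then show ?case using h by (subst hover_still) auto
next
  case (step m)
  have "traced_braid n (hover n V b h \<circ> linepath (real m - 1/2) (real m + 1/2))
    = (if m \<in> V then sigma n m else inv\<^bsub>Br n\<^esub> sigma n m)"
  proof (cases "m \<in> V")
    case True
    then show ?thesis using step h by (simp add: hover_cross_right)
  next
    case False
    \<comment> \<open>A strand outside \<open>V\<close> lies below height \<open>h\<close>, so
      moving right past it undoes the passage to the left.\<close>
    have "hover n V b h \<circ> linepath (real m - 1/2) (real m + 1/2)
      = reversepath (hover n V b h \<circ> linepath (real m + 1/2) (real m - 1/2))"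
      by (auto simp: reversepath_def linepath_def fun_eq_iff algebra_simps)
    moreover have "conf_path n (hover n V b h \<circ> linepath (real m + 1/2) (real m - 1/2))"
      using h by (intro conf_path_family conf_family_hover) auto
    ultimately show ?thesis
      using False step h hover_cross_left[of m h] by (simp add: traced_braid_reversepath)
  qed
  moreover have "traced_braid n (hover n V b h \<circ> linepath (real m - 1/2) (real b))
    = traced_braid n (hover n V b h \<circ> linepath (real m - 1/2) (real m + 1/2)) \<otimes>\<^bsub>Br n\<^esub>
      traced_braid n (hover n V b h \<circ> linepath (real (Suc m) - 1/2) (real b))"
    using h by (subst traced_braid_linepath_join[OF conf_family_hover, where b = "real m + 1/2"]) (auto simp: algebra_simps)
  ultimately show ?case
    using step by (simp add: upt_conv_Cons comp_def)
qed

end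

definition lifted :: "nat \<Rightarrow> nat set \<Rightarrow> (nat \<Rightarrow> complex) \<Rightarrow> nat \<Rightarrow> complex" where
  "lifted n V y j = (if j \<in> V then y j + \<i> * (4 * of_nat n) else y j)"

definition spin :: "nat set \<Rightarrow> (nat \<Rightarrow> real) \<Rightarrow> (nat \<Rightarrow> complex) \<Rightarrow> nat \<Rightarrow> complex" where
  "spin V \<phi> y j = (if j \<in> V then exp (\<i> * of_real (\<phi> j)) * y j else y j)"

definition full_twist :: "nat \<Rightarrow> nat set \<Rightarrow> real \<Rightarrow> nat \<Rightarrow> complex" where
  "full_twist n V t = lifted n V (spin V (\<lambda>_. 2 * pi * t) (std_conf n))"

lemma std_conf_simps [simp]: "j \<in> {1..n} \<Longrightarrow> std_conf n j = of_nat j"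
  by (simp add: std_conf_def)

text \<open>A lifted point has imaginary part at least \<open>4 * n - 2 * n\<close>, any other at
  most \<open>n\<close>; so collisions can occur only within one of the two groups. The bound
  \<open>2 * n\<close> is chosen with \<open>drift\<close> in view.\<close>

lemma lifted_conf:
  assumes V: "V \<subseteq> {1..n}" and y: "y \<in> cspace n" and inj: "inj_on y V" "inj_on y ({1..n} - V)"
    and height: "\<And>j. j \<in> V \<Longrightarrow> norm (y j) \<le> 2 * real n" "\<And>j. j \<in> {1..n} - V \<Longrightarrow> Im (y j) \<le> real n"
  shows "lifted n V y \<in> conf n"
proof (rule inj_on_conf)
  show "lifted n V y \<in> cspace n"
    using V y by (auto simp: cspace_def lifted_def)
  have apart: "lifted n V y i \<noteq> lifted n V y k" if "i \<in> V" "k \<in> {1..n} - V" for i k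
  proof -
    have "- (2 * real n) \<le> Im (y i)"
      using height(1)[OF that(1)] abs_Im_le_cmod[of "y i"] by linarith
    moreover have "Im (y k) \<le> real n" "0 < real n" using height(2)[OF that(2)] that by auto
    ultimately have "Im (lifted n V y k) < Im (lifted n V y i)"
      using that by (simp add: lifted_def)
    then show ?thesis by auto
  qed
  fix i k assume ik: "i \<in> {1..n}" "k \<in> {1..n}" "i < k"
  then consider "i \<in> V" "k \<in> V" | "i \<in> V" "k \<in> {1..n} - V" | "i \<in> {1..n} - V" "k \<in> V" | "i \<in> {1..n} - V" "k \<in> {1..n} - V"
    by blast
  then show "lifted n V y i \<noteq> lifted n V y k"
  proof cases
    case 1
    then show ?thesis using inj_onD[OF inj(1)] ik by (auto simp: lifted_def)
  next
    case 3
    then show ?thesis using apart[of k i] by auto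
  next
    case 4
    then show ?thesis using inj_onD[OF inj(2), of i k] ik by (auto simp: lifted_def)
  qed (rule apart)
qed

text \<open>The strands move on concentric circles whose radii are their distinct labels, so their
  angles may be chosen independently.\<close>

lemma spin_std_conf:
  assumes V: "V \<subseteq> {1..n}"
  shows "lifted n V (spin V \<phi> (std_conf n)) \<in> conf n"
proof (rule lifted_conf[OF V])
  have norm: "norm (spin V \<phi> (std_conf n) j) = real j" if "j \<in> {1..n}" for j
    using that by (simp add: spin_def norm_mult)
  show "spin V \<phi> (std_conf n) \<in> cspace n"
    using V by (auto simp: cspace_def spin_def std_conf_def)
  have "inj_on (spin V \<phi> (std_conf n)) {1..n}"
    using norm by (metis inj_onI of_nat_eq_iff)
  then show "inj_on (spin V \<phi> (std_conf n)) V" "inj_on (spin V \<phi> (std_conf n)) ({1..n} - V)"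
    using V by (auto intro: inj_on_subset)
  show "norm (spin V \<phi> (std_conf n) j) \<le> 2 * real n" if "j \<in> V" for j
  proof -
    have j: "j \<in> {1..n}" using that V by blast
    then show ?thesis using norm[OF j] by simp
  qed
  show "Im (spin V \<phi> (std_conf n) j) \<le> real n" if "j \<in> {1..n} - V" for j
    using that by (simp add: spin_def)
qed

lemma conf_path_full_twist: "V \<subseteq> {1..n} \<Longrightarrow> conf_path n (full_twist n V)"
proof (rule conf_pathI)
  show "full_twist n V t \<in> conf n" if "V \<subseteq> {1..n}" for t
    unfolding full_twist_def using that by (rule spin_std_conf)
  show "continuous_on {0..1} (\<lambda>t. full_twist n V t i)" for i
    unfolding full_twist_def lifted_def spin_def by (cases "i \<in> V") (auto intro!: continuous_intros)
qed

lemma lex_less_Re: "Re z \<noteq> Re w \<Longrightarrow> lex_less z w \<longleftrightarrow> Re z < Re w"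
  by (auto simp: lex_less_def)

lemma sorted_filter_upt:
  fixes b :: nat
  assumes "V \<subseteq> {1..<b}"
  shows "sorted_list_of_set V = filter (\<lambda>a. a \<in> V) [1..<b]"
proof -
  have "finite V" using assms finite_subset by blast
  then show ?thesis
    using assms by (intro sorted_distinct_set_unique) (auto intro: sorted_wrt_filter)
qed

text \<open>The last factor of \<open>A_V\<close> collects the generators that involve the largest
  element; induction can therefore add the points of a block in increasing order.\<close>

lemma block_twist_insert_max:
  assumes V: "V \<subseteq> {1..<b}" and b: "b \<le> n"
  shows "block_twist n (insert b V) = block_twist n V \<otimes>\<^bsub>Br n\<^esub>
    braid_word n (map (\<lambda>a. pure_gen n a b) (filter (\<lambda>a. a \<in> V) [1..<b]))"
proof -
  have fin: "finite V" using V finite_subset by blast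
  have "sorted_list_of_set (insert b V) = sorted_list_of_set V @ [b]"
    using V fin by (intro sorted_distinct_set_unique) (auto simp: sorted_append simp del: sorted_list_of_set_insert_remove)
  moreover have "{a \<in> insert b V. a < b} = V" using V by auto
  moreover have "map (\<lambda>b'. map (\<lambda>a. pure_gen n a b') (sorted_list_of_set {a \<in> insert b V. a < b'})) (sorted_list_of_set V)
      = map (\<lambda>b'. map (\<lambda>a. pure_gen n a b') (sorted_list_of_set {a \<in> V. a < b'})) (sorted_list_of_set V)"
  proof (rule map_cong[OF refl])
    fix b' assume "b' \<in> set (sorted_list_of_set V)"
    then have "{a \<in> insert b V. a < b'} = {a \<in> V. a < b'}" using V fin by auto
    then show "map (\<lambda>a. pure_gen n a b') (sorted_list_of_set {a \<in> insert b V. a < b'})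
      = map (\<lambda>a. pure_gen n a b') (sorted_list_of_set {a \<in> V. a < b'})" by simp
  qed
  moreover have "set (concat (map (\<lambda>b'. map (\<lambda>a. pure_gen n a b') (sorted_list_of_set {a \<in> V. a < b'})) (sorted_list_of_set V)))
      \<subseteq> carrier (Br n)"
    using V b fin by (force intro!: pure_gen_in_carrier)
  moreover have "set (map (\<lambda>a. pure_gen n a b) (sorted_list_of_set V)) \<subseteq> carrier (Br n)"
    using V b fin by (auto intro!: pure_gen_in_carrier)
  ultimately show ?thesis
    unfolding block_twist_def sorted_filter_upt[OF V, symmetric] map_append concat_append
    by (simp only: list.map map_append concat_append concat.simps append_Nil2 braid_word_append)
qed

section \<open>The turn of the largest strand of a block\<close>

context
  fixes n :: nat and V :: "nat set" and b :: nat
  assumes V: "V \<subseteq> {1..<b}" and b: "b \<in> {1..n}"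
begin

private lemma V_n: "V \<subseteq> {1..n}" and bV: "b \<notin> V" and n: "0 < real n" "real b \<le> real n"
  using V b by auto

text \<open>The lifted points of \<open>V\<close> rest at distances less than \<open>b\<close> from
  the centre, so the circle of strand \<open>b\<close> encloses them all. It consists of a half
  above height \<open>4 * n\<close> and a half below it, compared with \<open>hover\<close>
  separately.\<close>

definition lone_turn :: "real \<Rightarrow> nat \<Rightarrow> complex" where
  "lone_turn \<theta> = lifted n (insert b V) (spin (insert b V) (\<lambda>j. if j = b then \<theta> else 0) (std_conf n))"

lemma conf_family_lone_turn: "conf_family n lone_turn"
proof (rule conf_familyI)
  show "lone_turn \<theta> \<in> conf n" for \<theta>
    unfolding lone_turn_def using V_n b by (intro spin_std_conf) auto
  show "continuous_on UNIV (\<lambda>\<theta>. lone_turn \<theta> i)" for i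
    unfolding lone_turn_def lifted_def spin_def by (cases "i = b"; cases "i \<in> V") (auto intro!: continuous_intros)
qed

lemma lone_turn_hover: "j \<in> {1..n} \<Longrightarrow> j \<noteq> b \<Longrightarrow> lone_turn \<theta> j = hover n V b h x j"
  by (auto simp: lone_turn_def hover_def lifted_def spin_def complex_eq_iff)

lemma Re_lone_turn: "Re (lone_turn \<theta> b) = real b * cos \<theta>"
  and Im_lone_turn: "Im (lone_turn \<theta> b) = real b * sin \<theta> + 4 * real n"
  using b by (auto simp: lone_turn_def lifted_def spin_def Re_exp Im_exp)

text \<open>All strands except \<open>b\<close> rest at the same places in both families, so only
  differences with \<open>b\<close> matter. The abscissas \<open>- b\<close> and \<open>1/2\<close>
  at the far left are interchangeable: both lie to the left of every other strand.\<close>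

lemma lone_turn_eq_hover:
  assumes h: "h \<noteq> 0" "h \<noteq> 4 * real n"
    and ends: "(\<theta> = 0 \<and> \<theta>' = pi \<and> x = real b \<and> x' = 1/2) \<or> (\<theta> = pi \<and> \<theta>' = 2 * pi \<and> x = 1/2 \<and> x' = real b)"
    and miss: "\<And>t u j. t \<in> {0..1} \<Longrightarrow> j \<in> {1..n} \<Longrightarrow> j \<noteq> b \<Longrightarrow> lone_turn (linepath \<theta> \<theta>' t) b - hover n V b h u j \<noteq> 0 \<Longrightarrow>
      segment_misses_0 (lone_turn (linepath \<theta> \<theta>' t) b - hover n V b h u j) (hover n V b h u b - hover n V b h u j)"
  shows "traced_braid n (lone_turn \<circ> linepath \<theta> \<theta>') = traced_braid n (hover n V b h \<circ> linepath x x')"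
proof -
  have c: "conf_path n (lone_turn \<circ> linepath \<theta> \<theta>')"
    by (intro conf_path_family conf_family_lone_turn path_linepath)
  have d: "conf_path n (hover n V b h \<circ> linepath x x')"
    using h V_n b by (intro conf_path_family conf_family_hover path_linepath) auto
  have seg: "segment_misses_0 (lone_turn (linepath \<theta> \<theta>' t) b - lone_turn (linepath \<theta> \<theta>' t) j)
      (hover n V b h (linepath x x' t) b - hover n V b h (linepath x x' t) j)"
    if t: "t \<in> {0..1}" and j: "j \<in> {1..n}" "j \<noteq> b" for t j
    unfolding lone_turn_hover[OF j, of _ h "linepath x x' t"]
    using miss[OF t j, of "linepath x x' t"] conf_distinct[OF conf_path_at[OF c t] b j(1)] j
    by (simp add: lone_turn_hover[OF j, of _ h "linepath x x' t"])
  have ends_lex: "lex_less (lone_turn (linepath \<theta> \<theta>' t) i) (lone_turn (linepath \<theta> \<theta>' t) k) \<longleftrightarrow>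
      lex_less (hover n V b h (linepath x x' t) i) (hover n V b h (linepath x x' t) k)"
    if ik: "i \<in> {1..n}" "k \<in> {1..n}" "i < k" and t: "t = 0 \<or> t = 1" for i k t
  proof -
    have R: "Re (lone_turn (linepath \<theta> \<theta>' t) j) = Re (hover n V b h (linepath x x' t) j)"
      if "j \<in> {1..n}" "j \<noteq> b" for j
      using lone_turn_hover[OF that] by metis
    have "(Re (lone_turn (linepath \<theta> \<theta>' t) b) = real b \<and> Re (hover n V b h (linepath x x' t) b) = real b) \<or>
        (Re (lone_turn (linepath \<theta> \<theta>' t) b) = - real b \<and> Re (hover n V b h (linepath x x' t) b) = 1/2)"
      using t ends b by (auto simp: Re_lone_turn Re_hover[OF V_n b] linepath_def)
    moreover have "1 \<le> real i" "1 \<le> real k" "real i < real k" using ik by auto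
    ultimately have "Re (lone_turn (linepath \<theta> \<theta>' t) i) \<noteq> Re (lone_turn (linepath \<theta> \<theta>' t) k) \<and>
        Re (hover n V b h (linepath x x' t) i) \<noteq> Re (hover n V b h (linepath x x' t) k) \<and>
        (Re (lone_turn (linepath \<theta> \<theta>' t) i) < Re (lone_turn (linepath \<theta> \<theta>' t) k) \<longleftrightarrow>
         Re (hover n V b h (linepath x x' t) i) < Re (hover n V b h (linepath x x' t) k))"
      using R[OF ik(1)] R[OF ik(2)] Re_hover[OF V_n b ik(1), of h "linepath x x' t"]
        Re_hover[OF V_n b ik(2), of h "linepath x x' t"]
      by (cases "i = b"; cases "k = b"; elim disjE conjE; simp split del: if_split)
    then show ?thesis
      by (simp add: lex_less_Re)
  qed
  show ?thesis
  proof (rule traced_braid_eqI[OF c d])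
    fix i k t assume ik: "i \<in> {1..n}" "k \<in> {1..n}" "i < k" and t: "t \<in> {0..1 :: real}"
    show "segment_misses_0 ((lone_turn \<circ> linepath \<theta> \<theta>') t k - (lone_turn \<circ> linepath \<theta> \<theta>') t i)
        ((hover n V b h \<circ> linepath x x') t k - (hover n V b h \<circ> linepath x x') t i)"
    proof -
      consider "k = b" "i \<noteq> b" | "i = b" "k \<noteq> b" | "i \<noteq> b" "k \<noteq> b" using ik by blast
      then show ?thesis
      proof cases
        case 1
        then show ?thesis using seg[OF t ik(1)] by simp
      next
        case 2
        then show ?thesis using seg[OF t ik(2)] by (subst segment_misses_0_minus_commute) simp
      next
        case 3
        then show ?thesis
          using lone_turn_hover[OF ik(1), of _ h "linepath x x' t"] lone_turn_hover[OF ik(2), of _ h "linepath x x' t"]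
            conf_distinct[OF conf_path_at[OF d t] ik(1,2)] ik
          by (simp add: segment_misses_0_same)
      qed
    qed
  qed (use ends_lex[of _ _ 0] ends_lex[of _ _ 1] in auto)
qed

text \<open>On this half the strand is at least as high as the lifted ones; \<open>8 * n\<close> is
  a height strictly above all of them.\<close>

lemma lone_turn_upper:
  "traced_braid n (lone_turn \<circ> linepath 0 pi) = traced_braid n (hover n V b (8 * real n) \<circ> linepath (real b) (1/2))"
proof (rule lone_turn_eq_hover)
  fix t u :: real and j assume t: "t \<in> {0..1}" and j: "j \<in> {1..n}" "j \<noteq> b"
    and nz: "lone_turn (linepath 0 pi t) b - hover n V b (8 * real n) u j \<noteq> 0"
  have "linepath 0 pi t \<in> {0..pi}" using t by (intro linepath_in_interval) auto
  then have "0 \<le> sin (linepath 0 pi t)" by (intro sin_ge_zero) auto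
  then show "segment_misses_0 (lone_turn (linepath 0 pi t) b - hover n V b (8 * real n) u j)
      (hover n V b (8 * real n) u b - hover n V b (8 * real n) u j)"
    using j b n nz by (intro segment_misses_0_Im) (auto simp: Im_lone_turn Im_hover[OF V_n b])
qed (use n in auto)

text \<open>On this half the height of the strand lies between \<open>3 * n\<close> and
  \<open>4 * n\<close>. The height \<open>2 * n\<close> too is between the two levels: under
  \<open>V\<close> and above the rest.\<close>

lemma lone_turn_lower:
  "traced_braid n (lone_turn \<circ> linepath pi (2 * pi)) = traced_braid n (hover n V b (2 * real n) \<circ> linepath (1/2) (real b))"
proof (rule lone_turn_eq_hover)
  fix t u :: real and j assume t: "t \<in> {0..1}" and j: "j \<in> {1..n}" "j \<noteq> b"
    and nz: "lone_turn (linepath pi (2 * pi) t) b - hover n V b (2 * real n) u j \<noteq> 0"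
  have "linepath pi (2 * pi) t \<in> {pi..2 * pi}" using t by (intro linepath_in_interval) auto
  then have "0 \<le> sin (linepath pi (2 * pi) t - pi)" by (intro sin_ge_zero) auto
  then have s: "sin (linepath pi (2 * pi) t) \<le> 0" by (simp add: sin_diff)
  have "- real n \<le> real b * sin (linepath pi (2 * pi) t)"
  proof -
    have "real b * (- sin (linepath pi (2 * pi) t)) \<le> real b * 1"
      by (intro mult_left_mono) (auto simp: minus_le_iff)
    then show ?thesis using n by simp
  qed
  moreover have "real b * sin (linepath pi (2 * pi) t) \<le> 0"
    using s by (simp add: mult_nonneg_nonpos)
  ultimately show "segment_misses_0 (lone_turn (linepath pi (2 * pi) t) b - hover n V b (2 * real n) u j)
      (hover n V b (2 * real n) u b - hover n V b (2 * real n) u j)"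
  proof (cases "j \<in> V")
    case True
    then show ?thesis
      using j b n nz \<open>real b * sin (linepath pi (2 * pi) t) \<le> 0\<close>
      by (subst segment_misses_0_minus_commute, intro segment_misses_0_Im) (auto simp: Im_lone_turn Im_hover[OF V_n b])
  next
    case False
    then show ?thesis
      using j b n nz \<open>- real n \<le> real b * sin (linepath pi (2 * pi) t)\<close>
      by (intro segment_misses_0_Im) (auto simp: Im_lone_turn Im_hover[OF V_n b])
  qed
qed (use n in auto)

lemma traced_braid_lone_turn:
  "traced_braid n (lone_turn \<circ> linepath 0 (2 * pi))
    = braid_word n (map (\<lambda>a. pure_gen n a b) (filter (\<lambda>a. a \<in> V) [1..<b]))"
proof -
  have "traced_braid n (hover n V b (8 * real n) \<circ> linepath (real b) (1/2)) = braid_word n (map (sigma n) (rev [1..<b]))"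
    using hover_left[OF V_n b, of 1 "8 * real n"] b n by auto
  moreover have "traced_braid n (hover n V b (2 * real n) \<circ> linepath (1/2) (real b))
    = braid_word n (map (\<lambda>k. if k \<in> V then sigma n k else inv\<^bsub>Br n\<^esub> sigma n k) [1..<b])"
    using hover_right[OF V_n b, of 1 "2 * real n"] b n by auto
  ultimately show ?thesis
    using b traced_braid_linepath_join[OF conf_family_lone_turn, of 0 "2 * pi" pi]
    by (simp add: lone_turn_upper lone_turn_lower braid_word_pure_gen)
qed

lemma traced_braid_full_twist_insert:
  "traced_braid n (full_twist n (insert b V)) = traced_braid n (full_twist n V) \<otimes>\<^bsub>Br n\<^esub>
    braid_word n (map (\<lambda>a. pure_gen n a b) (filter (\<lambda>a. a \<in> V) [1..<b]))"
proof -
  \<comment> \<open>The coordinates are the angle of \<open>V\<close> and the angle of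
    \<open>b\<close>. The diagonal is the full twist of the enlarged block; along the edges
    \<open>V\<close> turns first and \<open>b\<close> afterwards.\<close>
  define F where "F = (\<lambda>x :: real \<times> real. lifted n (insert b V)
    (spin (insert b V) (\<lambda>j. if j = b then snd x else fst x) (std_conf n)))"
  have F: "conf_family n F"
  proof (rule conf_familyI)
    show "F x \<in> conf n" for x
      unfolding F_def using V_n b by (intro spin_std_conf) auto
    show "continuous_on UNIV (\<lambda>x. F x i)" for i
      unfolding F_def lifted_def spin_def by (cases "i = b"; cases "i \<in> V") (auto intro!: continuous_intros)
  qed
  have "full_twist n (insert b V) = F \<circ> linepath (0, 0) (2 * pi, 2 * pi)"
    by (auto simp: F_def full_twist_def lifted_def spin_def linepath_def fun_eq_iff algebra_simps)
  moreover have "F \<circ> linepath (2 * pi, 0) (2 * pi, 2 * pi) = lone_turn \<circ> linepath 0 (2 * pi)"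
    using exp_two_pi_i
    by (auto simp: F_def lone_turn_def lifted_def spin_def linepath_def fun_eq_iff algebra_simps)
  \<comment> \<open>On this edge \<open>b\<close> rests at the lifted level, but in the twist of
    \<open>V\<close> at height 0. Throughout, smaller strands have real part below \<open>b\<close>
    and larger ones above it, so its height does not affect the braid.\<close>
  moreover have "traced_braid n (F \<circ> linepath (0, 0) (2 * pi, 0)) = traced_braid n (full_twist n V)"
  proof (rule traced_braid_eqI)
    let ?c = "F \<circ> linepath (0, 0) (2 * pi, 0)"
    show c: "conf_path n ?c"
      by (intro conf_path_family F path_linepath)
    show d: "conf_path n (full_twist n V)"
      using V_n by (rule conf_path_full_twist)
    have eq: "?c t j = (if j = b then of_nat b + \<i> * (4 * of_nat n) else full_twist n V t j)" for t j
      using b bV by (auto simp: F_def full_twist_def lifted_def spin_def linepath_def algebra_simps)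
    have Re_twist: "Re (full_twist n V t j) < real b" if "j < b" "j \<in> {1..n}" for t j
    proof -
      have "real j * cos (t * (pi * 2)) \<le> real j * 1" by (intro mult_left_mono) auto
      then have "real j * cos (t * (pi * 2)) < real b" using that by linarith
      then show ?thesis using that by (auto simp: full_twist_def lifted_def spin_def Re_exp mult.commute)
    qed
    have Re_twist': "Re (full_twist n V t j) = real j" if "j \<ge> b" "j \<in> {1..n}" for t j
      using that V by (auto simp: full_twist_def lifted_def spin_def)
    have Re_ends: "Re (full_twist n V t j) = real j" if "j \<in> {1..n}" "t = 0 \<or> t = 1" for t j
      using that exp_two_pi_i by (auto simp: full_twist_def lifted_def spin_def algebra_simps)
    fix i k assume ik: "i \<in> {1..n}" "k \<in> {1..n}" "i < k"
    show "segment_misses_0 (?c t k - ?c t i)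
        (full_twist n V t k - full_twist n V t i)" if "t \<in> {0..1}" for t
    proof -
      consider "k = b" | "i = b" | "i \<noteq> b" "k \<noteq> b" by blast
      then show ?thesis
      proof cases
        case 1
        then show ?thesis
          using ik Re_twist[of i t] Re_twist'[of b t] b unfolding eq by (intro segment_misses_0_Re) auto
      next
        case 2
        then show ?thesis
          using ik Re_twist'[of k t] Re_twist'[of b t] b unfolding eq by (intro segment_misses_0_Re) auto
      next
        case 3
        then show ?thesis
          using conf_distinct[OF conf_path_at[OF d that] ik(1,2)] ik unfolding eq by (simp add: segment_misses_0_same)
      qed
    qed
    have "lex_less (?c t i) (?c t k)
        \<longleftrightarrow> lex_less (full_twist n V t i) (full_twist n V t k)" if "t = 0 \<or> t = 1" for t
      unfolding eq using ik Re_ends[OF _ that] by (auto simp: lex_less_def)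
    then show "lex_less (?c 0 i) (?c 0 k)
        \<longleftrightarrow> lex_less (full_twist n V 0 i) (full_twist n V 0 k)"
      "lex_less (?c 1 i) (?c 1 k)
        \<longleftrightarrow> lex_less (full_twist n V 1 i) (full_twist n V 1 k)"
      by blast+
  qed
  ultimately show ?thesis
    using traced_braid_linepath_join[OF F, of "(0, 0)" "(2 * pi, 2 * pi)" "(2 * pi, 0)"] traced_braid_lone_turn by simp
qed

end

theorem traced_braid_full_twist:
  assumes "V \<subseteq> {1..n}"
  shows "traced_braid n (full_twist n V) = block_twist n V"
proof -
  have "finite V" using assms finite_subset by blast
  then show ?thesis using assms
  proof (induction V rule: finite_linorder_max_induct)
    case empty
    have "full_twist n {} = (\<lambda>_. std_conf n)"
      by (simp add: full_twist_def lifted_def spin_def fun_eq_iff)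
    then show ?case
      by (simp add: traced_braid_cell conf_path_def path_const path_image_const block_twist_def)
  next
    case (insert b V)
    then have "V \<subseteq> {1..<b}" "b \<in> {1..n}" by auto
    with insert show ?case
      using traced_braid_full_twist_insert[of V b n] block_twist_insert_max[of V b n] by simp
  qed
qed

section \<open>Conjugating block twists\<close>

text \<open>Real parts move linearly from \<open>i\<close> to \<open>\<pi> i\<close>. The summand
  \<open>i * (t * (1 - t))\<close> gives the strands different heights for \<open>0 < t < 1\<close>,
  so that they do not meet when their real parts agree.\<close>

definition drift :: "nat \<Rightarrow> (nat \<Rightarrow> nat) \<Rightarrow> real \<Rightarrow> nat \<Rightarrow> complex" where
  "drift n \<pi> t i = (if i \<in> {1..n} then Complex ((1 - t) * real i + t * real (\<pi> i)) (real i * (t * (1 - t))) else 0)"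

text \<open>A path for the braid \<open>\<gamma>\<close> of the overview.\<close>

definition carry :: "nat \<Rightarrow> nat set \<Rightarrow> (nat \<Rightarrow> nat) \<Rightarrow> real \<Rightarrow> nat \<Rightarrow> complex" where
  "carry n V \<pi> t = lifted n V (drift n \<pi> t)"

lemma exp_full_turn: "exp (\<i> * of_real (2 * pi)) = 1"
  using exp_two_pi_i by (simp add: ac_simps)

lemma spin_zero: "spin V (\<lambda>_. 0) y = y" and spin_full: "spin V (\<lambda>_. 2 * pi) y = y"
  using exp_full_turn by (auto simp: spin_def fun_eq_iff)

context
  fixes n :: nat and V :: "nat set" and \<pi> :: "nat \<Rightarrow> nat"
  assumes V: "V \<subseteq> {1..n}" and \<pi>: "\<pi> permutes {1..n}"
begin

interpretation B: group "Br n"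
  by (rule group_braid_group)

lemma drift_0: "drift n \<pi> 0 = std_conf n" and drift_1: "drift n \<pi> 1 = std_conf n \<circ> \<pi>"
  using permutes_in_image[OF \<pi>] by (auto simp: drift_def std_conf_def fun_eq_iff complex_eq_iff simp del: atLeastAtMost_iff)

lemma inj_on_drift: "inj_on (drift n \<pi> t) {1..n}"
proof (rule inj_onI)
  fix i k assume ik: "i \<in> {1..n}" "k \<in> {1..n}" and eq: "drift n \<pi> t i = drift n \<pi> t k"
  then have "real i * (t * (1 - t)) = real k * (t * (1 - t))"
    and re: "(1 - t) * real i + t * real (\<pi> i) = (1 - t) * real k + t * real (\<pi> k)"
    by (auto simp: drift_def)
  then have "i = k \<or> t = 0 \<or> t = 1" by auto
  then show "i = k" using re inj_eq[OF permutes_inj[OF \<pi>]] by auto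
qed

text \<open>Real and imaginary parts both lie between 0 and \<open>n\<close>, whence the bound
  \<open>2 * n\<close> required by \<open>lifted_conf\<close>.\<close>

lemma norm_drift:
  assumes "i \<in> {1..n}" "t \<in> {0..1}"
  shows "norm (drift n \<pi> t i) \<le> 2 * real n" and "Im (drift n \<pi> t i) \<le> real n"
proof -
  have "\<pi> i \<in> {1..n}" using assms permutes_in_image[OF \<pi>] by blast
  then have "(1 - t) * real i + t * real (\<pi> i) \<le> (1 - t) * real n + t * real n"
    using assms by (intro add_mono mult_left_mono) auto
  moreover have "real i * (t * (1 - t)) \<le> real n * 1"
    using assms by (intro mult_mono mult_le_one) auto
  moreover have "0 \<le> (1 - t) * real i + t * real (\<pi> i)" "0 \<le> real i * (t * (1 - t))"
    using assms by auto
  ultimately show "norm (drift n \<pi> t i) \<le> 2 * real n" "Im (drift n \<pi> t i) \<le> real n"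
    using assms cmod_le[of "drift n \<pi> t i"] by (auto simp: drift_def algebra_simps)
qed

text \<open>A common rotation of \<open>V\<close> preserves norms and keeps its points distinct, so
  the lifted block stays clear of the others during the drift.\<close>

lemma spin_drift_conf:
  assumes t: "t \<in> {0..1}"
  shows "lifted n V (spin V (\<lambda>_. \<theta>) (drift n \<pi> t)) \<in> conf n"
proof (rule lifted_conf[OF V])
  show "spin V (\<lambda>_. \<theta>) (drift n \<pi> t) \<in> cspace n"
    using V by (auto simp: cspace_def spin_def drift_def)
  show "inj_on (spin V (\<lambda>_. \<theta>) (drift n \<pi> t)) V"
  proof (rule inj_onI)
    fix i k assume ik: "i \<in> V" "k \<in> V" "spin V (\<lambda>_. \<theta>) (drift n \<pi> t) i = spin V (\<lambda>_. \<theta>) (drift n \<pi> t) k"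
    then have "drift n \<pi> t i = drift n \<pi> t k" by (simp add: spin_def)
    then show "i = k" using inj_onD[OF inj_on_drift] ik V by blast
  qed
  show "inj_on (spin V (\<lambda>_. \<theta>) (drift n \<pi> t)) ({1..n} - V)"
  proof (rule inj_onI)
    fix i k assume ik: "i \<in> {1..n} - V" "k \<in> {1..n} - V" "spin V (\<lambda>_. \<theta>) (drift n \<pi> t) i = spin V (\<lambda>_. \<theta>) (drift n \<pi> t) k"
    then have "drift n \<pi> t i = drift n \<pi> t k" by (simp add: spin_def)
    then show "i = k" using inj_onD[OF inj_on_drift] ik by blast
  qed
  show "norm (spin V (\<lambda>_. \<theta>) (drift n \<pi> t) j) \<le> 2 * real n" if "j \<in> V" for j
    using norm_drift(1)[OF _ t, of j] that V by (auto simp: spin_def norm_mult)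
  show "Im (spin V (\<lambda>_. \<theta>) (drift n \<pi> t) j) \<le> real n" if "j \<in> {1..n} - V" for j
    using norm_drift(2)[OF _ t, of j] that by (auto simp: spin_def)
qed

lemma conf_path_carry: "conf_path n (carry n V \<pi>)"
proof (rule conf_pathI)
  show "carry n V \<pi> t \<in> conf n" if "t \<in> {0..1}" for t
    using spin_drift_conf[OF that, of 0] by (simp add: carry_def spin_zero)
  show "continuous_on {0..1} (\<lambda>t. carry n V \<pi> t i)" for i
    unfolding carry_def lifted_def drift_def Complex_eq
    by (cases "i \<in> {1..n}"; cases "i \<in> V") (auto intro!: continuous_intros)
qed

lemma lex_pos_lifted_comp:
  assumes "\<sigma> permutes {1..n}" "lifted n V (std_conf n \<circ> \<sigma>) \<in> conf n"
  shows "lex_pos n (lifted n V (std_conf n \<circ> \<sigma>)) = \<sigma>"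
proof (rule lex_pos_unique[OF assms(1)])
  fix i k assume ik: "i \<in> {1..n}" "k \<in> {1..n}"
  have "\<sigma> i = \<sigma> k \<Longrightarrow> i = k" using inj_eq[OF permutes_inj[OF assms(1)]] by auto
  moreover have "\<sigma> j \<in> {1..n}" if "j \<in> {1..n}" for j using that permutes_in_image[OF assms(1)] by blast
  ultimately show "lex_less (lifted n V (std_conf n \<circ> \<sigma>) i) (lifted n V (std_conf n \<circ> \<sigma>) k) \<longleftrightarrow> \<sigma> i < \<sigma> k"
    using ik by (cases "i = k") (auto simp: lifted_def lex_less_def simp del: atLeastAtMost_iff)
qed

lemma lex_pos_carry_0: "lex_pos n (carry n V \<pi> 0) = id"
  using lex_pos_lifted_comp[of id] conf_path_start[OF conf_path_carry]
  by (simp add: carry_def drift_0 permutes_id)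

lemma lex_pos_carry_1: "lex_pos n (carry n V \<pi> 1) = \<pi>"
  using lex_pos_lifted_comp[OF \<pi>] conf_path_finish[OF conf_path_carry]
  by (simp add: carry_def drift_1)

text \<open>The square has the angle of the block and the time of the drift as coordinates. Angles 0
  and \<open>2 * pi\<close> give the same two sides; the other sides are the full twist before and
  after the drift.\<close>

lemma traced_braid_carry_conj:
  "traced_braid n (carry n V \<pi>) \<otimes>\<^bsub>Br n\<^esub> traced_braid n (full_twist n (\<pi> ` V))
    = block_twist n V \<otimes>\<^bsub>Br n\<^esub> traced_braid n (carry n V \<pi>)"
proof -
  define h where "h = (\<lambda>x :: real \<times> real. lifted n V (spin V (\<lambda>_. 2 * pi * fst x) (drift n \<pi> (snd x))))"
  have "traced_braid n (\<lambda>t. h (0, t)) \<otimes>\<^bsub>Br n\<^esub> traced_braid n (\<lambda>s. h (s, 1))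
    = traced_braid n (\<lambda>s. h (s, 0)) \<otimes>\<^bsub>Br n\<^esub> traced_braid n (\<lambda>t. h (1, t))"
  proof (rule traced_braid_square)
    have "continuous_on ({0..1} \<times> {0..1}) (\<lambda>x. h x i)" for i
      unfolding h_def lifted_def spin_def drift_def Complex_eq
      by (cases "i \<in> {1..n}"; cases "i \<in> V") (auto intro!: continuous_intros)
    then show "continuous_on ({0..1} \<times> {0..1}) h"
      by (rule continuous_on_coordinatewise_then_product)
    show "h ` ({0..1} \<times> {0..1}) \<subseteq> conf n"
      using spin_drift_conf by (auto simp: h_def)
  qed
  moreover have "(\<lambda>t. h (0, t)) = carry n V \<pi>" "(\<lambda>t. h (1, t)) = carry n V \<pi>"
    using spin_full[of V] by (auto simp: h_def carry_def spin_zero)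
  moreover have "(\<lambda>s. h (s, 0)) = full_twist n V"
    by (auto simp: h_def full_twist_def drift_0)
  moreover have "(\<lambda>s. h (s, 1)) = (\<lambda>s. full_twist n (\<pi> ` V) s \<circ> \<pi>)"
    using permutes_inj[OF \<pi>]
    by (auto simp: h_def full_twist_def drift_1 lifted_def spin_def fun_eq_iff inj_image_mem_iff)
  moreover have "\<pi> ` V \<subseteq> {1..n}"
    using V permutes_image[OF \<pi>] by blast
  then have "traced_braid n (\<lambda>s. full_twist n (\<pi> ` V) s \<circ> \<pi>) = traced_braid n (full_twist n (\<pi> ` V))"
    by (intro traced_braid_relabel \<pi> conf_path_start conf_path_full_twist)
  ultimately show ?thesis
    using traced_braid_full_twist[OF V] by simp
qed

end

section \<open>Pure conjugators\<close>

lemma traced_braid_pure: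
  assumes "conf_path n c" "lex_pos n (c 0) = id" "lex_pos n (c 1) = id"
  shows "traced_braid n c \<in> carrier (pure_braid_group n)"
  using braid_path_pinned[OF assms(1,2)] assms(3) traced_braid_sorted[of n c, OF assms(2)]
  by (auto simp: pure_braid_group_def fundamental_group_def braid_path_def)

text \<open>Takes the braid and not a path, so that the conjugator built from it is a function of
  the diagram. The choice is harmless because all representatives end at the same
  configuration.\<close>

definition end_perm :: "nat \<Rightarrow> braid \<Rightarrow> nat \<Rightarrow> nat" where
  "end_perm n P = lex_pos n (pathfinish (SOME p. p \<in> P))"

lemma end_perm_traced_braid:
  assumes "conf_path n c" "lex_pos n (c 0) = id"
  shows "end_perm n (traced_braid n c) = lex_pos n (c 1)"
proof -
  let ?P = "traced_braid n c"
  have pin: "path (pinned n c)" "path_image (pinned n c) \<subseteq> conf n" "pathfinish (pinned n c) = std_conf n \<circ> lex_pos n (c 1)"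
    using braid_path_pinned[OF assms] by (auto simp: braid_path_def)
  have P: "?P = path_class (conf n) (pinned n c)"
    using assms(2) by (rule traced_braid_sorted)
  then have "(SOME p. p \<in> ?P) \<in> ?P"
    using path_class_self[OF pin(1,2)] by (metis someI)
  then have "homotopic_paths (conf n) (pinned n c) (SOME p. p \<in> ?P)"
    unfolding P by (simp add: path_class_def)
  from homotopic_paths_imp_pathfinish[OF this] show ?thesis
    using pin(3) lex_pos_std_conf_comp[OF lex_pos_permutes[OF conf_path_finish[OF assms(1)]]]
    by (simp add: end_perm_def)
qed

definition block_conjugator :: "nat \<Rightarrow> braid \<Rightarrow> nat set \<Rightarrow> braid" where
  "block_conjugator n P V = traced_braid n (carry n V (end_perm n P)) \<otimes>\<^bsub>Br n\<^esub> inv\<^bsub>Br n\<^esub> P"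

lemma
  assumes c: "conf_path n c" and c0: "lex_pos n (c 0) = id" and V: "V \<subseteq> {1..n}"
  shows block_conjugator_pure: "block_conjugator n (traced_braid n c) V \<in> carrier (pure_braid_group n)"
    and braid_conj_block_conjugator:
      "braid_conj n (block_twist n V) (block_conjugator n (traced_braid n c) V)
        = traced_braid n c \<otimes>\<^bsub>Br n\<^esub> traced_braid n (full_twist n (lex_pos n (c 1) ` V))
          \<otimes>\<^bsub>Br n\<^esub> inv\<^bsub>Br n\<^esub> traced_braid n c"
proof -
  interpret B: group "Br n" by (rule group_braid_group)
  let ?\<pi> = "lex_pos n (c 1)"
  let ?g = "carry n V ?\<pi>"
  note \<pi> = lex_pos_permutes[OF conf_path_finish[OF c]]
  note g = conf_path_carry[OF V \<pi>]
  have \<pi>V: "?\<pi> ` V \<subseteq> {1..n}" using V permutes_image[OF \<pi>] by blast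
  have z: "block_conjugator n (traced_braid n c) V = traced_braid n ?g \<otimes>\<^bsub>Br n\<^esub> inv\<^bsub>Br n\<^esub> traced_braid n c"
    using end_perm_traced_braid[OF c c0] by (simp add: block_conjugator_def)
  \<comment> \<open>The two paths end at different configurations of one cell. The segment between
    them traces the trivial braid and turns the product into the braid of a single path, which
    starts and ends in the cell of the identity and hence is pure.\<close>
  let ?S = "straight (?g 1) (c 1)"
  have cell: "?g 1 \<in> conf n" "c 1 \<in> conf n" "lex_pos n (?g 1) = lex_pos n (c 1)"
    using g c lex_pos_carry_1[OF V \<pi>] by (simp_all add: conf_path_finish)
  have S: "conf_path n ?S"
    using cell by (rule conf_path_straight_cell)
  have S1: "traced_braid n ?S = \<one>\<^bsub>Br n\<^esub>"
    using cell by (intro traced_braid_cell S) (simp add: lex_pos_straight)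
  have r: "conf_path n (reversepath c)" using c by (rule conf_path_reversepath)
  have Sr: "conf_path n (?S +++ reversepath c)"
    by (intro conf_path_join S r) (auto simp: reversepath_def)
  have "block_conjugator n (traced_braid n c) V = traced_braid n (?g +++ (?S +++ reversepath c))"
  proof -
    have "traced_braid n (?g +++ (?S +++ reversepath c))
      = traced_braid n ?g \<otimes>\<^bsub>Br n\<^esub> (traced_braid n ?S \<otimes>\<^bsub>Br n\<^esub> traced_braid n (reversepath c))"
      using traced_braid_join[OF g Sr] traced_braid_join[OF S r] by (simp add: joinpaths_def reversepath_def)
    then show ?thesis
      unfolding z S1 traced_braid_reversepath[OF c] using traced_braid_in_carrier[OF c] by simp
  qed
  moreover have "conf_path n (?g +++ (?S +++ reversepath c))"
    by (intro conf_path_join g Sr) (simp add: joinpaths_def)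
  ultimately show "block_conjugator n (traced_braid n c) V \<in> carrier (pure_braid_group n)"
    using lex_pos_carry_0[OF V \<pi>] c0
    by (simp add: traced_braid_pure joinpaths_def reversepath_def)
  let ?b = "traced_braid n c" and ?\<gamma> = "traced_braid n ?g" and ?T = "traced_braid n (full_twist n (?\<pi> ` V))"
  have carr: "?b \<in> carrier (Br n)" "?\<gamma> \<in> carrier (Br n)" "?T \<in> carrier (Br n)"
    "block_twist n V \<in> carrier (Br n)"
    using traced_braid_in_carrier[OF c] traced_braid_in_carrier[OF g] traced_braid_in_carrier[OF conf_path_full_twist[OF \<pi>V]]
      traced_braid_in_carrier[OF conf_path_full_twist[OF V]] traced_braid_full_twist[OF V] by simp_all
  \<comment> \<open>Conjugation by \<open>?\<gamma> \<otimes> inv ?b\<close> is conjugation by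
    \<open>?\<gamma>\<close>, which yields \<open>?T\<close>, followed by conjugation by
    \<open>inv ?b\<close>.\<close>
  have "inv\<^bsub>Br n\<^esub> (?\<gamma> \<otimes>\<^bsub>Br n\<^esub> inv\<^bsub>Br n\<^esub> ?b) = ?b \<otimes>\<^bsub>Br n\<^esub> inv\<^bsub>Br n\<^esub> ?\<gamma>"
    using carr by (simp add: B.inv_mult_group)
  moreover have "inv\<^bsub>Br n\<^esub> ?\<gamma> \<otimes>\<^bsub>Br n\<^esub> (block_twist n V \<otimes>\<^bsub>Br n\<^esub> ?\<gamma>) = ?T"
    unfolding traced_braid_carry_conj[OF V \<pi>, symmetric] using carr by (simp flip: B.m_assoc)
  ultimately show "braid_conj n (block_twist n V) (block_conjugator n ?b V)
      = ?b \<otimes>\<^bsub>Br n\<^esub> ?T \<otimes>\<^bsub>Br n\<^esub> inv\<^bsub>Br n\<^esub> ?b"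
    unfolding braid_conj_def z using carr by (simp add: B.m_assoc) (simp flip: B.m_assoc)
qed

section \<open>Lines near a multiple point\<close>

definition lines :: "nat \<Rightarrow> (nat \<Rightarrow> complex) \<Rightarrow> (nat \<Rightarrow> complex) \<Rightarrow> complex \<Rightarrow> nat \<Rightarrow> complex" where
  "lines n p \<alpha> u i = (if i \<in> {1..n} then p i + u * \<alpha> i else 0)"

text \<open>The lines \<open>z = p i + u * \<alpha> i\<close>, sorted over \<open>u = 1\<close>; those which do not meet over \<open>u = 0\<close> meet
  nowhere over the unit disk and keep their order over \<open>u = -1\<close>.\<close>

definition tame_pair :: "(nat \<Rightarrow> complex) \<Rightarrow> (nat \<Rightarrow> complex) \<Rightarrow> nat \<Rightarrow> nat \<Rightarrow> bool" where
  "tame_pair p \<alpha> i k \<longleftrightarrow>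
     (p i = p k \<and> lex_less 0 (\<alpha> k - \<alpha> i)) \<or>
     (p i \<noteq> p k \<and> lex_less 0 (p k - p i + (\<alpha> k - \<alpha> i)) \<and> lex_less 0 (p k - p i - (\<alpha> k - \<alpha> i)) \<and>
       (\<forall>u. norm u \<le> 1 \<longrightarrow> p k - p i + u * (\<alpha> k - \<alpha> i) \<noteq> 0))"

definition tame :: "nat \<Rightarrow> (nat \<Rightarrow> complex) \<Rightarrow> (nat \<Rightarrow> complex) \<Rightarrow> bool" where
  "tame n p \<alpha> \<longleftrightarrow> (\<forall>i\<in>{1..n}. \<forall>k\<in>{1..n}. i < k \<longrightarrow> tame_pair p \<alpha> i k)"

lemma tame_pair_nonzero:
  assumes "tame_pair p \<alpha> i k" "norm u \<le> 1" "u \<noteq> 0"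
  shows "p k - p i + u * (\<alpha> k - \<alpha> i) \<noteq> 0"
  using assms by (auto simp: tame_pair_def)

lemma lines_diff: "i \<in> {1..n} \<Longrightarrow> k \<in> {1..n} \<Longrightarrow> lines n p \<alpha> u k - lines n p \<alpha> u i = p k - p i + u * (\<alpha> k - \<alpha> i)"
  by (simp add: lines_def algebra_simps)

lemma lines_conf:
  assumes "tame n p \<alpha>" "norm u \<le> 1" "u \<noteq> 0"
  shows "lines n p \<alpha> u \<in> conf n"
proof (rule inj_on_conf)
  show "lines n p \<alpha> u \<in> cspace n" by (auto simp: lines_def cspace_def)
  fix i k assume "i \<in> {1..n}" "k \<in> {1..n}" "i < k"
  then show "lines n p \<alpha> u i \<noteq> lines n p \<alpha> u k"
    using tame_pair_nonzero[of p \<alpha> i k u] assms lines_diff[of i n k p \<alpha> u] by (auto simp: tame_def)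
qed

lemma conf_path_lines:
  assumes "tame n p \<alpha>" "path w" "\<And>t. t \<in> {0..1} \<Longrightarrow> norm (w t) \<le> 1 \<and> w t \<noteq> 0"
  shows "conf_path n (\<lambda>t. lines n p \<alpha> (w t))"
proof (rule conf_pathI)
  show "continuous_on {0..1} (\<lambda>t. lines n p \<alpha> (w t) i)" for i
    using assms(2) unfolding lines_def path_def by (cases "i \<in> {1..n}") (auto intro!: continuous_intros)
qed (use assms(3) in \<open>auto intro!: lines_conf assms(1)\<close>)

lemma lex_less_shrink:
  assumes "lex_less 0 (\<delta> + a)" "lex_less 0 (\<delta> - a)" "r \<in> {-1..1 :: real}"
  shows "lex_less 0 (\<delta> + of_real r * a)"
proof -
  \<comment> \<open>With this weight \<delta> + r a is a convex combination of \<delta> - a and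
    \<delta> + a.\<close>
  have "(1 + r) / 2 \<in> {0..1}" using assms(3) by auto
  from lex_less_convex[OF assms(2,1) this]
  show ?thesis by (simp add: algebra_simps add_divide_distrib diff_divide_distrib)
qed

text \<open>Passing from the right end of a diameter to the left one reverses the order of meeting
  lines and keeps the order of the others, on every smaller concentric disk as well.\<close>

lemma tame_pair_lex:
  assumes tame: "tame_pair p \<alpha> i k" and r: "0 < r" "r \<le> 1" and u: "u = 1 \<or> u = -1"
  shows "lex_less 0 (p k - p i + (of_real r * u) * (\<alpha> k - \<alpha> i)) \<longleftrightarrow> p i \<noteq> p k \<or> u = 1"
proof (cases "p i = p k")
  case True
  then have "lex_less 0 (\<alpha> k - \<alpha> i)" using tame by (simp add: tame_pair_def)
  moreover from this have "\<not> lex_less 0 (\<alpha> i - \<alpha> k)" by (auto simp: lex_less_def)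
  moreover have "of_real r * (-1) * (\<alpha> k - \<alpha> i) = of_real r * (\<alpha> i - \<alpha> k)" by (simp add: algebra_simps)
  ultimately show ?thesis
    using True u lex_less_scale[OF r(1), of "\<alpha> k - \<alpha> i"] lex_less_scale[OF r(1), of "\<alpha> i - \<alpha> k"] by auto
next
  case False
  with tame have a: "lex_less 0 (p k - p i + (\<alpha> k - \<alpha> i))" "lex_less 0 (p k - p i - (\<alpha> k - \<alpha> i))"
    by (auto simp: tame_pair_def)
  show ?thesis using lex_less_shrink[OF a, of r] lex_less_shrink[OF a, of "- r"] r u False by auto
qed

lemma lines_lex:
  assumes "tame n p \<alpha>" "i \<in> {1..n}" "k \<in> {1..n}" "i < k" "0 < r" "r \<le> 1" "u = 1 \<or> u = -1"
  shows "lex_less (lines n p \<alpha> (of_real r * u) i) (lines n p \<alpha> (of_real r * u) k) \<longleftrightarrow> p i \<noteq> p k \<or> u = 1"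
  using assms tame_pair_lex[of p \<alpha> i k r u] lex_less_diff lines_diff[OF assms(2,3)]
  by (metis (no_types, lifting) tame_def)

text \<open>Differences of lines are affine in \<open>u\<close>, so the interpolation between the
  two radii is itself the difference over an intermediate circle, where tameness excludes
  zero.\<close>

lemma traced_braid_lines_shrink:
  assumes tame: "tame n p \<alpha>" and w: "path w" "\<And>t. t \<in> {0..1} \<Longrightarrow> norm (w t) = 1"
    and ends: "w 0 = 1 \<or> w 0 = -1" "w 1 = 1 \<or> w 1 = -1" and r: "0 < r" "r \<le> 1"
  shows "traced_braid n (\<lambda>t. lines n p \<alpha> (w t)) = traced_braid n (\<lambda>t. lines n p \<alpha> (of_real r * w t))"
proof (rule traced_braid_eqI)
  let ?c = "\<lambda>t. lines n p \<alpha> (w t)" and ?d = "\<lambda>t. lines n p \<alpha> (of_real r * w t)"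
  have w0: "w t \<noteq> 0" if "t \<in> {0..1}" for t using w(2)[OF that] by auto
  show "conf_path n ?c"
    using w w0 by (intro conf_path_lines tame) auto
  have "path (\<lambda>t. of_real r * w t)" using w(1) unfolding path_def by (intro continuous_intros)
  then show "conf_path n ?d"
    using w w0 r by (intro conf_path_lines tame) (auto simp: norm_mult)
  fix i k assume ik: "i \<in> {1..n}" "k \<in> {1..n}" "i < k"
  have tp: "tame_pair p \<alpha> i k" using tame ik by (auto simp: tame_def)
  show "segment_misses_0 (?c t k - ?c t i)
      (?d t k - ?d t i)" if t: "t \<in> {0..1}" for t
    unfolding segment_misses_0_def
  proof
    fix s :: real assume s: "s \<in> {0..1}"
    let ?v = "of_real (1 - s + s * r) * w t"
    have pos: "0 < 1 - s + s * r"
    proof (cases "s = 1")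
      case False
      then have "0 < 1 - s" "0 \<le> s * r" using s r by auto
      then show ?thesis by linarith
    qed (use r in auto)
    have "s * r \<le> s * 1" using r s by (intro mult_left_mono) auto
    then have "norm ?v \<le> 1" unfolding norm_mult norm_of_real w(2)[OF t] using pos by simp
    moreover have "?v \<noteq> 0" using pos w0[OF t] by (metis less_irrefl mult_eq_0_iff of_real_eq_0_iff)
    ultimately have "p k - p i + ?v * (\<alpha> k - \<alpha> i) \<noteq> 0" by (intro tame_pair_nonzero[OF tp])
    then show "of_real (1 - s) * (?c t k - ?c t i) +
        of_real s * (?d t k - ?d t i) \<noteq> 0"
      unfolding lines_diff[OF ik(1,2)] by (simp add: algebra_simps)
  qed
  show "lex_less (?c 0 i) (?c 0 k) \<longleftrightarrow>
      lex_less (?d 0 i) (?d 0 k)"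
    using lines_lex[OF tame ik _ _ ends(1), of 1] lines_lex[OF tame ik r ends(1)] by simp
  show "lex_less (?c 1 i) (?c 1 k) \<longleftrightarrow>
      lex_less (?d 1 i) (?d 1 k)"
    using lines_lex[OF tame ik _ _ ends(2), of 1] lines_lex[OF tame ik r ends(2)] by simp
qed

text \<open>The segment is compact and has a distance \<open>e\<close> from the origin;
  perturbations bounded by \<open>r * M\<close> with \<open>r < e / M\<close> cannot reach it,
  uniformly for \<open>u\<close> in the unit disk.\<close>

lemma segment_misses_0_perturb:
  assumes "segment_misses_0 z z'"
  shows "eventually (\<lambda>r :: real. \<forall>u. norm u \<le> 1 \<longrightarrow> segment_misses_0 (z + (of_real r * u) * a) (z' + (of_real r * u) * a')) (at_right 0)"
proof -
  have seg: "closed_segment z z' = (\<lambda>s. of_real (1 - s) * z + of_real s * z') ` {0..1}"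
    by (auto simp: closed_segment_def scaleR_conv_of_real)
  then have "0 \<notin> closed_segment z z'"
    using assms by (auto simp: segment_misses_0_def image_iff)
  from separate_point_closed[OF closed_segment this] obtain e where e: "e > 0" "\<And>x. x \<in> closed_segment z z' \<Longrightarrow> e \<le> dist 0 x"
    by auto
  define M where "M = norm a + norm a' + 1"
  have M: "0 < M" by (simp add: M_def add_nonneg_pos)
  show ?thesis
    unfolding eventually_at_right_field
  proof (intro exI conjI allI impI)
    show "0 < e / M" using e(1) M by simp
    fix r :: real and u :: complex
    assume r: "0 < r" "r < e / M" and u: "norm u \<le> 1"
    show "segment_misses_0 (z + (of_real r * u) * a) (z' + (of_real r * u) * a')"
      unfolding segment_misses_0_def
    proof
      fix s :: real assume s: "s \<in> {0..1}"
      let ?x = "of_real (1 - s) * z + of_real s * z'" and ?b = "of_real (1 - s) * a + of_real s * a'"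
      have "norm ?b \<le> (1 - s) * norm a + s * norm a'"
        using s norm_triangle_ineq[of "of_real (1 - s) * a" "of_real s * a'"]
        unfolding norm_mult norm_of_real by simp
      also have "\<dots> \<le> 1 * norm a + 1 * norm a'"
        using s by (intro add_mono mult_right_mono) auto
      finally have b: "norm ?b < M" by (simp add: M_def)
      have "norm ((of_real r * u) * ?b) \<le> r * norm ?b"
        using r u by (simp add: norm_mult mult_left_le mult_right_mono mult_left_le_one_le)
      also have "\<dots> < r * M" using b r by simp
      also have "\<dots> < e" using r M by (simp add: field_simps)
      finally have "norm ((of_real r * u) * ?b) < e" .
      moreover have "e \<le> norm ?x" using e(2)[of ?x] s seg by auto
      ultimately have "?x + (of_real r * u) * ?b \<noteq> 0"
        by (metis add_eq_0_iff norm_minus_cancel not_less)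
      then show "of_real (1 - s) * (z + (of_real r * u) * a) + of_real s * (z' + (of_real r * u) * a') \<noteq> 0"
        by (simp add: algebra_simps)
    qed
  qed
qed

lemma tame_pair_lex_base: "tame_pair p \<alpha> i k \<Longrightarrow> p i \<noteq> p k \<Longrightarrow> lex_less 0 (p k - p i)"
  using lex_less_shrink[of "p k - p i" "\<alpha> k - \<alpha> i" 0] by (auto simp: tame_pair_def)

text \<open>Both families are shrunk to a common radius \<open>r\<close>. Lines that do not meet
  have lexicographically positive constant terms, whose segment misses 0 and absorbs the small
  linear terms. Lines that meet have the difference \<open>r * w t\<close> times a slope difference,
  and these slope differences are lexicographically positive.\<close>

theorem traced_braid_lines_eq:
  assumes tame: "tame n p \<alpha>" "tame n p' \<alpha>'"
    and meet: "\<And>i k. i \<in> {1..n} \<Longrightarrow> k \<in> {1..n} \<Longrightarrow> i < k \<Longrightarrow> p i = p k \<longleftrightarrow> p' i = p' k"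
    and w: "path w" "\<And>t. t \<in> {0..1} \<Longrightarrow> norm (w t) = 1"
    and ends: "w 0 = 1 \<or> w 0 = -1" "w 1 = 1 \<or> w 1 = -1"
  shows "traced_braid n (\<lambda>t. lines n p \<alpha> (w t)) = traced_braid n (\<lambda>t. lines n p' \<alpha>' (w t))"
proof -
  let ?ok = "\<lambda>r i k. p i \<noteq> p k \<longrightarrow> (\<forall>u. norm u \<le> 1 \<longrightarrow>
      segment_misses_0 (p k - p i + (of_real r * u) * (\<alpha> k - \<alpha> i)) (p' k - p' i + (of_real r * u) * (\<alpha>' k - \<alpha>' i)))"
  have ev: "eventually (\<lambda>r :: real. i < k \<longrightarrow> ?ok r i k) (at_right 0)" if ik: "i \<in> {1..n}" "k \<in> {1..n}" for i k
  proof (cases "i < k \<and> p i \<noteq> p k")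
    case True
    then have "p' i \<noteq> p' k" using meet ik by auto
    then have "segment_misses_0 (p k - p i) (p' k - p' i)"
      using tame True ik
      by (intro segment_misses_0_lex tame_pair_lex_base[of p \<alpha>] tame_pair_lex_base[of p' \<alpha>']) (auto simp: tame_def)
    from segment_misses_0_perturb[OF this] show ?thesis by (rule eventually_mono) auto
  qed auto
  have "eventually (\<lambda>r :: real. \<forall>i\<in>{1..n}. \<forall>k\<in>{1..n}. i < k \<longrightarrow> ?ok r i k) (at_right 0)"
    by (intro eventually_ball_finite finite_atLeastAtMost ballI ev)
  moreover have "eventually (\<lambda>r :: real. 0 < r \<and> r \<le> 1) (at_right 0)"
    by (auto simp: eventually_at_right_field intro: exI[of _ 1])
  ultimately have "eventually (\<lambda>r :: real. (0 < r \<and> r \<le> 1) \<and> (\<forall>i\<in>{1..n}. \<forall>k\<in>{1..n}. i < k \<longrightarrow> ?ok r i k)) (at_right 0)"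
    by eventually_elim blast
  from eventually_happens'[OF trivial_limit_at_right_real this]
  obtain r :: real where r: "0 < r" "r \<le> 1" and ok: "\<And>i k. i \<in> {1..n} \<Longrightarrow> k \<in> {1..n} \<Longrightarrow> i < k \<Longrightarrow> ?ok r i k"
    by blast
  let ?c = "\<lambda>t. lines n p \<alpha> (of_real r * w t)" and ?d = "\<lambda>t. lines n p' \<alpha>' (of_real r * w t)"
  have w0: "w t \<noteq> 0" if "t \<in> {0..1}" for t using w(2)[OF that] by auto
  have pw: "path (\<lambda>t. of_real r * w t)" using w(1) unfolding path_def by (intro continuous_intros)
  have "traced_braid n ?c = traced_braid n ?d"
  proof (rule traced_braid_eqI)
    show "conf_path n ?c"
      using w w0 r pw by (intro conf_path_lines tame) (auto simp: norm_mult)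
    show "conf_path n ?d"
      using w w0 r pw by (intro conf_path_lines tame) (auto simp: norm_mult)
    fix i k assume ik: "i \<in> {1..n}" "k \<in> {1..n}" "i < k"
    have tp: "tame_pair p \<alpha> i k" "tame_pair p' \<alpha>' i k" using tame ik by (auto simp: tame_def)
    show "segment_misses_0 (?c t k - ?c t i)
        (?d t k - ?d t i)" if t: "t \<in> {0..1}" for t
    proof (cases "p i = p k")
      case False
      then show ?thesis
        using ok[OF ik] w(2)[OF t] unfolding lines_diff[OF ik(1,2)] by simp
    next
      case True
      then have eq: "p' i = p' k" using meet ik by simp
      have lex: "lex_less 0 (\<alpha> k - \<alpha> i)" "lex_less 0 (\<alpha>' k - \<alpha>' i)"
        using True eq tp by (auto simp: tame_pair_def)
      show ?thesis
        unfolding lines_diff[OF ik(1,2)] segment_misses_0_def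
      proof
        fix s :: real assume s: "s \<in> {0..1}"
        have "of_real (1 - s) * (\<alpha> k - \<alpha> i) + of_real s * (\<alpha>' k - \<alpha>' i) \<noteq> 0"
          using segment_misses_0_lex[OF lex] s unfolding segment_misses_0_def by blast
        then have "(of_real r * w t) * (of_real (1 - s) * (\<alpha> k - \<alpha> i) + of_real s * (\<alpha>' k - \<alpha>' i)) \<noteq> 0"
          using r w0[OF t] by auto
        then show "of_real (1 - s) * (p k - p i + of_real r * w t * (\<alpha> k - \<alpha> i)) +
            of_real s * (p' k - p' i + of_real r * w t * (\<alpha>' k - \<alpha>' i)) \<noteq> 0"
          using True eq by (simp add: algebra_simps)
      qed
    qed
    show "lex_less (?c 0 i) (?c 0 k) \<longleftrightarrow>
        lex_less (?d 0 i) (?d 0 k)"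
      using lines_lex[OF tame(1) ik r ends(1)] lines_lex[OF tame(2) ik r ends(1)] meet[OF ik] by simp
    show "lex_less (?c 1 i) (?c 1 k) \<longleftrightarrow>
        lex_less (?d 1 i) (?d 1 k)"
      using lines_lex[OF tame(1) ik r ends(2)] lines_lex[OF tame(2) ik r ends(2)] meet[OF ik] by simp
  qed
  then show ?thesis
    using traced_braid_lines_shrink[OF tame(1) w ends r] traced_braid_lines_shrink[OF tame(2) w ends r] by simp
qed


section \<open>The canonical multiple point\<close>

context
  fixes n :: nat and m :: "nat \<Rightarrow> nat"
begin

interpretation B: group "Br n"
  by (rule group_braid_group)

text \<open>The centre of the block numbered \<open>m i\<close>. Two strands
  \<open>i \<noteq> k\<close> circle with radii \<open>i + k < 2 * n\<close> in sum, so the spacing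
  \<open>2 * n\<close> keeps distinct blocks apart whatever their angles.\<close>

definition hubs :: "nat \<Rightarrow> complex" where
  "hubs i = of_nat (2 * n * m i)"

definition wheels :: "(nat \<Rightarrow> complex) \<Rightarrow> nat \<Rightarrow> complex" where
  "wheels e i = (if i \<in> {1..n} then hubs i + e i * of_nat i else 0)"

lemma norm_hubs_diff:
  assumes "m i \<noteq> m k"
  shows "2 * real n \<le> norm (hubs k - hubs i)"
proof -
  have "hubs k - hubs i = of_int (2 * int n * (int (m k) - int (m i)))"
    by (simp add: hubs_def algebra_simps)
  then have "norm (hubs k - hubs i) = of_int (2 * int n * \<bar>int (m k) - int (m i)\<bar>)"
    by (simp only: norm_of_int) (simp add: abs_mult)
  moreover have "2 * int n * 1 \<le> 2 * int n * \<bar>int (m k) - int (m i)\<bar>"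
    using assms by (intro mult_left_mono) auto
  then have "real_of_int (2 * int n * 1) \<le> real_of_int (2 * int n * \<bar>int (m k) - int (m i)\<bar>)"
    by (simp only: of_int_le_iff)
  ultimately show ?thesis by simp
qed

lemma wheels_conf:
  assumes e: "\<And>i. i \<in> {1..n} \<Longrightarrow> norm (e i) = 1"
    and same: "\<And>i k. i \<in> {1..n} \<Longrightarrow> k \<in> {1..n} \<Longrightarrow> m i = m k \<Longrightarrow> e i = e k"
  shows "wheels e \<in> conf n"
proof (rule inj_on_conf)
  show "wheels e \<in> cspace n" by (auto simp: wheels_def cspace_def)
  fix i k assume ik: "i \<in> {1..n}" "k \<in> {1..n}" "i < k"
  show "wheels e i \<noteq> wheels e k"
  proof (cases "m i = m k")
    case True
    then have "e i = e k" "e i \<noteq> 0" using same[OF ik(1,2)] e[OF ik(1)] by auto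
    then show ?thesis using ik True by (auto simp: wheels_def hubs_def)
  next
    case False
    have "norm (e i * of_nat i - e k * of_nat k) \<le> real i + real k"
      using norm_triangle_ineq4[of "e i * of_nat i" "e k * of_nat k"] e ik by (simp add: norm_mult)
    also have "\<dots> < 2 * real n" using ik by auto
    finally have "norm (e i * of_nat i - e k * of_nat k) < norm (hubs k - hubs i)"
      using norm_hubs_diff[OF False] by linarith
    then have "e i * of_nat i - e k * of_nat k \<noteq> hubs k - hubs i" by auto
    then show ?thesis using ik by (auto simp: wheels_def algebra_simps)
  qed
qed

text \<open>Links the two descriptions: lines through the hubs with slopes \<open>i\<close> are the
  special case in which all blocks turn by the same factor.\<close>

lemma wheels_lines: "wheels (\<lambda>_. u) = lines n hubs of_nat u"
  by (auto simp: wheels_def lines_def)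

definition block_turn :: "nat set \<Rightarrow> real \<Rightarrow> nat \<Rightarrow> complex" where
  "block_turn U t = wheels (\<lambda>i. if i \<in> U then exp (\<i> * of_real (2 * pi * t)) else 1)"

text \<open>Saturated sets, that is, unions of fibres of \<open>m\<close> and not only single ones,
  so that blocks can be split off one after another.\<close>

definition fibre :: "nat set \<Rightarrow> bool" where
  "fibre U \<longleftrightarrow> U \<subseteq> {1..n} \<and> (\<forall>i\<in>{1..n}. \<forall>k\<in>{1..n}. m i = m k \<longrightarrow> i \<in> U \<longrightarrow> k \<in> U)"

lemma fibre_iff: "fibre U \<Longrightarrow> i \<in> {1..n} \<Longrightarrow> k \<in> {1..n} \<Longrightarrow> m i = m k \<Longrightarrow> i \<in> U \<longleftrightarrow> k \<in> U"
  unfolding fibre_def by metis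

lemma block_turn_conf:
  assumes "fibre U"
  shows "block_turn U t \<in> conf n"
  unfolding block_turn_def
proof (rule wheels_conf)
  fix i k assume "i \<in> {1..n}" "k \<in> {1..n}" "m i = m k"
  from fibre_iff[OF assms this]
  show "(if i \<in> U then exp (\<i> * of_real (2 * pi * t)) else 1) = (if k \<in> U then exp (\<i> * of_real (2 * pi * t)) else 1)"
    by simp
qed auto

lemma conf_path_block_turn:
  assumes "fibre U"
  shows "conf_path n (block_turn U)"
proof (rule conf_pathI)
  show "block_turn U t \<in> conf n" for t
    using assms by (rule block_turn_conf)
  show "continuous_on {0..1} (\<lambda>t. block_turn U t i)" for i
    unfolding block_turn_def wheels_def by (cases "i \<in> {1..n}"; cases "i \<in> U") (auto intro!: continuous_intros)
qed

text \<open>The angles of the two sets are independent parameters; the diagonal of the parameter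
  square is replaced by two of its edges.\<close>

lemma traced_braid_block_turn_Un:
  assumes "fibre U" "fibre U'" "U \<inter> U' = {}"
  shows "traced_braid n (block_turn (U \<union> U'))
    = traced_braid n (block_turn U) \<otimes>\<^bsub>Br n\<^esub> traced_braid n (block_turn U')"
proof -
  define F where "F = (\<lambda>x :: real \<times> real. wheels (\<lambda>i. if i \<in> U then exp (\<i> * of_real (2 * pi * fst x))
    else if i \<in> U' then exp (\<i> * of_real (2 * pi * snd x)) else 1))"
  have F: "conf_family n F"
  proof (rule conf_familyI)
    show "F x \<in> conf n" for x
      unfolding F_def
    proof (rule wheels_conf)
      fix i k assume ik: "i \<in> {1..n}" "k \<in> {1..n}" "m i = m k"
      then have "i \<in> U \<longleftrightarrow> k \<in> U" "i \<in> U' \<longleftrightarrow> k \<in> U'"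
        using fibre_iff[OF assms(1)] fibre_iff[OF assms(2)] by blast+
      then show "(if i \<in> U then exp (\<i> * of_real (2 * pi * fst x)) else if i \<in> U' then exp (\<i> * of_real (2 * pi * snd x)) else 1)
        = (if k \<in> U then exp (\<i> * of_real (2 * pi * fst x)) else if k \<in> U' then exp (\<i> * of_real (2 * pi * snd x)) else 1)"
        by simp
    qed auto
    show "continuous_on UNIV (\<lambda>x. F x i)" for i
      unfolding F_def wheels_def by (cases "i \<in> {1..n}"; cases "i \<in> U"; cases "i \<in> U'") (auto intro!: continuous_intros)
  qed
  have F_cong: "F \<circ> linepath (0, 0) (1, 1) = block_turn (U \<union> U')" "F \<circ> linepath (0, 0) (1, 0) = block_turn U"
    "F \<circ> linepath (1, 0) (1, 1) = block_turn U'"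
    using assms(3) exp_two_pi_i
    by (auto simp: F_def block_turn_def wheels_def linepath_def fun_eq_iff algebra_simps)
  show ?thesis
    using traced_braid_linepath_join[OF F, of "(0, 0)" "(1, 1)" "(1, 0)"] unfolding F_cong .
qed

lemma fibre_Union: "(\<And>U. U \<in> \<U> \<Longrightarrow> fibre U) \<Longrightarrow> fibre (\<Union>\<U>)"
  unfolding fibre_def by blast

lemma traced_braid_block_turn_list:
  assumes "\<And>U. U \<in> set Us \<Longrightarrow> fibre U" "distinct Us" "pairwise disjnt (set Us)"
  shows "traced_braid n (block_turn (\<Union>(set Us))) = braid_word n (map (\<lambda>U. traced_braid n (block_turn U)) Us)"
  using assms
proof (induction Us)
  case Nil
  have "wheels (\<lambda>_. 1) \<in> conf n" by (rule wheels_conf) auto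
  then show ?case
    by (simp add: block_turn_def) (simp add: traced_braid_cell conf_path_def path_const path_image_const)
next
  case (Cons U Us)
  have "U \<inter> \<Union>(set Us) = {}"
    using Cons.prems(2,3) by (auto simp: pairwise_insert disjnt_def)
  moreover have "fibre U" "fibre (\<Union>(set Us))"
    using Cons.prems(1) by (auto intro: fibre_Union)
  ultimately show ?case
    using Cons traced_braid_block_turn_Un[of U "\<Union>(set Us)"] by (simp add: pairwise_insert)
qed

context
  assumes mono: "\<And>i k. i \<in> {1..n} \<Longrightarrow> k \<in> {1..n} \<Longrightarrow> i < k \<Longrightarrow> m i \<le> m k"
begin

lemma Re_hubs_diff: "m i < m k \<Longrightarrow> 2 * real n \<le> Re (hubs k - hubs i)"
proof -
  assume "m i < m k"
  then have "2 * n * Suc (m i) \<le> 2 * n * m k" by (intro mult_le_mono2) simp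
  then have "real (2 * n * Suc (m i)) \<le> real (2 * n * m k)" by (simp only: of_nat_le_iff)
  then show ?thesis by (simp add: hubs_def algebra_simps)
qed

lemma Re_hubs_le:
  assumes "i \<in> {1..n}" "k \<in> {1..n}" "i < k"
  shows "Re (hubs i) \<le> Re (hubs k)"
proof -
  have "2 * n * m i \<le> 2 * n * m k" using mono[OF assms] by (intro mult_le_mono2)
  then have "real (2 * n * m i) \<le> real (2 * n * m k)" by (simp only: of_nat_le_iff)
  then show ?thesis by (simp add: hubs_def)
qed

lemma tame_hubs: "tame n hubs of_nat"
  unfolding tame_def
proof (intro ballI impI)
  fix i k :: nat assume ik: "i \<in> {1..n}" "k \<in> {1..n}" "i < k"
  show "tame_pair hubs of_nat i k"
  proof (cases "m i = m k")
    case True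
    then show ?thesis using ik by (simp add: tame_pair_def hubs_def lex_less_def)
  next
    case False
    then have Re: "2 * real n \<le> Re (hubs k - hubs i)"
      using mono[OF ik] by (intro Re_hubs_diff) simp
    have "hubs k - hubs i + u * (of_nat k - of_nat i) \<noteq> 0" if "norm u \<le> 1" for u
    proof -
      have "norm (of_nat k - of_nat i :: complex) = real k - real i"
        using ik by (metis norm_of_nat of_nat_diff less_imp_le)
      then have "norm (u * (of_nat k - of_nat i)) \<le> 1 * (real k - real i)"
        unfolding norm_mult using that ik by (intro mult_mono) auto
      also have "\<dots> < 2 * real n" using ik by auto
      also have "\<dots> \<le> norm (hubs k - hubs i)" using Re complex_Re_le_cmod order_trans by blast
      finally show ?thesis by (metis add_eq_0_iff norm_minus_cancel order_less_irrefl)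
    qed
    moreover have "hubs i \<noteq> hubs k" using Re ik by auto
    ultimately show ?thesis
      using Re ik by (auto simp: tame_pair_def lex_less_def)
  qed
qed

text \<open>First the block is lifted above the others, then all hubs are moved to the origin.\<close>

lemma traced_braid_block_turn:
  assumes U: "fibre U" and one: "\<And>i k. i \<in> U \<Longrightarrow> k \<in> U \<Longrightarrow> m i = m k"
  shows "traced_braid n (block_turn U) = traced_braid n (full_twist n U)"
proof -
  have U_n: "U \<subseteq> {1..n}" using U by (simp add: fibre_def)
  define e where "e = (\<lambda>t :: real. exp (\<i> * of_real (2 * pi * t)))"
  have e1: "norm (e t) = 1" "e 0 = 1" "e 1 = 1" for t
    using exp_two_pi_i by (auto simp: e_def ac_simps)
  have bt: "block_turn U t i = (if i \<in> U then hubs i + e t * of_nat i else hubs i + of_nat i)"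
    and ft: "full_twist n U t i = (if i \<in> U then e t * of_nat i + \<i> * (4 * of_nat n) else of_nat i)"
    if "i \<in> {1..n}" for t i
    using that by (auto simp: block_turn_def wheels_def e_def full_twist_def lifted_def spin_def)
  define c where "c = (\<lambda>t. lifted n U (block_turn U t))"
  have c_at: "c t i = (if i \<in> U then hubs i + e t * of_nat i + \<i> * (4 * of_nat n) else hubs i + of_nat i)"
    if "i \<in> {1..n}" for t i
    using that by (simp add: c_def lifted_def bt)
  have bound: "\<bar>Re (e t * of_nat i)\<bar> \<le> real i" "\<bar>Im (e t * of_nat i)\<bar> \<le> real i" for t i
    using abs_Re_le_cmod[of "e t * of_nat i"] abs_Im_le_cmod[of "e t * of_nat i"] by (simp_all add: norm_mult e1)
  \<comment> \<open>A strand in \<open>U\<close> and one outside belong to different blocks, so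
    their hubs are at least \<open>2 * n\<close> apart.\<close>
  have mixed: "m i < m k" if "i \<in> {1..n}" "k \<in> {1..n}" "i < k" "i \<in> U \<longleftrightarrow> k \<notin> U" for i k
    using U that mono[OF that(1,2,3)] unfolding fibre_def by (metis le_neq_implies_less)
  have Im_hubs [simp]: "Im (hubs i) = 0" for i by (simp add: hubs_def)
  have hubs_eq: "hubs i = hubs k" if "i \<in> U" "k \<in> U" for i k
    using one[OF that] by (simp add: hubs_def)
  have conf_c: "c t \<in> conf n" for t
  proof (rule inj_on_conf)
    show "c t \<in> cspace n" using U_n by (auto simp: cspace_def c_def lifted_def block_turn_def wheels_def)
    fix i k assume ik: "i \<in> {1..n}" "k \<in> {1..n}" "i < k"
    show "c t i \<noteq> c t k"
    proof (cases "i \<in> U \<longleftrightarrow> k \<in> U")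
      case True
      have "block_turn U t i \<noteq> block_turn U t k"
        using conf_distinct[OF block_turn_conf[OF U] ik(1,2)] ik(3) by simp
      then show ?thesis using True by (auto simp: c_def lifted_def)
    next
      case False
      have "Re (c t i) < Re (c t k)"
        using False Re_hubs_diff[OF mixed[OF ik]] bound[of t i] bound[of t k] ik by (auto simp: c_at)
      then show ?thesis by auto
    qed
  qed
  have path_c: "conf_path n c"
  proof (rule conf_pathI)
    show "continuous_on {0..1} (\<lambda>t. c t i)" if "i \<in> {1..n}" for i
      unfolding c_at[OF that] e_def by (cases "i \<in> U") (auto intro!: continuous_intros)
  qed (rule conf_c)
  have path_b: "conf_path n (block_turn U)" using U by (rule conf_path_block_turn)
  have path_f: "conf_path n (full_twist n U)" using U_n by (rule conf_path_full_twist)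
  have ends: "lex_less (block_turn U t i) (block_turn U t k)" "lex_less (c t i) (c t k)"
      "lex_less (full_twist n U t i) (full_twist n U t k)"
    if ik: "i \<in> {1..n}" "k \<in> {1..n}" "i < k" and t: "t = 0 \<or> t = 1" for i k t
    using t ik Re_hubs_le[OF ik] e1 by (auto simp: lex_less_def bt c_at ft)
  \<comment> \<open>During the lift such a mixed pair is kept apart by its real parts. Afterwards,
    when the hubs move to the origin, it is kept apart by its heights.\<close>
  have "traced_braid n (block_turn U) = traced_braid n c"
  proof (rule traced_braid_eqI[OF path_b path_c])
    fix i k t assume ik: "i \<in> {1..n}" "k \<in> {1..n}" "i < k" and t: "t \<in> {0..1 :: real}"
    show "segment_misses_0 (block_turn U t k - block_turn U t i) (c t k - c t i)"
    proof (cases "i \<in> U \<longleftrightarrow> k \<in> U")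
      case True
      then have "c t k - c t i = block_turn U t k - block_turn U t i" by (auto simp: c_def lifted_def)
      then show ?thesis
        using conf_distinct[OF conf_path_at[OF path_b t] ik(1,2)] ik by (simp add: segment_misses_0_same)
    next
      case False
      then show ?thesis
        using Re_hubs_diff[OF mixed[OF ik]] bound[of t i] bound[of t k] ik
        by (intro segment_misses_0_Re) (auto simp: c_at bt)
    qed
  qed (use ends in auto)
  also have "\<dots> = traced_braid n (full_twist n U)"
  proof (rule traced_braid_eqI[OF path_c path_f])
    fix i k t assume ik: "i \<in> {1..n}" "k \<in> {1..n}" "i < k" and t: "t \<in> {0..1 :: real}"
    show "segment_misses_0 (c t k - c t i) (full_twist n U t k - full_twist n U t i)"
    proof -
      consider "i \<in> U" "k \<in> U" | "i \<notin> U" "k \<notin> U" | "i \<in> U" "k \<notin> U" | "i \<notin> U" "k \<in> U" by blast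
      then show ?thesis
      proof cases
        case 1
        then have "c t k - c t i = full_twist n U t k - full_twist n U t i"
          using hubs_eq[of i k] ik by (simp add: c_at ft)
        then show ?thesis
          using conf_distinct[OF conf_path_at[OF path_f t] ik(1,2)] ik by (simp add: segment_misses_0_same)
      next
        case 2
        then show ?thesis
          using Re_hubs_le[OF ik] ik by (intro segment_misses_0_Re) (auto simp: c_at ft)
      next
        case 3
        then show ?thesis
          using ik bound(2)[of t i] conf_distinct[OF conf_c ik(1,2)]
          by (subst segment_misses_0_minus_commute, intro segment_misses_0_Im) (auto simp: c_at ft)
      next
        case 4
        then show ?thesis
          using ik bound(2)[of t k] conf_distinct[OF conf_c ik(2,1)]
          by (intro segment_misses_0_Im) (auto simp: c_at ft)
      qed
    qed
  qed (use ends in auto)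
  finally show ?thesis .
qed

end

end

section \<open>Monodromy around a multiple point\<close>

lemma induced_map_path_class:
  assumes "continuous_on S f" "f ` S \<subseteq> T" "path p" "path_image p \<subseteq> S"
  shows "induced_map T f (path_class S p) = path_class T (f \<circ> p)"
proof -
  have p: "p \<in> path_class S p" using assms(3,4) by (rule path_class_self)
  have "homotopic_paths T (f \<circ> p) (f \<circ> p')" if "p' \<in> path_class S p" for p'
    using that assms(1,2) homotopic_paths_continuous_image unfolding path_class_def by blast
  then show ?thesis
    using p unfolding induced_map_def path_class_def[of T]
    by (blast intro: homotopic_paths_trans)
qed

text \<open>Over a sorted base point, the identification of the target along a straight segment is
  the same as pinning, so that monodromy can be computed with traced braids.\<close>

lemma braid_monodromy_path_class:
  assumes f: "continuous_on S f" "f ` S \<subseteq> conf n" and p: "path p" "path_image p \<subseteq> S"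
    and ends: "pathstart p = x0" "pathfinish p = x0" and sorted: "lex_pos n (f x0) = id"
  shows "braid_monodromy n f x0 (path_class S p) = traced_braid n (f \<circ> p)"
proof -
  have ends': "(f \<circ> p) 0 = f x0" "(f \<circ> p) 1 = f x0"
    using ends by (auto simp: pathstart_def pathfinish_def)
  have fp: "path (f \<circ> p)" "path_image (f \<circ> p) \<subseteq> conf n"
    using p f path_continuous_image[of p f] by (auto simp: path_image_compose intro: continuous_on_subset)
  then have c: "conf_path n (f \<circ> p)" by (simp add: conf_path_def)
  have tb: "traced_braid n (f \<circ> p) = path_class (conf n) (pinned n (f \<circ> p))"
    by (rule traced_braid_sorted) (simp only: ends' sorted)
  have pin: "pinned n p' = straight (std_conf n) (f x0) +++ p' +++ straight (f x0) (std_conf n)"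
    if "homotopic_paths (conf n) (f \<circ> p) p'" for p'
  proof -
    have "p' 0 = f x0" "p' 1 = f x0"
      using homotopic_paths_imp_pathstart[OF that] homotopic_paths_imp_pathfinish[OF that] ends'
      by (auto simp: pathstart_def pathfinish_def)
    then show ?thesis by (simp add: pinned_def sorted)
  qed
  have hom: "homotopic_paths (conf n) (pinned n (f \<circ> p)) (pinned n p')" if "homotopic_paths (conf n) (f \<circ> p) p'" for p'
    by (rule homotopic_pinned[OF that]) (simp only: ends' sorted)
  have refl: "homotopic_paths (conf n) (f \<circ> p) (f \<circ> p)" using fp by simp
  show ?thesis
    unfolding braid_monodromy_def induced_map_path_class[OF f p] tb
  proof (intro equalityI subsetI)
    fix r assume "r \<in> {r. \<exists>p'\<in>path_class (conf n) (f \<circ> p).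
      homotopic_paths (conf n) (straight (std_conf n) (f x0) +++ p' +++ straight (f x0) (std_conf n)) r}"
    then obtain p' where p': "homotopic_paths (conf n) (f \<circ> p) p'"
      "homotopic_paths (conf n) (straight (std_conf n) (f x0) +++ p' +++ straight (f x0) (std_conf n)) r"
      unfolding path_class_def by blast
    from homotopic_paths_trans[OF hom[OF p'(1)] p'(2)[folded pin[OF p'(1)]]]
    show "r \<in> path_class (conf n) (pinned n (f \<circ> p))" by (simp add: path_class_def)
  next
    fix r assume "r \<in> path_class (conf n) (pinned n (f \<circ> p))"
    then show "r \<in> {r. \<exists>p'\<in>path_class (conf n) (f \<circ> p).
      homotopic_paths (conf n) (straight (std_conf n) (f x0) +++ p' +++ straight (f x0) (std_conf n)) r}"
      using refl unfolding path_class_def pin[OF refl] by blast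
  qed
qed

text \<open>Numbers the blocks by their least elements: a numbering that depends on the partition
  alone, and is increasing when the blocks are intervals.\<close>

definition block_min :: "nat set set \<Rightarrow> nat \<Rightarrow> nat" where
  "block_min I i = Min (\<Union>{U\<in>I. i \<in> U})"

text \<open>The braid over the upper half circle for a model whose hubs and slopes are computed from
  the partition only.\<close>

definition half_braid :: "nat \<Rightarrow> nat set set \<Rightarrow> braid" where
  "half_braid n I = traced_braid n (\<lambda>t. lines n (hubs n (block_min I)) of_nat (exp (\<i> * of_real (linepath 0 pi t))))"

text \<open>The braid \<open>P\<close> of the overview as a function of the diagram. The path before
  the first disk contributes no factor, its braid being trivial.\<close>

definition diagram_braid :: "nat \<Rightarrow> (nat set set \<times> braid) list \<Rightarrow> braid" where
  "diagram_braid n D = foldl (\<lambda>x (I, \<beta>). x \<otimes>\<^bsub>Br n\<^esub> (half_braid n I \<otimes>\<^bsub>Br n\<^esub> \<beta>)) \<one>\<^bsub>Br n\<^esub> D"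

lemma path_exp: "path \<theta> \<Longrightarrow> path (\<lambda>t. exp (\<i> * of_real (\<theta> t)))" for \<theta> :: "real \<Rightarrow> real"
  unfolding path_def by (intro continuous_intros)

text \<open>Forgets the arrangements: the computation concerns \<open>n\<close> affine functions of
  one complex variable whose values are distinct away from the points \<open>q\<close>.\<close>

locale fibred_line =
  fixes n m :: nat and f :: "complex \<Rightarrow> nat \<Rightarrow> complex" and \<beta> \<kappa> :: "nat \<Rightarrow> complex"
    and q :: "nat \<Rightarrow> complex" and q0 :: complex and \<epsilon> :: real and \<xi> :: "nat \<Rightarrow> real \<Rightarrow> complex"
  assumes f_line: "\<And>x i. i \<in> {1..n} \<Longrightarrow> f x i = \<beta> i + x * \<kappa> i"
    and f_outside: "\<And>x i. i \<notin> {1..n} \<Longrightarrow> f x i = 0"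
    and f_conf: "\<And>x. x \<notin> q ` {1..m} \<Longrightarrow> f x \<in> conf n"
    and base: "base_path m q q0 \<epsilon> \<xi>"
    and wiring: "braided_wiring n f m q q0 \<epsilon> \<xi>"
begin

interpretation B: group "Br n"
  by (rule group_braid_group)

lemma \<epsilon>_pos: "0 < \<epsilon>"
  using base by (simp add: base_path_def)

lemma continuous_f: "continuous_on A f"
proof (rule continuous_on_coordinatewise_then_product)
  fix i show "continuous_on A (\<lambda>x. f x i)"
    by (cases "i \<in> {1..n}") (auto simp: f_line f_outside intro!: continuous_intros simp del: atLeastAtMost_iff)
qed

lemma conf_path_f: "path p \<Longrightarrow> path_image p \<subseteq> - q ` {1..m} \<Longrightarrow> conf_path n (f \<circ> p)"
  using path_continuous_image[OF _ continuous_f] f_conf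
  by (auto simp: conf_path_def path_image_compose)

lemma punctured_disk:
  assumes "j \<in> {1..m}" "dist (q j) x \<le> \<epsilon>" "x \<noteq> q j"
  shows "x \<notin> q ` {1..m}"
proof
  assume "x \<in> q ` {1..m}"
  then obtain i where i: "i \<in> {1..m}" "x = q i" by blast
  then have "i \<noteq> j" using assms by auto
  then have "cball (q i) \<epsilon> \<inter> cball (q j) \<epsilon> = {}"
    using base i assms(1) by (simp add: base_path_def)
  moreover have "q i \<in> cball (q i) \<epsilon>" "q i \<in> cball (q j) \<epsilon>"
    using assms(2) i \<epsilon>_pos by auto
  ultimately show False by blast
qed

lemma circle_punctured:
  assumes "j \<in> {1..m}" "norm u \<le> 1" "u \<noteq> 0"
  shows "q j + of_real \<epsilon> * u \<notin> q ` {1..m}"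
  using assms \<epsilon>_pos by (intro punctured_disk[OF assms(1)]) (auto simp: dist_norm norm_mult mult_left_le)

section \<open>The lines over one small disk and their normal form\<close>

context
  fixes j :: nat
  assumes j: "j \<in> {1..m}"
begin

definition order_at :: "nat \<Rightarrow> nat" where
  "order_at = lex_pos n (f (q j + of_real \<epsilon>))"

definition label_at :: "nat \<Rightarrow> nat" where
  "label_at = inv_into UNIV order_at"

definition point_at :: "nat \<Rightarrow> complex" where
  "point_at i = f (q j) (label_at i)"

text \<open>The factor \<epsilon> comes from rescaling the disk around \<open>q j\<close> to the
  unit disk; lines are numbered by their order over the point \<open>u = 1\<close>.\<close>

definition slope_at :: "nat \<Rightarrow> complex" where
  "slope_at i = of_real \<epsilon> * \<kappa> (label_at i)"

definition class_at :: "nat \<Rightarrow> nat set" where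
  "class_at i = {k\<in>{1..n}. point_at k = point_at i}"

lemmas wiring_at = wiring[unfolded braided_wiring_def, THEN conjunct2, THEN conjunct2, THEN bspec, OF j]

lemma f_right: "f (q j + of_real \<epsilon>) \<in> conf n"
  using circle_punctured[OF j, of 1] by (intro f_conf) simp

lemma order_at_permutes: "order_at permutes {1..n}"
  unfolding order_at_def using f_right by (rule lex_pos_permutes)

lemma label_at_permutes: "label_at permutes {1..n}"
  unfolding label_at_def using order_at_permutes by (rule permutes_inv)

lemma label_at_in: "i \<in> {1..n} \<Longrightarrow> label_at i \<in> {1..n}"
  using permutes_in_image[OF label_at_permutes] by blast

lemma order_label: "order_at (label_at i) = i" and label_order: "label_at (order_at i) = i"
  unfolding label_at_def using permutes_inverses[OF order_at_permutes] by simp_all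

lemma f_near: "f (q j + of_real \<epsilon> * u) \<circ> label_at = lines n point_at slope_at u"
proof
  fix i
  show "(f (q j + of_real \<epsilon> * u) \<circ> label_at) i = lines n point_at slope_at u i"
  proof (cases "i \<in> {1..n}")
    case True
    then show ?thesis using label_at_in[OF True]
      by (simp add: lines_def point_at_def slope_at_def f_line algebra_simps)
  next
    case False
    then show ?thesis using f_outside permutes_not_in[OF label_at_permutes]
      by (simp add: lines_def del: atLeastAtMost_iff)
  qed
qed

lemma local_partition_class: "local_partition n f (q j) \<epsilon> = class_at ` {1..n}"
proof -
  have "order_at ` {k\<in>{1..n}. f (q j) i = f (q j) k} = class_at (order_at i)" for i
  proof (intro equalityI subsetI)
    fix x assume "x \<in> order_at ` {k\<in>{1..n}. f (q j) i = f (q j) k}"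
    then obtain k where "k \<in> {1..n}" "f (q j) i = f (q j) k" "x = order_at k" by blast
    then show "x \<in> class_at (order_at i)"
      using permutes_in_image[OF order_at_permutes] by (auto simp: class_at_def point_at_def label_order simp del: atLeastAtMost_iff)
  next
    fix x assume x: "x \<in> class_at (order_at i)"
    then have "label_at x \<in> {k\<in>{1..n}. f (q j) i = f (q j) k}"
      using label_at_in by (auto simp: class_at_def point_at_def label_order simp del: atLeastAtMost_iff)
    then show "x \<in> order_at ` {k\<in>{1..n}. f (q j) i = f (q j) k}"
      using order_label by (metis image_eqI)
  qed
  moreover have "meeting_partition n f (q j) = (\<lambda>i. {k\<in>{1..n}. f (q j) i = f (q j) k}) ` {1..n}"
    by (auto simp: meeting_partition_def quotient_def)
  ultimately have "local_partition n f (q j) \<epsilon> = class_at ` order_at ` {1..n}"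
    unfolding local_partition_def order_at_def[symmetric] by (simp add: image_image)
  then show ?thesis
    by (simp add: permutes_image[OF order_at_permutes])
qed

lemma class_at_self: "i \<in> {1..n} \<Longrightarrow> i \<in> class_at i"
  by (simp add: class_at_def)

lemma class_at_eq: "k \<in> class_at i \<Longrightarrow> class_at k = class_at i"
  by (auto simp: class_at_def)

lemma block_min_at: "i \<in> {1..n} \<Longrightarrow> block_min (local_partition n f (q j) \<epsilon>) i = Min (class_at i)"
proof -
  assume i: "i \<in> {1..n}"
  have "\<Union>{U \<in> class_at ` {1..n}. i \<in> U} = class_at i"
    using class_at_eq class_at_self[OF i] i by blast
  then show ?thesis by (simp add: block_min_def local_partition_class)
qed

abbreviation "\<mu> \<equiv> block_min (local_partition n f (q j) \<epsilon>)"

lemma block_min_in_class: "i \<in> {1..n} \<Longrightarrow> \<mu> i \<in> class_at i" and block_min_le: "i \<in> {1..n} \<Longrightarrow> \<mu> i \<le> i"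
proof -
  assume i: "i \<in> {1..n}"
  have fin: "finite (class_at i)" by (simp add: class_at_def)
  show "\<mu> i \<in> class_at i"
    unfolding block_min_at[OF i] using class_at_self[OF i] fin by (intro Min_in) auto
  show "\<mu> i \<le> i"
    unfolding block_min_at[OF i] using class_at_self[OF i] fin by (intro Min_le)
qed

lemma block_min_eq_iff:
  assumes "i \<in> {1..n}" "k \<in> {1..n}"
  shows "\<mu> i = \<mu> k \<longleftrightarrow> point_at i = point_at k"
proof
  assume "\<mu> i = \<mu> k"
  then have "\<mu> i \<in> class_at i" "\<mu> i \<in> class_at k" using block_min_in_class assms by metis+
  then show "point_at i = point_at k" by (auto simp: class_at_def)
next
  assume "point_at i = point_at k"
  then have "class_at i = class_at k" by (simp add: class_at_def)
  then show "\<mu> i = \<mu> k" using assms by (simp add: block_min_at)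
qed

text \<open>Here consecutive blocks are essential: otherwise \<open>i\<close> would lie between two
  elements \<open>\<mu> k\<close> and \<open>k\<close> of the block of \<open>k\<close>, hence
  belong to it.\<close>

lemma block_min_mono:
  assumes ik: "i \<in> {1..n}" "k \<in> {1..n}" "i < k"
  shows "\<mu> i \<le> \<mu> k"
proof (rule ccontr)
  assume less: "\<not> \<mu> i \<le> \<mu> k"
  have "class_at k \<in> local_partition n f (q j) \<epsilon>" using ik local_partition_class by blast
  then obtain a b where ab: "class_at k = {a..b}"
    using wiring_at[THEN conjunct1] by blast
  have "\<mu> k \<in> {a..b}" "k \<in> {a..b}"
    using block_min_in_class[OF ik(2)] class_at_self[OF ik(2)] ab by simp_all
  moreover have "\<mu> k \<le> i" using less block_min_le[OF ik(1)] by simp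
  ultimately have "i \<in> class_at k" using ab ik(3) by auto
  then have "\<mu> i = \<mu> k" using ik by (simp add: block_min_eq_iff class_at_def)
  then show False using less by simp
qed

text \<open>The order at \<open>u = 1\<close> holds by the numbering and is carried to
  \<open>u = -1\<close> by the last condition of \<open>braided_wiring\<close>. Coincidences at
  other points of the disk are excluded because it contains no further \<open>q i\<close>.\<close>

lemma tame_at: "tame n point_at slope_at"
  unfolding tame_def
proof (intro ballI impI)
  fix i k assume ik: "i \<in> {1..n}" "k \<in> {1..n}" "i < k"
  have near: "f (q j + of_real \<epsilon> * u) (label_at l) = point_at l + u * slope_at l" if "l \<in> {1..n}" for u l
    using fun_cong[OF f_near, of u l] that by (simp add: lines_def)
  have "lex_less (f (q j + of_real \<epsilon>) (label_at i)) (f (q j + of_real \<epsilon>) (label_at k))"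
    using lex_pos_less_iff[OF f_right label_at_in[OF ik(1)] label_at_in[OF ik(2)]] order_label ik(3)
    unfolding order_at_def by simp
  then have right: "lex_less (point_at i + slope_at i) (point_at k + slope_at k)"
    using near[OF ik(1), of 1] near[OF ik(2), of 1] by simp
  then have right': "lex_less 0 (point_at k - point_at i + (slope_at k - slope_at i))"
    by (subst (asm) lex_less_diff) (simp add: algebra_simps)
  show "tame_pair point_at slope_at i k"
  proof (cases "point_at i = point_at k")
    case True
    then show ?thesis using right' by (simp add: tame_pair_def)
  next
    case False
    then have "f (q j) (label_at i) \<noteq> f (q j) (label_at k)" by (simp add: point_at_def)
    moreover have "f (q j) (label_at i) \<noteq> f (q j) (label_at k) \<longrightarrow>
        (lex_less (f (q j + of_real \<epsilon>) (label_at i)) (f (q j + of_real \<epsilon>) (label_at k)) \<longleftrightarrow>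
         lex_less (f (q j - of_real \<epsilon>) (label_at i)) (f (q j - of_real \<epsilon>) (label_at k)))"
      using wiring_at[THEN conjunct2] label_at_in[OF ik(1)] label_at_in[OF ik(2)] by blast
    moreover have "lex_less (f (q j + of_real \<epsilon>) (label_at i)) (f (q j + of_real \<epsilon>) (label_at k))"
      using right near[OF ik(1), of 1] near[OF ik(2), of 1] by simp
    ultimately have "lex_less (f (q j - of_real \<epsilon>) (label_at i)) (f (q j - of_real \<epsilon>) (label_at k))"
      by blast
    then have "lex_less (point_at i - slope_at i) (point_at k - slope_at k)"
      using near[OF ik(1), of "-1"] near[OF ik(2), of "-1"] by simp
    then have left: "lex_less 0 (point_at k - point_at i - (slope_at k - slope_at i))"
      by (subst (asm) lex_less_diff) (simp add: algebra_simps)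
    have "point_at k - point_at i + u * (slope_at k - slope_at i) \<noteq> 0" if u: "norm u \<le> 1" for u
    proof (cases "u = 0")
      case False
      have "label_at i \<noteq> label_at k" using ik(3) order_label by (metis less_irrefl)
      then have "f (q j + of_real \<epsilon> * u) (label_at i) \<noteq> f (q j + of_real \<epsilon> * u) (label_at k)"
        using conf_distinct[OF f_conf[OF circle_punctured[OF j u False]]] label_at_in ik by blast
      then show ?thesis
        unfolding near[OF ik(1)] near[OF ik(2)] by (simp add: algebra_simps)
    qed (use \<open>point_at i \<noteq> point_at k\<close> in simp)
    then show ?thesis using False left right' by (simp add: tame_pair_def)
  qed
qed

text \<open>The angles must begin and end at multiples of pi, since the order of the lines is
  controlled only over the ends of the horizontal diameter.\<close>

lemma traced_braid_near:
  assumes \<theta>: "path \<theta>" and ends: "\<theta> 0 = 0 \<or> \<theta> 0 = pi" "\<theta> 1 = pi \<or> \<theta> 1 = 2 * pi"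
  shows "traced_braid n (\<lambda>t. f (q j + of_real \<epsilon> * exp (\<i> * of_real (\<theta> t))))
    = traced_braid n (\<lambda>t. lines n (hubs n \<mu>) of_nat (exp (\<i> * of_real (\<theta> t))))"
proof -
  let ?w = "\<lambda>t. exp (\<i> * of_real (\<theta> t))"
  have "f (q j + of_real \<epsilon> * ?w 0) \<in> conf n"
    using circle_punctured[OF j] by (intro f_conf) simp
  then have "traced_braid n (\<lambda>t. f (q j + of_real \<epsilon> * ?w t) \<circ> label_at) = traced_braid n (\<lambda>t. f (q j + of_real \<epsilon> * ?w t))"
    by (rule traced_braid_relabel[OF _ label_at_permutes])
  then have "traced_braid n (\<lambda>t. f (q j + of_real \<epsilon> * ?w t)) = traced_braid n (\<lambda>t. lines n point_at slope_at (?w t))"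
    unfolding f_near by simp
  also have "\<dots> = traced_braid n (\<lambda>t. lines n (hubs n \<mu>) of_nat (?w t))"
  proof (rule traced_braid_lines_eq[OF tame_at])
    show "tame n (hubs n \<mu>) of_nat"
      using block_min_mono by (rule tame_hubs)
    show "point_at i = point_at k \<longleftrightarrow> hubs n \<mu> i = hubs n \<mu> k" if "i \<in> {1..n}" "k \<in> {1..n}" for i k
      using block_min_eq_iff[OF that] that by (auto simp: hubs_def)
    show "?w 0 = 1 \<or> ?w 0 = - 1" "?w 1 = 1 \<or> ?w 1 = - 1"
      using ends exp_full_turn exp_pi_i by (auto simp: mult.commute)
  qed (auto intro: path_exp \<theta>)
  finally show ?thesis .
qed

lemma traced_braid_upper_arc:
  "traced_braid n (f \<circ> upper_arc (q j) \<epsilon>) = half_braid n (local_partition n f (q j) \<epsilon>)"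
proof -
  have "f \<circ> upper_arc (q j) \<epsilon> = (\<lambda>t. f (q j + of_real \<epsilon> * exp (\<i> * of_real (linepath 0 pi t))))"
    by (auto simp: upper_arc_def part_circlepath_def)
  then show ?thesis
    using traced_braid_near[OF path_linepath[of 0 pi]] by (simp add: half_braid_def linepath_def)
qed

lemma traced_braid_circle:
  assumes Us: "distinct Us" "set Us = local_partition n f (q j) \<epsilon>"
  shows "traced_braid n (f \<circ> (upper_arc (q j) \<epsilon> +++ lower_arc (q j) \<epsilon>))
    = braid_word n (map (\<lambda>U. traced_braid n (full_twist n U)) Us)"
proof -
  let ?\<theta> = "linepath 0 pi +++ linepath pi (2 * pi)"
  have \<theta>: "path ?\<theta>" "?\<theta> 0 = 0 \<or> ?\<theta> 0 = pi" "?\<theta> 1 = pi \<or> ?\<theta> 1 = 2 * pi"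
    by (simp, simp_all add: joinpaths_def linepath_def)
  define G where "G = (\<lambda>\<phi> :: real. wheels n \<mu> (\<lambda>_. exp (\<i> * of_real \<phi>)))"
  have G: "conf_family n G"
  proof (rule conf_familyI)
    show "G \<phi> \<in> conf n" for \<phi>
      unfolding G_def by (rule wheels_conf) auto
    show "continuous_on UNIV (\<lambda>\<phi>. G \<phi> i)" for i
      unfolding G_def wheels_def by (cases "i \<in> {1..n}") (auto intro!: continuous_intros)
  qed
  have "f \<circ> (upper_arc (q j) \<epsilon> +++ lower_arc (q j) \<epsilon>) = (\<lambda>t. f (q j + of_real \<epsilon> * exp (\<i> * of_real (?\<theta> t))))"
    by (auto simp: upper_arc_def lower_arc_def part_circlepath_def joinpaths_def)
  then have "traced_braid n (f \<circ> (upper_arc (q j) \<epsilon> +++ lower_arc (q j) \<epsilon>)) = traced_braid n (G \<circ> ?\<theta>)"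
    using traced_braid_near[OF \<theta>] by (simp only: G_def wheels_lines comp_def)
  \<comment> \<open>In the model the configuration depends on a real angle alone, so the two arcs
    may be reparametrised to uniform speed; the result is the turn of all blocks together.\<close>
  also have "\<dots> = traced_braid n (G \<circ> linepath 0 (2 * pi))"
    by (rule traced_braid_family[OF G]) auto
  also have "G \<circ> linepath 0 (2 * pi) = block_turn n \<mu> {1..n}"
    by (auto simp: G_def block_turn_def wheels_def linepath_def fun_eq_iff ac_simps)
  also have "{1..n} = \<Union>(set Us)"
    unfolding Us(2) local_partition_class using class_at_self by (auto simp: class_at_def)
  also have "traced_braid n (block_turn n \<mu> (\<Union>(set Us))) = braid_word n (map (\<lambda>U. traced_braid n (block_turn n \<mu> U)) Us)"
  proof (rule traced_braid_block_turn_list)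
    show "fibre n \<mu> U" if U: "U \<in> set Us" for U
    proof -
      obtain l where "U = class_at l" using U unfolding Us(2) local_partition_class by blast
      then show ?thesis
        unfolding fibre_def by (auto simp: class_at_def block_min_eq_iff)
    qed
    show "pairwise disjnt (set Us)"
      unfolding Us(2) local_partition_class by (auto simp: pairwise_def disjnt_def class_at_def)
  qed (rule Us(1))
  also have "map (\<lambda>U. traced_braid n (block_turn n \<mu> U)) Us = map (\<lambda>U. traced_braid n (full_twist n U)) Us"
  proof (rule map_cong[OF refl])
    fix U assume "U \<in> set Us"
    then obtain l where U: "U = class_at l" unfolding Us(2) local_partition_class by blast
    show "traced_braid n (block_turn n \<mu> U) = traced_braid n (full_twist n U)"
    proof (rule traced_braid_block_turn)
      show "\<mu> i \<le> \<mu> k" if "i \<in> {1..n}" "k \<in> {1..n}" "i < k" for i k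
        using that by (rule block_min_mono)
      show "fibre n \<mu> U"
        unfolding fibre_def U by (auto simp: class_at_def block_min_eq_iff)
      show "\<mu> i = \<mu> k" if "i \<in> U" "k \<in> U" for i k
        using that by (simp add: U class_at_def block_min_eq_iff)
    qed
  qed
  finally show ?thesis .
qed

end

section \<open>Paths and loops in the punctured line\<close>

lemma arcs_punctured:
  assumes "j \<in> {1..m}"
  shows "path_image (upper_arc (q j) \<epsilon>) \<subseteq> - q ` {1..m}" "path_image (lower_arc (q j) \<epsilon>) \<subseteq> - q ` {1..m}"
proof -
  have circle: "q j + of_real \<epsilon> * exp (\<i> * of_real \<theta>) \<notin> q ` {1..m}" for \<theta>
    using circle_punctured[OF assms] by simp
  show "path_image (upper_arc (q j) \<epsilon>) \<subseteq> - q ` {1..m}"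
    unfolding upper_arc_def part_circlepath_def path_image_def by (rule image_subsetI, rule ComplI, erule notE[OF circle])
  show "path_image (lower_arc (q j) \<epsilon>) \<subseteq> - q ` {1..m}"
    unfolding lower_arc_def part_circlepath_def path_image_def by (rule image_subsetI, rule ComplI, erule notE[OF circle])
qed

lemma arc_ends:
  "pathstart (upper_arc c r) = c + of_real r" "pathfinish (upper_arc c r) = c - of_real r"
  "pathstart (lower_arc c r) = c - of_real r" "pathfinish (lower_arc c r) = c + of_real r"
  using exp_pi_i exp_two_pi_i by (simp_all add: upper_arc_def lower_arc_def ac_simps)

lemma path_arcs: "path (upper_arc c r)" "path (lower_arc c r)"
  by (simp_all add: upper_arc_def lower_arc_def)

lemma base_piece:
  assumes "k \<le> m"
  shows "path (\<xi> k)" "path_image (\<xi> k) \<subseteq> - q ` {1..m}"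
proof -
  show "path (\<xi> k)" using base assms by (simp add: base_path_def)
  have "path_image (\<xi> k) \<inter> (\<Union>i\<in>{1..m}. ball (q i) \<epsilon>) = {}"
    using base assms unfolding base_path_def by blast
  moreover have "q ` {1..m} \<subseteq> (\<Union>i\<in>{1..m}. ball (q i) \<epsilon>)"
    using \<epsilon>_pos by auto
  ultimately show "path_image (\<xi> k) \<subseteq> - q ` {1..m}" by blast
qed

lemma base_ends:
  shows "pathstart (\<xi> 0) = q0" "k \<in> {1..m} \<Longrightarrow> pathstart (\<xi> k) = q k - of_real \<epsilon>"
    "k < m \<Longrightarrow> pathfinish (\<xi> k) = q (Suc k) + of_real \<epsilon>"
  using base by (simp_all add: base_path_def)

lemma approach_path:
  assumes "k < m"
  shows "path (approach q \<epsilon> \<xi> k) \<and> path_image (approach q \<epsilon> \<xi> k) \<subseteq> - q ` {1..m} \<and>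
    pathstart (approach q \<epsilon> \<xi> k) = q0 \<and> pathfinish (approach q \<epsilon> \<xi> k) = q (Suc k) + of_real \<epsilon>"
  using assms
proof (induction k)
  case 0
  then show ?case using base_piece[of 0] base_ends by simp
next
  case (Suc k)
  then have k: "Suc k \<in> {1..m}" by simp
  show ?case
    using Suc base_piece[of "Suc k"] base_ends(2)[OF k] base_ends(3)[of "Suc k"] arcs_punctured(1)[OF k]
    by (simp add: subset_path_image_join arc_ends path_arcs)
qed

lemma traced_braid_approach:
  assumes "k < m"
  shows "traced_braid n (f \<circ> approach q \<epsilon> \<xi> k) = diagram_braid n (take k (wiring_diagram n f m q \<epsilon> \<xi>))"
  using assms
proof (induction k)
  case 0
  then show ?case using wiring by (simp add: braided_wiring_def diagram_braid_def comp_def)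
next
  case (Suc k)
  then have k: "Suc k \<in> {1..m}" by simp
  let ?a = "approach q \<epsilon> \<xi> k" and ?u = "upper_arc (q (Suc k)) \<epsilon>" and ?x = "\<xi> (Suc k)"
  have a: "conf_path n (f \<circ> ?a)" using approach_path[of k] Suc.prems by (simp add: conf_path_f)
  have u: "conf_path n (f \<circ> ?u)" using arcs_punctured[OF k] by (simp add: conf_path_f path_arcs)
  have x: "conf_path n (f \<circ> ?x)" using base_piece[of "Suc k"] Suc.prems by (simp add: conf_path_f)
  have joins: "(f \<circ> ?u) 1 = (f \<circ> ?x) 0" "(f \<circ> ?a) 1 = (f \<circ> ?u) 0"
    using arc_ends[of "q (Suc k)" \<epsilon>] base_ends(2)[OF k] approach_path[of k] Suc.prems
    by (auto simp: pathstart_def pathfinish_def)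
  have ux: "conf_path n ((f \<circ> ?u) +++ (f \<circ> ?x))"
    using u x joins(1) by (rule conf_path_join)
  have "f \<circ> approach q \<epsilon> \<xi> (Suc k) = (f \<circ> ?a) +++ ((f \<circ> ?u) +++ (f \<circ> ?x))"
    by (simp add: joinpaths_compose)
  moreover have "(f \<circ> ?a) 1 = ((f \<circ> ?u) +++ (f \<circ> ?x)) 0"
    using joins(2) by (simp add: joinpaths_def)
  ultimately have "traced_braid n (f \<circ> approach q \<epsilon> \<xi> (Suc k)) = traced_braid n (f \<circ> ?a) \<otimes>\<^bsub>Br n\<^esub>
      (traced_braid n (f \<circ> ?u) \<otimes>\<^bsub>Br n\<^esub> traced_braid n (f \<circ> ?x))"
    by (simp only: traced_braid_join[OF a ux] traced_braid_join[OF u x joins(1)])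
  \<comment> \<open>Lists count from 0, so entry \<open>k\<close> of the diagram belongs to the
    point \<open>q (Suc k)\<close>.\<close>
  moreover have "take (Suc k) (wiring_diagram n f m q \<epsilon> \<xi>)
      = take k (wiring_diagram n f m q \<epsilon> \<xi>) @ [(local_partition n f (q (Suc k)) \<epsilon>, traced_braid n (f \<circ> ?x))]"
    using Suc.prems by (simp add: wiring_diagram_def take_Suc_conv_app_nth plus_1_eq_Suc del: upt_Suc)
  ultimately show ?case
    using Suc traced_braid_upper_arc[OF k] by (simp add: diagram_braid_def comp_def)
qed

lemma lex_pos_base: "lex_pos n (f q0) = id"
proof (rule lex_pos_unique[OF permutes_id])
  fix i k assume ik: "i \<in> {1..n}" "k \<in> {1..n}"
  have less: "lex_less (f q0 i) (f q0 k)" if "i \<in> {1..n}" "k \<in> {1..n}" "i < k" for i k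
    using wiring[unfolded braided_wiring_def, THEN conjunct1] that by blast
  show "lex_less (f q0 i) (f q0 k) \<longleftrightarrow> id i < id k"
    using less[OF ik] less[OF ik(2,1)] lex_less_asym by (cases i k rule: linorder_cases) auto
qed

lemma base_loop_path:
  assumes j: "j \<in> {1..m}"
  defines "p \<equiv> approach q \<epsilon> \<xi> (j - 1) +++ (upper_arc (q j) \<epsilon> +++ lower_arc (q j) \<epsilon>) +++ reversepath (approach q \<epsilon> \<xi> (j - 1))"
  shows "path p" "path_image p \<subseteq> - q ` {1..m}" "pathstart p = q0" "pathfinish p = q0"
proof -
  have "j - 1 < m" "Suc (j - 1) = j" using j by auto
  then show "path p" "path_image p \<subseteq> - q ` {1..m}" "pathstart p = q0" "pathfinish p = q0"
    using approach_path[of "j - 1"] arcs_punctured[OF j]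
    by (simp_all add: p_def subset_path_image_join arc_ends path_arcs)
qed

theorem traced_braid_base_loop:
  assumes j: "j \<in> {1..m}" and Vs: "distinct Vs" "set Vs = meeting_partition n f (q j)"
  defines "p \<equiv> approach q \<epsilon> \<xi> (j - 1) +++ (upper_arc (q j) \<epsilon> +++ lower_arc (q j) \<epsilon>) +++ reversepath (approach q \<epsilon> \<xi> (j - 1))"
    and "P \<equiv> diagram_braid n (take (j - 1) (wiring_diagram n f m q \<epsilon> \<xi>))"
  shows "traced_braid n (f \<circ> p) = braid_word n (map (\<lambda>V. braid_conj n (block_twist n V) (block_conjugator n P V)) Vs)"
    and "\<And>V. V \<in> set Vs \<Longrightarrow> block_conjugator n P V \<in> carrier (pure_braid_group n)"
proof -
  let ?a = "approach q \<epsilon> \<xi> (j - 1)" and ?c = "upper_arc (q j) \<epsilon> +++ lower_arc (q j) \<epsilon>"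
  have j1: "j - 1 < m" "Suc (j - 1) = j" using j by auto
  note ap = approach_path[OF j1(1), unfolded j1(2)]
  have a: "conf_path n (f \<circ> ?a)" using ap by (simp add: conf_path_f)
  have c: "conf_path n (f \<circ> ?c)"
    using arcs_punctured[OF j] by (intro conf_path_f) (simp_all add: subset_path_image_join arc_ends path_arcs)
  have a0: "lex_pos n ((f \<circ> ?a) 0) = id" and a1: "(f \<circ> ?a) 1 = f (q j + of_real \<epsilon>)"
    using ap lex_pos_base by (auto simp: pathstart_def pathfinish_def)
  have P: "traced_braid n (f \<circ> ?a) = P"
    unfolding P_def using j1(1) by (rule traced_braid_approach)
  have Pc: "P \<in> carrier (Br n)"
    using traced_braid_in_carrier[OF a] P by simp
  have V_n: "V \<subseteq> {1..n}" if "V \<in> set Vs" for V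
    using that unfolding Vs(2) meeting_partition_def quotient_def by auto
  let ?\<pi> = "lex_pos n (f (q j + of_real \<epsilon>))"
  have \<pi>: "?\<pi> permutes {1..n}"
    using conf_path_finish[OF a] a1 by (simp add: lex_pos_permutes)
  \<comment> \<open>The order over \<open>q j + \<epsilon>\<close> translates the blocks of
    \<open>V(j)\<close> into those of \<open>I(j)\<close> and keeps the enumeration, which is
    arbitrary.\<close>
  have Us: "distinct (map ((`) ?\<pi>) Vs)" "set (map ((`) ?\<pi>) Vs) = local_partition n f (q j) \<epsilon>"
    using Vs permutes_inj[OF \<pi>] by (simp_all add: distinct_map local_partition_def inj_image_eq_iff inj_on_def)
  show "block_conjugator n P V \<in> carrier (pure_braid_group n)" if "V \<in> set Vs" for V
    using block_conjugator_pure[OF a a0 V_n[OF that]] unfolding P .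
  have conj: "braid_conj n (block_twist n V) (block_conjugator n P V)
      = P \<otimes>\<^bsub>Br n\<^esub> traced_braid n (full_twist n (?\<pi> ` V)) \<otimes>\<^bsub>Br n\<^esub> inv\<^bsub>Br n\<^esub> P"
    if "V \<in> set Vs" for V
    using braid_conj_block_conjugator[OF a a0 V_n[OF that]] unfolding P a1 .
  have tw: "traced_braid n (full_twist n (?\<pi> ` V)) \<in> carrier (Br n)" if "V \<in> set Vs" for V
  proof -
    have "?\<pi> ` V \<subseteq> {1..n}" using V_n[OF that] permutes_image[OF \<pi>] by blast
    then show ?thesis by (intro traced_braid_in_carrier conf_path_full_twist)
  qed
  \<comment> \<open>Conjugation by \<open>P\<close> is distributed over the product: between
    neighbouring factors \<open>inv P\<close> meets \<open>P\<close>.\<close>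
  have word: "P \<otimes>\<^bsub>Br n\<^esub> braid_word n (map (\<lambda>V. traced_braid n (full_twist n (?\<pi> ` V))) Ws) \<otimes>\<^bsub>Br n\<^esub> inv\<^bsub>Br n\<^esub> P
      = braid_word n (map (\<lambda>V. braid_conj n (block_twist n V) (block_conjugator n P V)) Ws)"
    if "set Ws \<subseteq> set Vs" for Ws
    using that
  proof (induction Ws)
    case (Cons W Ws)
    let ?T = "traced_braid n (full_twist n (?\<pi> ` W))" and ?R = "braid_word n (map (\<lambda>V. traced_braid n (full_twist n (?\<pi> ` V))) Ws)"
    have R: "?R \<in> carrier (Br n)"
      using Cons.prems tw by (intro braid_word_in_carrier) (auto simp: subset_iff)
    have T: "?T \<in> carrier (Br n)" using Cons.prems tw by simp
    have "inv\<^bsub>Br n\<^esub> P \<otimes>\<^bsub>Br n\<^esub> (P \<otimes>\<^bsub>Br n\<^esub> (?R \<otimes>\<^bsub>Br n\<^esub> inv\<^bsub>Br n\<^esub> P))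
        = ?R \<otimes>\<^bsub>Br n\<^esub> inv\<^bsub>Br n\<^esub> P"
      using Pc R by (simp flip: B.m_assoc)
    then show ?case
      using Cons Pc R T conj[of W] by (simp add: B.m_assoc flip: Cons.IH)
  qed (use Pc in simp)
  have ca: "conf_path n ((f \<circ> ?c) +++ reversepath (f \<circ> ?a))" and joins: "(f \<circ> ?c) 1 = reversepath (f \<circ> ?a) 0" "(f \<circ> ?a) 1 = (f \<circ> ?c) 0"
  proof -
    show joins: "(f \<circ> ?c) 1 = reversepath (f \<circ> ?a) 0" "(f \<circ> ?a) 1 = (f \<circ> ?c) 0"
      using arc_ends[of "q j" \<epsilon>] ap by (auto simp: pathstart_def pathfinish_def reversepath_def joinpaths_def)
    show "conf_path n ((f \<circ> ?c) +++ reversepath (f \<circ> ?a))"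
      using c conf_path_reversepath[OF a] joins(1) by (rule conf_path_join)
  qed
  have "f \<circ> p = (f \<circ> ?a) +++ ((f \<circ> ?c) +++ reversepath (f \<circ> ?a))"
    by (simp only: p_def joinpaths_compose) (simp add: reversepath_def comp_def)
  moreover have "(f \<circ> ?a) 1 = ((f \<circ> ?c) +++ reversepath (f \<circ> ?a)) 0"
    using joins(2) by (simp add: joinpaths_def)
  ultimately have "traced_braid n (f \<circ> p) = P \<otimes>\<^bsub>Br n\<^esub> (traced_braid n (f \<circ> ?c) \<otimes>\<^bsub>Br n\<^esub> inv\<^bsub>Br n\<^esub> P)"
    by (simp only: traced_braid_join[OF a ca] traced_braid_join[OF c conf_path_reversepath[OF a] joins(1)]
        traced_braid_reversepath[OF a] P)
  also have "traced_braid n (f \<circ> ?c) = braid_word n (map (\<lambda>V. traced_braid n (full_twist n (?\<pi> ` V))) Vs)"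
    using traced_braid_circle[OF j Us] by (simp add: comp_def)
  finally show "traced_braid n (f \<circ> p) = braid_word n (map (\<lambda>V. braid_conj n (block_twist n V) (block_conjugator n P V)) Vs)"
    using word[OF order_refl] Pc tw
    by (subst (asm) B.m_assoc[symmetric]) (auto intro!: braid_word_in_carrier)
qed

end

section \<open>Restriction of a root map to a transverse line\<close>

lemma aff_line_cspace: "a \<in> cspace l \<Longrightarrow> v \<in> cspace l \<Longrightarrow> aff_line a v x \<in> cspace l"
  by (simp add: cspace_def aff_line_def)

lemma continuous_on_aff_line: "continuous_on S (aff_line a v)"
  unfolding aff_line_def by (intro continuous_on_coordinatewise_then_product continuous_intros)

lemma affine_form_aff_line:
  assumes "affine_form l h" "a \<in> cspace l" "v \<in> cspace l"
  shows "\<exists>b k. \<forall>x. h (aff_line a v x) = b + x * k"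
proof -
  obtain c d where h: "\<And>y. y \<in> cspace l \<Longrightarrow> h y = (\<Sum>i=1..l. c i * y i) + d"
    using assms(1) unfolding affine_form_def by blast
  have "h (aff_line a v x) = ((\<Sum>i=1..l. c i * a i) + d) + x * (\<Sum>i=1..l. c i * v i)" for x
    unfolding h[OF aff_line_cspace[OF assms(2,3)]]
    by (simp add: aff_line_def algebra_simps sum.distrib sum_distrib_left)
  then show ?thesis by blast
qed

lemma root_map_aff_line:
  assumes g: "root_map l n \<A> \<B> X Z g" and av: "a \<in> cspace l" "v \<in> cspace l"
  obtains \<beta> \<kappa> where "\<And>x i. i \<in> {1..n} \<Longrightarrow> (g \<circ> aff_line a v) x i = \<beta> i + x * \<kappa> i"
    "\<And>x i. i \<notin> {1..n} \<Longrightarrow> (g \<circ> aff_line a v) x i = 0"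
proof -
  have "\<forall>i\<in>{1..n}. \<exists>b k. \<forall>x. g (aff_line a v x) i = b + x * k"
    using g affine_form_aff_line[OF _ av] unfolding root_map_def by blast
  then obtain \<beta> \<kappa> where "\<forall>i\<in>{1..n}. \<forall>x. g (aff_line a v x) i = \<beta> i + x * \<kappa> i"
    by metis
  moreover have "g (aff_line a v x) \<in> cspace n" for x
    using g aff_line_cspace[OF av] unfolding root_map_def by blast
  ultimately show ?thesis
    using that[of \<beta> \<kappa>] unfolding cspace_def by simp
qed

lemma continuous_on_root_map:
  assumes g: "root_map l n \<A> \<B> X Z g"
  shows "continuous_on (arr_complement l \<B>) g"
proof (rule continuous_on_coordinatewise_then_product)
  fix j
  have coord: "continuous_on (arr_complement l \<B>) (\<lambda>x. x i)" for i :: nat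
    by (rule continuous_on_product_then_coordinatewise[OF continuous_on_id])
  have sub: "arr_complement l \<B> \<subseteq> cspace l" by (auto simp: arr_complement_def)
  show "continuous_on (arr_complement l \<B>) (\<lambda>x. g x j)"
  proof (cases "j \<in> {1..n}")
    case True
    then have "affine_form l (\<lambda>x. g x j)" using g by (simp add: root_map_def)
    then obtain c d where h: "\<And>y. y \<in> cspace l \<Longrightarrow> g y j = (\<Sum>i=1..l. c i * y i) + d"
      unfolding affine_form_def by blast
    have "continuous_on (arr_complement l \<B>) (\<lambda>y. (\<Sum>i=1..l. c i * y i) + d)"
      by (intro continuous_intros coord)
    then show ?thesis
      by (rule continuous_on_eq) (use h sub in auto)
  next
    case False
    have "g y \<in> cspace n" if "y \<in> arr_complement l \<B>" for y
      using g sub that unfolding root_map_def by blast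
    then have "g y j = 0" if "y \<in> arr_complement l \<B>" for y
      using False that unfolding cspace_def by blast
    then show ?thesis by (intro continuous_on_eq[OF continuous_on_const[of _ 0]]) auto
  qed
qed

theorem theorem1p3p1:
  fixes n :: nat
  shows "\<exists>\<zeta> :: (nat set set \<times> braid) list \<Rightarrow> nat set \<Rightarrow> braid.
    (\<forall>D U. \<zeta> D U \<in> carrier (pure_braid_group n)) \<and>
    (\<forall>l m \<A> \<B> X Z g a v q q0 \<epsilon> \<xi>.
       strictly_linearly_fibered_via l \<A> \<B> X Z \<and> card \<A> = m + n \<and> card \<B> = m \<and>
       root_map l n \<A> \<B> X Z g \<and>
       transverse_line l \<B> a v \<and>
       ordered_points m {x. \<exists>H\<in>\<B>. aff_line a v x \<in> H} q \<and>
       base_path m q q0 \<epsilon> \<xi> \<and>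
       braided_wiring n (g \<circ> aff_line a v) m q q0 \<epsilon> \<xi>
       \<longrightarrow>
       (\<forall>j\<in>{1..m}. \<forall>Vs.
          distinct Vs \<and> set Vs = meeting_partition n (g \<circ> aff_line a v) (q j) \<longrightarrow>
          braid_monodromy n g (aff_line a v q0)
              (induced_map (arr_complement l \<B>) (aff_line a v) (base_loop m q \<epsilon> \<xi> j))
            = braid_monodromy n (g \<circ> aff_line a v) q0 (base_loop m q \<epsilon> \<xi> j) \<and>
          braid_monodromy n (g \<circ> aff_line a v) q0 (base_loop m q \<epsilon> \<xi> j)
            = braid_word n
                (map (\<lambda>V. braid_conj n (block_twist n V)
                       (\<zeta> (take (j - 1) (wiring_diagram n (g \<circ> aff_line a v) m q \<epsilon> \<xi>)) V)) Vs)))"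
proof (intro exI conjI allI impI ballI)
  \<comment> \<open>Purity is demanded for arbitrary lists, also for those that come from no wiring
    diagram; there the trivial braid serves as default if necessary.\<close>
  let ?\<zeta> = "\<lambda>(D :: (nat set set \<times> braid) list) V.
    if block_conjugator n (diagram_braid n D) V \<in> carrier (pure_braid_group n)
    then block_conjugator n (diagram_braid n D) V else path_class (conf n) (\<lambda>_. std_conf n)"
  show "?\<zeta> D U \<in> carrier (pure_braid_group n)" for D U
  proof -
    have "path_class (conf n) (\<lambda>_. std_conf n) \<in> carrier (pure_braid_group n)"
      unfolding pure_braid_group_def fundamental_group_def
      by (auto intro!: exI[of _ "\<lambda>_. std_conf n"] simp: path_const path_image_const)
    then show ?thesis by simp
  qed
  fix l m j :: nat and \<A> \<B> X Z and g :: "(nat \<Rightarrow> complex) \<Rightarrow> nat \<Rightarrow> complex"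
    and a v q :: "nat \<Rightarrow> complex" and \<epsilon> \<xi> and q0 :: complex and Vs :: "nat set list"
  let ?f = "g \<circ> aff_line a v" and ?Q = "q ` {1..m}"
  assume hyps: "strictly_linearly_fibered_via l \<A> \<B> X Z \<and> card \<A> = m + n \<and> card \<B> = m \<and>
       root_map l n \<A> \<B> X Z g \<and>
       transverse_line l \<B> a v \<and>
       ordered_points m {x. \<exists>H\<in>\<B>. aff_line a v x \<in> H} q \<and>
       base_path m q q0 \<epsilon> \<xi> \<and>
       braided_wiring n ?f m q q0 \<epsilon> \<xi>"
    and j: "j \<in> {1..m}"
    and Vs: "distinct Vs \<and> set Vs = meeting_partition n ?f (q j)"
  have root: "root_map l n \<A> \<B> X Z g" and base: "base_path m q q0 \<epsilon> \<xi>"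
    and wiring: "braided_wiring n ?f m q q0 \<epsilon> \<xi>" and line: "transverse_line l \<B> a v"
    and points: "ordered_points m {x. \<exists>H\<in>\<B>. aff_line a v x \<in> H} q"
    using hyps by blast+
  have av: "a \<in> cspace l" "v \<in> cspace l"
    using line by (auto simp: transverse_line_def)
  have Q: "?Q = {x. \<exists>H\<in>\<B>. aff_line a v x \<in> H}"
    using points by (simp add: ordered_points_def bij_betw_def)
  have into: "aff_line a v ` (- ?Q) \<subseteq> arr_complement l \<B>"
  proof (rule image_subsetI)
    fix x assume "x \<in> - ?Q"
    then show "aff_line a v x \<in> arr_complement l \<B>"
      unfolding Q using aff_line_cspace[OF av] by (simp add: arr_complement_def)
  qed
  have g_conf: "g ` arr_complement l \<B> \<subseteq> conf n"
    using root by (simp add: root_map_def)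
  obtain \<beta> \<kappa> where f: "\<And>x i. i \<in> {1..n} \<Longrightarrow> ?f x i = \<beta> i + x * \<kappa> i" "\<And>x i. i \<notin> {1..n} \<Longrightarrow> ?f x i = 0"
    using root_map_aff_line[OF root av] by metis
  have f_conf: "?f x \<in> conf n" if "x \<notin> ?Q" for x
    using that into g_conf by auto
  interpret fibred_line n m ?f \<beta> \<kappa> q q0 \<epsilon> \<xi>
    by unfold_locales (fact f f_conf base wiring)+
  let ?a = "approach q \<epsilon> \<xi> (j - 1)"
  let ?p = "?a +++ (upper_arc (q j) \<epsilon> +++ lower_arc (q j) \<epsilon>) +++ reversepath ?a"
  let ?D = "take (j - 1) (wiring_diagram n ?f m q \<epsilon> \<xi>)"
  have p: "path ?p" "path_image ?p \<subseteq> - ?Q" "pathstart ?p = q0" "pathfinish ?p = q0"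
    using base_loop_path[OF j] by blast+
  have loop: "base_loop m q \<epsilon> \<xi> j = path_class (- ?Q) ?p"
    by (simp add: base_loop_def)
  have f_cont: "continuous_on (- ?Q) ?f"
    by (rule continuous_f)
  have sorted: "lex_pos n (?f q0) = id"
    by (rule lex_pos_base)
  have mono_f: "braid_monodromy n ?f q0 (base_loop m q \<epsilon> \<xi> j) = traced_braid n (?f \<circ> ?p)"
    unfolding loop using f_conf by (intro braid_monodromy_path_class f_cont p sorted) auto
  let ?loop = "induced_map (arr_complement l \<B>) (aff_line a v) (base_loop m q \<epsilon> \<xi> j)"
  let ?p' = "aff_line a v \<circ> ?p"
  have p': "path ?p'" "path_image ?p' \<subseteq> arr_complement l \<B>" "pathstart ?p' = aff_line a v q0" "pathfinish ?p' = aff_line a v q0"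
  proof -
    show "path ?p'"
      using p(1) continuous_on_aff_line by (rule path_continuous_image)
    show "path_image ?p' \<subseteq> arr_complement l \<B>"
      unfolding path_image_compose using image_mono[OF p(2)] into by (rule order_trans)
    show "pathstart ?p' = aff_line a v q0" "pathfinish ?p' = aff_line a v q0"
      by (simp_all only: pathstart_compose pathfinish_compose p(3,4))
  qed
  have "?loop = path_class (arr_complement l \<B>) ?p'"
    unfolding loop by (rule induced_map_path_class[OF continuous_on_aff_line into p(1,2)])
  \<comment> \<open>Both monodromies trace the same path of configurations: the loop is mapped into
    the complement first, or \<open>g\<close> is restricted to the line first.\<close>
  then have "braid_monodromy n g (aff_line a v q0) ?loop
      = traced_braid n (g \<circ> ?p')"
    using braid_monodromy_path_class[OF continuous_on_root_map[OF root] g_conf p'] sorted by simp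
  then show "braid_monodromy n g (aff_line a v q0) ?loop
      = braid_monodromy n ?f q0 (base_loop m q \<epsilon> \<xi> j)"
    unfolding mono_f by (simp only: o_assoc)
  have Vs': "distinct Vs" "set Vs = meeting_partition n ?f (q j)" using Vs by blast+
  have "map (\<lambda>V. braid_conj n (block_twist n V) (block_conjugator n (diagram_braid n ?D) V)) Vs
      = map (\<lambda>V. braid_conj n (block_twist n V) (?\<zeta> ?D V)) Vs"
  proof (rule map_cong[OF refl])
    fix V assume "V \<in> set Vs"
    then have "block_conjugator n (diagram_braid n ?D) V \<in> carrier (pure_braid_group n)"
      by (rule traced_braid_base_loop(2)[OF j Vs'])
    then show "braid_conj n (block_twist n V) (block_conjugator n (diagram_braid n ?D) V)
        = braid_conj n (block_twist n V) (?\<zeta> ?D V)"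
      by (simp only: if_True)
  qed
  then show "braid_monodromy n ?f q0 (base_loop m q \<epsilon> \<xi> j)
      = braid_word n (map (\<lambda>V. braid_conj n (block_twist n V) (?\<zeta> ?D V)) Vs)"
    unfolding mono_f traced_braid_base_loop(1)[OF j Vs'] by (rule arg_cong)
qed

end
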